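(* Let $0<\gamma<1$ and $n\to\infty$. For each edge $e$ of the complete graph $K_n$ let $W_e$ and $C_e$ be independent copies of $U^\gamma$, where $U$ is uniform on $[0,1]$, all these random variables being independent. For a spanning tree $T$ put $W(T)=\sum_{e\in T}W_e$, $C(T)=\sum_{e\in T}C_e$, and let $W^*$ be the minimum of $W(T)$ over spanning trees $T$ with $C(T)\le c_0$. Suppose $$n^{1-\gamma}\log^{\gamma/2}n\ll c_0\ll\frac{n}{\log^{\gamma/2}n}.$$ Then with high probability $$W^*\approx\frac{C_\gamma^2 n^{2-\gamma}}{4c_0},\qquad\text{where } C_\gamma=\frac{\gamma}{2}\frac{\Gamma(2/\gamma+1)^{\gamma/2}}{\Gamma(1/\gamma+1)^{\gamma}}\sum_{k=1}^\infty\frac{\Gamma(k+\gamma/2-1)}{k^{\gamma/2+1}k!}.$$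
   Context: $a\ll b$ means $a/b\to0$ as $n\to\infty$. "With high probability" means with probability tending to $1$ as $n\to\infty$. $A\approx B$ means $A=(1+o(1))B$. $\Gamma$ is the gamma function. *)

theory Defs
  imports "HOL-Probability.Probability"
begin

text \<open>Undirected simple graphs on the vertex set \<open>{..<n}\<close> are given by their sets of
  edges, an edge being a two-element set of vertices.\<close>

definition complete_edges :: "nat \<Rightarrow> nat set set" where
  "complete_edges n = {{u, v} | u v. u < n \<and> v < n \<and> u \<noteq> v}"

definition adjacency :: "nat set set \<Rightarrow> (nat \<times> nat) set" where
  "adjacency T = {(u, v). {u, v} \<in> T}"

definition is_cycle :: "nat set set \<Rightarrow> nat list \<Rightarrow> bool" where
  "is_cycle T vs \<longleftrightarrow> 3 \<le> length vs \<and> distinct vs \<and>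
     (\<forall>i<length vs. {vs ! i, vs ! (Suc i mod length vs)} \<in> T)"

definition spanning_tree :: "nat \<Rightarrow> nat set set \<Rightarrow> bool" where
  "spanning_tree n T \<longleftrightarrow> T \<subseteq> complete_edges n \<and>
     (\<forall>u<n. \<forall>v<n. (u, v) \<in> (adjacency T)\<^sup>*) \<and> (\<nexists>vs. is_cycle T vs)"

text \<open>The infimum ranges over a finite set, so it is a minimum whenever some spanning tree
  satisfies the cost constraint; otherwise it is \<open>\<infinity>\<close>.\<close>

definition min_constrained_weight ::
    "nat \<Rightarrow> (nat set \<Rightarrow> real) \<Rightarrow> (nat set \<Rightarrow> real) \<Rightarrow> real \<Rightarrow> ereal" where
  "min_constrained_weight n w c b =
     (INF T \<in> {T. spanning_tree n T \<and> (\<Sum>e\<in>T. c e) \<le> b}. ereal (\<Sum>e\<in>T. w e))"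

definition uniform_power_law :: "real \<Rightarrow> real measure" where
  "uniform_power_law \<gamma> = distr (uniform_measure lborel {0..1}) borel (\<lambda>u. u powr \<gamma>)"

definition C_const :: "real \<Rightarrow> real" where
  "C_const \<gamma> = \<gamma> / 2 * (Gamma (2 / \<gamma> + 1) powr (\<gamma> / 2) / Gamma (1 / \<gamma> + 1) powr \<gamma>) *
     (\<Sum>j. let k = Suc j in
        Gamma (real k + \<gamma> / 2 - 1) / (real k powr (\<gamma> / 2 + 1) * fact k))"

text \<open>With high probability \<open>A = (1 + o(1)) B\<close>, the bound \<open>\<delta>\<close> on the \<open>o(1)\<close> term being
  deterministic. Since \<open>ereal\<close> of a real number is finite, the event
  excludes \<open>A n \<omega> = \<infinity>\<close>.\<close>

definition whp_approx ::
    "(nat \<Rightarrow> 'a measure) \<Rightarrow> (nat \<Rightarrow> 'a \<Rightarrow> ereal) \<Rightarrow> (nat \<Rightarrow> real) \<Rightarrow> bool" where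
  "whp_approx M A B \<longleftrightarrow> (\<exists>\<delta> :: nat \<Rightarrow> real. \<delta> \<longlonglongrightarrow> 0 \<and>
     (\<lambda>n. measure (M n)
        {\<omega> \<in> space (M n). \<exists>r. \<bar>r\<bar> \<le> \<delta> n \<and> A n \<omega> = ereal ((1 + r) * B n)}) \<longlonglongrightarrow> 1)"

end

(* For l > 0 let phi(l) be the minimum over spanning trees of W(T) + l C(T). Kruskal's algorithm
   expresses this minimum as an integral over x of the number of components (minus one) of the
   random graph G(n, x/n), because P(W_e + l C_e <= t) is a constant times l^(-1/gamma) t^(2/gamma)
   for small t. The number of components has variance at most the expected number of edges, and
   its mean is n E(1/|component|), where the limiting component sizes follow the Borel
   distribution; integrating term by term gives phi(l) ~ C_gamma n^(1 - gamma/2) sqrt l.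
   Lagrangian duality, max over l of phi(l) - l c_0, then yields the lower bound. As the limiting
   dual function is strictly concave, comparing an optimal tree for a slightly larger multiplier
   with the dual bounds on both sides shows that it is feasible and almost attains that bound. *)
theory Submission
  imports Defs "HOL-Real_Asymp.Real_Asymp"
begin

section \<open>Connected components and Kruskal's algorithm\<close>

text \<open>The substitution t = s x^b with b = \<gamma>/2, which makes P(W_e + l C_e <= t) equal to
  x/n, is exact as long as {w + l c <= t} stays inside the support of the pair, that is for t <= min
  1 l. Thresholds need only be followed up to x = 4 ln n, where the graph is already connected with
  high probability. For l near the optimal multiplier, the requirements s (4 ln n)^b <= 1 and s (4
  ln n)^b <= l follow from the lower and the upper growth condition on c_0 respectively; this is the
  origin of the logarithms. The obstacle to the upper bound is that a minimiser of W + l C may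
  violate the cost constraint and that a discrete problem can have a duality gap. Since the dual
  bounds are proportional to sqrt l, knowing them up to relative errors of order \<eta>^2 at
  multipliers a relative distance of order \<eta> apart determines the slope C(T) up to order
  \<eta>. Three multipliers suffice, so no statement uniform in l is required. Supercritical x needs
  no separate treatment: a giant component contributes almost nothing to the mean of
  1/|component|.\<close>

lemma finite_complete_edges [simp]: "finite (complete_edges n)"
proof (rule finite_subset)
  show "complete_edges n \<subseteq> Pow {..<n}"
    by (auto simp: complete_edges_def)
qed simp

lemma finite_edges: "T \<subseteq> complete_edges n \<Longrightarrow> finite T"
  by (rule finite_subset[OF _ finite_complete_edges])

lemma complete_edgesE:
  assumes "e \<in> complete_edges n"
  obtains a b where "e = {a, b}" "a < n" "b < n" "a \<noteq> b"
  using assms by (auto simp: complete_edges_def)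

lemma card_complete_edges_le: "card (complete_edges n) \<le> n\<^sup>2"
proof -
  have "complete_edges n \<subseteq> (\<lambda>(u, v). {u, v}) ` ({..<n} \<times> {..<n})"
    by (auto simp: complete_edges_def)
  then have "card (complete_edges n) \<le> card ((\<lambda>(u, v). {u, v}) ` ({..<n} \<times> {..<n}))"
    by (intro card_mono) auto
  also have "\<dots> \<le> card ({..<n} \<times> {..<n})"
    by (rule card_image_le) simp
  finally show ?thesis
    by (simp add: power2_eq_square)
qed

definition component :: "nat set set \<Rightarrow> nat \<Rightarrow> nat set" where
  "component T v = (adjacency T)\<^sup>* `` {v}"

definition ncomp :: "nat \<Rightarrow> nat set set \<Rightarrow> nat" where
  "ncomp n T = card (component T ` {..<n})"

lemma sym_adjacency: "sym (adjacency T)"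
  by (auto simp: sym_def adjacency_def insert_commute)

lemma component_refl [simp]: "v \<in> component T v"
  by (simp add: component_def)

lemma component_eq: "w \<in> component T v \<Longrightarrow> component T w = component T v"
  using sym_rtrancl[OF sym_adjacency, of T]
  by (auto simp: component_def sym_def) (meson rtrancl_trans)+

lemma component_sym: "w \<in> component T v \<longleftrightarrow> v \<in> component T w"
  using component_eq component_refl by blast

lemma component_subset:
  assumes "T \<subseteq> complete_edges n" "v < n"
  shows "component T v \<subseteq> {..<n}"
proof
  fix u assume "u \<in> component T v"
  then have "(v, u) \<in> (adjacency T)\<^sup>*" by (simp add: component_def)
  then show "u \<in> {..<n}"
  proof (induction rule: rtrancl_induct)
    case base
    then show ?case using assms by simp
  next
    case (step y z)
    then have "{y, z} \<in> complete_edges n" using assms by (auto simp: adjacency_def)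
    then show ?case by (auto simp: complete_edges_def doubleton_eq_iff)
  qed
qed

lemma adjacency_insert:
  "adjacency (insert {a, b} T) = insert (a, b) (insert (b, a) (adjacency T))"
  by (auto simp: adjacency_def doubleton_eq_iff)

text \<open>Expresses the new components through \<open>component T\<close> alone, so two edge sets
  with the same components keep the same components when one edge is added to both;
  \<open>kruskal\<close> relies on this.\<close>

lemma component_insert:
  "component (insert {a, b} T) v =
     (if v \<in> component T a \<union> component T b then component T a \<union> component T b else component T v)"
proof -
  let ?R = "\<lambda>x y. (x, y) \<in> (adjacency T)\<^sup>*"
  have sy: "\<And>x y. ?R x y \<Longrightarrow> ?R y x"
    using sym_rtrancl[OF sym_adjacency] by (auto simp: sym_def)
  have tr: "\<And>x y z. ?R x y \<Longrightarrow> ?R y z \<Longrightarrow> ?R x z"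
    by (rule rtrancl_trans)
  have "(v, x) \<in> (adjacency (insert {a, b} T))\<^sup>* \<longleftrightarrow>
      (if ?R a v \<or> ?R b v then ?R a x \<or> ?R b x else ?R v x)" for x
  proof -
    have "(v, x) \<in> (adjacency (insert {a, b} T))\<^sup>* \<longleftrightarrow>
        ?R v x \<or> (?R v a \<and> ?R b x) \<or> (?R v b \<and> ?R a x)"
      unfolding adjacency_insert rtrancl_insert by (auto intro: tr)
    moreover have "?R v a \<longleftrightarrow> ?R a v" "?R v b \<longleftrightarrow> ?R b v"
      using sy by blast+
    moreover have "?R a v \<Longrightarrow> ?R v x \<longleftrightarrow> ?R a x" "?R b v \<Longrightarrow> ?R v x \<longleftrightarrow> ?R b x"
      using sy tr by meson+
    ultimately show ?thesis by auto
  qed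
  note this [simp]
  show ?thesis
    by (rule set_eqI) (simp add: component_def)
qed

lemma component_insert_connected: "b \<in> component T a \<Longrightarrow> component (insert {a, b} T) = component T"
  using component_eq[of _ T] by (auto simp: fun_eq_iff component_insert)

lemma rtrancl_adjacency_eqI: "component S = component T \<Longrightarrow> (adjacency S)\<^sup>* = (adjacency T)\<^sup>*"
  by (auto simp: fun_eq_iff component_def set_eq_iff)

lemma ncomp_insert_connected: "b \<in> component T a \<Longrightarrow> ncomp n (insert {a, b} T) = ncomp n T"
  by (simp add: ncomp_def component_insert_connected)

lemma ncomp_insert_disconnected:
  assumes "b \<notin> component T a" "a < n" "b < n"
  shows "Suc (ncomp n (insert {a, b} T)) = ncomp n T"
proof -
  define I where "I = component T ` {..<n}"
  have ne: "component T a \<noteq> component T b"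
    using assms(1) component_refl by blast
  have joined: "component (insert {a, b} T) v = component T a \<union> component T b" if "v \<in> component T a \<union> component T b" for v
    using that by (simp add: component_insert)
  have other: "component (insert {a, b} T) v = component T v" "component T v \<noteq> component T a" "component T v \<noteq> component T b"
    if "v \<notin> component T a \<union> component T b" for v
    using that component_refl[of v T] by (simp_all add: component_insert, blast+)
  have "component (insert {a, b} T) ` {..<n} = insert (component T a \<union> component T b) (I - {component T a, component T b})"
  proof (intro equalityI subsetI)
    fix c assume "c \<in> component (insert {a, b} T) ` {..<n}"
    then obtain v where v: "v < n" "c = component (insert {a, b} T) v" by blast
    show "c \<in> insert (component T a \<union> component T b) (I - {component T a, component T b})"
    proof (cases "v \<in> component T a \<union> component T b")
      case True
      then show ?thesis using joined[of v] v by simp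
    next
      case False
      then show ?thesis using other[of v] v by (simp add: I_def)
    qed
  next
    fix c assume "c \<in> insert (component T a \<union> component T b) (I - {component T a, component T b})"
    then consider "c = component T a \<union> component T b"
      | v where "v < n" "c = component T v" "c \<noteq> component T a" "c \<noteq> component T b"
      unfolding I_def by blast
    then show "c \<in> component (insert {a, b} T) ` {..<n}"
    proof cases
      case 1
      then have "c = component (insert {a, b} T) a" by (simp add: joined)
      then show ?thesis using assms(2) by blast
    next
      case 2
      then have "v \<notin> component T a \<union> component T b"
        using component_eq[of v T a] component_eq[of v T b] by blast
      then have "c = component (insert {a, b} T) v"
        using other(1)[of v] 2 by simp
      then show ?thesis using 2 by blast
    qed
  qed
  moreover have "component T a \<union> component T b \<notin> I"
  proof
    assume "component T a \<union> component T b \<in> I"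
    then obtain v where v: "component T a \<union> component T b = component T v" by (auto simp: I_def)
    then have "a \<in> component T v" "b \<in> component T v"
      using component_refl[of a T] component_refl[of b T] by blast+
    then show False
      using ne component_eq by metis
  qed
  moreover have "finite I" "component T a \<in> I" "component T b \<in> I"
    using assms by (auto simp: I_def)
  moreover have "card (I - {component T a, component T b}) = card I - 2" 
    using ne calculation by (subst card_Diff_subset) auto
  \<comment> \<open>Rules out that the natural number subtraction \<open>card I - 2\<close> is cut
    off at 0.\<close>
  moreover have "card {component T a, component T b} \<le> card I"
    using calculation by (intro card_mono) auto
  ultimately show ?thesis
    using ne by (simp add: ncomp_def I_def)
qed

lemma ncomp_insert_bounds:
  assumes "e \<in> complete_edges n"
  shows "ncomp n (insert e T) \<le> ncomp n T" "ncomp n T \<le> Suc (ncomp n (insert e T))"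
proof -
  obtain a b where "e = {a, b}" "a < n" "b < n"
    using assms by (rule complete_edgesE)
  then show "ncomp n (insert e T) \<le> ncomp n T" "ncomp n T \<le> Suc (ncomp n (insert e T))"
    using ncomp_insert_connected[of b T a n] ncomp_insert_disconnected[of b T a n]
    by (cases "b \<in> component T a"; simp)+
qed

lemma ncomp_union_bounds:
  assumes "F \<subseteq> complete_edges n"
  shows "ncomp n (G \<union> F) \<le> ncomp n G" "ncomp n G \<le> ncomp n (G \<union> F) + card F"
proof -
  have "finite F" using assms by (rule finite_edges)
  then have "ncomp n (G \<union> F) \<le> ncomp n G \<and> ncomp n G \<le> ncomp n (G \<union> F) + card F"
    using assms
  proof (induction F rule: finite_induct)
    case empty
    then show ?case by simp
  next
    case (insert e F)
    then have "ncomp n (insert e (G \<union> F)) \<le> ncomp n (G \<union> F)"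
        "ncomp n (G \<union> F) \<le> Suc (ncomp n (insert e (G \<union> F)))"
      using ncomp_insert_bounds[of e n "G \<union> F"] by auto
    then show ?case using insert by auto
  qed
  then show "ncomp n (G \<union> F) \<le> ncomp n G" "ncomp n G \<le> ncomp n (G \<union> F) + card F" by auto
qed

lemma ncomp_antimono:
  assumes "G \<subseteq> H" "H \<subseteq> complete_edges n"
  shows "ncomp n H \<le> ncomp n G"
  using ncomp_union_bounds(1)[of H n G] assms by (simp add: sup.absorb2)

lemma ncomp_empty [simp]: "ncomp n {} = n"
proof -
  have "component {} = (\<lambda>v. {v})"
    by (auto simp: component_def adjacency_def fun_eq_iff)
  then show ?thesis
    by (simp add: ncomp_def card_image)
qed

lemma ncomp_le: "ncomp n T \<le> n"
  unfolding ncomp_def using card_image_le[of "{..<n}" "component T"] by simp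

lemma ncomp_connected:
  assumes "n > 0" "\<forall>u<n. \<forall>v<n. (u, v) \<in> (adjacency T)\<^sup>*"
  shows "ncomp n T = 1"
proof -
  have root: "component T v = component T 0" if "v < n" for v
    using assms that by (intro component_eq) (auto simp: component_def)
  have "component T ` {..<n} = (\<lambda>_. component T 0) ` {..<n}"
    by (rule image_cong[OF refl]) (rule root, simp)
  also have "\<dots> = {component T 0}"
    using assms(1) by (simp add: image_constant_conv lessThan_empty_iff)
  finally show ?thesis by (simp add: ncomp_def)
qed

lemma complete_edges_connected:
  assumes "u < n" "v < n"
  shows "(u, v) \<in> (adjacency (complete_edges n))\<^sup>*"
proof (cases "u = v")
  case False
  then have "(u, v) \<in> adjacency (complete_edges n)"
    using assms by (auto simp: adjacency_def complete_edges_def)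
  then show ?thesis by (rule r_into_rtrancl)
qed simp

lemma ncomp_complete: "n > 0 \<Longrightarrow> ncomp n (complete_edges n) = 1"
  by (intro ncomp_connected allI impI complete_edges_connected)

text \<open>The half of Kruskal's formula that every spanning tree satisfies: the light edges of
  \<open>T\<close> lie in the threshold graph, and putting back the heavy ones, each of which
  removes at most one component, connects everything. For the tree of
  \<open>minimum_spanning_tree\<close> there is equality.\<close>

lemma spanning_tree_ncomp_le:
  assumes "n > 0" "spanning_tree n T" "T \<subseteq> E" "E \<subseteq> complete_edges n"
  shows "ncomp n {e \<in> E. X e \<le> (t :: real)} \<le> Suc (card {e \<in> T. X e > t})"
proof -
  have "ncomp n {e \<in> E. X e \<le> t} \<le> ncomp n {e \<in> T. X e \<le> t}"
    using assms by (intro ncomp_antimono) auto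
  also have "\<dots> \<le> ncomp n ({e \<in> T. X e \<le> t} \<union> {e \<in> T. X e > t}) + card {e \<in> T. X e > t}"
    using assms by (intro ncomp_union_bounds) auto
  also have "{e \<in> T. X e \<le> t} \<union> {e \<in> T. X e > t} = T" by auto
  also have "ncomp n T = 1"
    using assms by (intro ncomp_connected) (auto simp: spanning_tree_def)
  finally show ?thesis by simp
qed

text \<open>Kruskal's algorithm: scanning the edges by increasing weight, an edge is kept iff it joins
  two components.\<close>
lemma kruskal:
  fixes X :: "nat set \<Rightarrow> real"
  assumes "E \<subseteq> complete_edges n"
  shows "\<exists>T \<subseteq> E. component T = component E \<and>
           (\<forall>t. card {e \<in> T. X e > t} + ncomp n E = ncomp n {e \<in> E. X e \<le> t})"
proof -
  have "finite E" using assms by (rule finite_edges)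
  then show ?thesis using assms
  proof (induction E rule: finite_ranking_induct[where f = X])
    case empty
    then show ?case by auto
  next
    \<comment> \<open>The ranking induction makes \<open>e\<close> at least as heavy as every edge
      of \<open>E\<close>, so from the threshold \<open>X e\<close> on nothing is cut off. It does
      not make \<open>e\<close> a new edge, hence the case distinction below.\<close>
    case (insert e E)
    then obtain T where T: "T \<subseteq> E" "component T = component E"
      "\<And>t. card {e \<in> T. X e > t} + ncomp n E = ncomp n {e \<in> E. X e \<le> t}"
      by auto
    have finT: "finite T" using T(1) insert(1) by (rule finite_subset)
    obtain a b where e: "e = {a, b}" "a < n" "b < n"
      using insert.prems by (auto elim: complete_edgesE)
    show ?case
    proof (cases "e \<in> E")
      case True
      then have "insert e E = E" by auto
      then show ?thesis using T by auto
    next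
      case nE: False
      have below: "{e' \<in> insert e E. X e' \<le> t} = {e' \<in> E. X e' \<le> t}" if "t < X e" for t
        using that by auto
      have above: "{e' \<in> insert e E. X e' \<le> t} = insert e E" "{e' \<in> E. X e' \<le> t} = E"
          "{e' \<in> insert e T. X e' > t} = {}" if "t \<ge> X e" for t
        using that insert(2) T(1) by force+
      show ?thesis
      proof (cases "b \<in> component E a")
        case True
        have eq: "component (insert e E) = component E" "ncomp n (insert e E) = ncomp n E"
          using True e component_insert_connected ncomp_insert_connected by auto
        have "card {e \<in> T. X e > t} + ncomp n (insert e E) = ncomp n {e' \<in> insert e E. X e' \<le> t}" for t
          using T(3)[of t] below[of t] above[of t] eq by (cases "t < X e") auto
        then show ?thesis using T eq by (intro exI[of _ T]) auto
      next
        case False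
        have suc: "Suc (ncomp n (insert e E)) = ncomp n E"
          using False e ncomp_insert_disconnected by auto
        have c: "component (insert e T) = component (insert e E)"
          unfolding e by (simp add: fun_eq_iff component_insert T(2))
        have k: "card {e' \<in> insert e T. X e' > t} + ncomp n (insert e E) =
            ncomp n {e' \<in> insert e E. X e' \<le> t}" for t
        proof (cases "t < X e")
          case True
          then have "{e' \<in> insert e T. X e' > t} = insert e {e' \<in> T. X e' > t}" by auto
          moreover have "e \<notin> T" using nE T(1) by auto
          ultimately have "card {e' \<in> insert e T. X e' > t} = Suc (card {e' \<in> T. X e' > t})"
            using finT by simp
          then show ?thesis using T(3)[of t] suc below[OF True] by auto
        next
          case False
          then have "X e \<le> t" by simp
          show ?thesis
            unfolding above[OF \<open>X e \<le> t\<close>] by simp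
        qed
        have "insert e T \<subseteq> insert e E"
          using T(1) by blast
        then show ?thesis
          by (rule exI[where x = "insert e T", OF conjI]) (intro conjI c allI k)
      qed
    qed
  qed
qed

text \<open>Deleting the edge that closes the cycle leaves its other edges as a path between the two
  ends.\<close>

lemma cycle_edge_redundant:
  assumes "is_cycle T vs"
  obtains a b where "{a, b} \<in> T" "b \<in> component (T - {{a, b}}) a"
proof -
  define k where "k = length vs - 1"
  have len: "3 \<le> length vs" and dist: "distinct vs" and
    ed: "\<And>i. i < length vs \<Longrightarrow> {vs ! i, vs ! (Suc i mod length vs)} \<in> T"
    using assms by (auto simp: is_cycle_def)
  define e where "e = {vs ! 0, vs ! k}"
  have "e \<in> T"
  proof -
    have "Suc k = length vs" using len by (simp add: k_def)
    then show ?thesis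
      using ed[of k] by (simp add: e_def insert_commute flip: \<open>Suc k = length vs\<close>)
  qed
  moreover have "vs ! i \<in> component (T - {e}) (vs ! 0)" if "i \<le> k" for i
    using that
  proof (induction i)
    case 0
    then show ?case by simp
  next
    case (Suc i)
    have lt: "Suc i < length vs" "0 < length vs" "k < length vs" "i < length vs"
      using Suc.prems len by (auto simp: k_def)
    then have "{vs ! i, vs ! Suc i} \<in> T"
      using ed[of i] by simp
    \<comment> \<open>A path edge equal to the closing edge would force \<open>k = 1\<close>, which
      the length of at least 3 excludes.\<close>
    moreover have "{vs ! i, vs ! Suc i} \<noteq> e"
    proof
      assume "{vs ! i, vs ! Suc i} = e"
      then have "(i = 0 \<and> Suc i = k) \<or> (i = k \<and> Suc i = 0)"
        using dist lt by (auto simp: e_def doubleton_eq_iff nth_eq_iff_index_eq)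
      then show False using len by (auto simp: k_def)
    qed
    ultimately have "(vs ! i, vs ! Suc i) \<in> adjacency (T - {e})"
      by (simp add: adjacency_def)
    then show ?case
      using Suc by (auto simp: component_def intro: rtrancl_into_rtrancl)
  qed
  ultimately show ?thesis
    using that[of "vs ! 0" "vs ! k"] by (simp add: e_def)
qed

text \<open>A graph has at least \<open>n - ncomp\<close> edges, because each edge removes at most
  one component. Deleting a suitable edge of a cycle would keep the components and go below this
  bound.\<close>

lemma acyclic_if_card:
  assumes "T \<subseteq> complete_edges n" "card T + ncomp n T = n"
  shows "\<not> is_cycle T vs"
proof
  assume "is_cycle T vs"
  then obtain a b where ab: "{a, b} \<in> T" "b \<in> component (T - {{a, b}}) a"
    by (rule cycle_edge_redundant)
  have "n \<le> ncomp n (T - {{a, b}}) + card (T - {{a, b}})"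
    using ncomp_union_bounds(2)[of "T - {{a, b}}" n "{}"] assms(1) by auto
  moreover have "ncomp n (T - {{a, b}}) = ncomp n T"
    using ncomp_insert_connected[OF ab(2), of n] ab(1) by (simp add: insert_absorb)
  moreover have "card (T - {{a, b}}) < card T"
    using ab finite_edges[OF assms(1)] by (intro card_Diff1_less) auto
  ultimately show False using assms(2) by simp
qed

lemma minimum_spanning_tree:
  fixes X :: "nat set \<Rightarrow> real"
  assumes "n > 0"
  obtains T where "spanning_tree n T"
    "\<And>t. Suc (card {e \<in> T. X e > t}) = ncomp n {e \<in> complete_edges n. X e \<le> t}"
proof -
  obtain T where T: "T \<subseteq> complete_edges n" "component T = component (complete_edges n)"
    "\<And>t. card {e \<in> T. X e > t} + ncomp n (complete_edges n)
       = ncomp n {e \<in> complete_edges n. X e \<le> t}"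
    using kruskal[of "complete_edges n" n X] by auto
  have finT: "finite T" using T(1) by (rule finite_edges)
  have conn: "\<forall>u<n. \<forall>v<n. (u, v) \<in> (adjacency T)\<^sup>*"
  proof (intro allI impI)
    fix u v assume "u < n" "v < n"
    then have "(u, v) \<in> (adjacency (complete_edges n))\<^sup>*"
      by (rule complete_edges_connected)
    then show "(u, v) \<in> (adjacency T)\<^sup>*"
      using rtrancl_adjacency_eqI[OF T(2)] by simp
  qed
  \<comment> \<open>Lies below all weights: the threshold graph at \<open>t0\<close> is empty, and
    Kruskal's formula at \<open>t0\<close> counts all edges of \<open>T\<close>.\<close>
  define t0 where "t0 = - (\<Sum>e\<in>complete_edges n. \<bar>X e\<bar>) - 1"
  have big: "X e > t0" if "e \<in> complete_edges n" for e
    using member_le_sum[OF that, of "\<lambda>e. \<bar>X e\<bar>"] by (simp add: t0_def)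
  have all: "{e \<in> T. X e > t0} = T" "{e \<in> complete_edges n. X e \<le> t0} = {}"
    using big T(1) by force+
  have "ncomp n T = ncomp n (complete_edges n)"
    by (simp add: ncomp_def T(2))
  then have "card T + ncomp n T = n"
    using T(3)[of t0] unfolding all ncomp_empty by simp
  then have "spanning_tree n T"
    using acyclic_if_card[OF T(1)] T(1) conn by (auto simp: spanning_tree_def)
  then show ?thesis
    using that T(3) ncomp_complete[OF assms] by simp
qed

section \<open>Bernoulli random subsets and component exploration\<close>

text \<open>\<open>bexp E p f\<close> is the expectation of \<open>f\<close> at the random subset of \<open>E\<close> that contains each
  element independently with probability \<open>p\<close>.\<close>
definition bexp :: "'b set \<Rightarrow> real \<Rightarrow> ('b set \<Rightarrow> real) \<Rightarrow> real" where
  "bexp E p f = (\<Sum>A\<in>Pow E. p ^ card A * (1 - p) ^ card (E - A) * f A)"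

lemma bexp_cong: "(\<And>A. A \<subseteq> E \<Longrightarrow> f A = g A) \<Longrightarrow> bexp E p f = bexp E p g"
  by (auto simp: bexp_def intro!: sum.cong)

lemma bexp_add: "bexp E p (\<lambda>A. f A + g A) = bexp E p f + bexp E p g"
  by (simp add: bexp_def distrib_left sum.distrib)

lemma bexp_cmult: "bexp E p (\<lambda>A. c * f A) = c * bexp E p f"
  by (simp add: bexp_def sum_distrib_left mult_ac)

lemma bexp_diff: "bexp E p (\<lambda>A. f A - g A) = bexp E p f - bexp E p g"
  by (simp add: bexp_def right_diff_distrib sum_subtractf)

lemma bexp_sum: "bexp E p (\<lambda>A. \<Sum>i\<in>I. f i A) = (\<Sum>i\<in>I. bexp E p (f i))"
  unfolding bexp_def sum_distrib_left by (rule sum.swap)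

lemma bexp_mono:
  assumes "0 \<le> p" "p \<le> 1" "\<And>A. A \<subseteq> E \<Longrightarrow> f A \<le> g A"
  shows "bexp E p f \<le> bexp E p g"
  unfolding bexp_def using assms by (intro sum_mono mult_left_mono) auto

text \<open>Independence of disjoint edge sets in the form of Fubini's theorem: the weight of a
  union is the product of the weights.\<close>

lemma bexp_union:
  assumes "finite E1" "finite E2" "E1 \<inter> E2 = {}"
  shows "bexp (E1 \<union> E2) p f = bexp E1 p (\<lambda>A. bexp E2 p (\<lambda>B. f (A \<union> B)))"
proof -
  let ?w = "\<lambda>E A. p ^ card A * (1 - p) ^ card (E - A)"
  have "bexp (E1 \<union> E2) p f =
      (\<Sum>(A, B)\<in>Pow E1 \<times> Pow E2. ?w (E1 \<union> E2) (A \<union> B) * f (A \<union> B))"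
    unfolding bexp_def
    by (rule sum.reindex_bij_witness[of _ "\<lambda>(A, B). A \<union> B" "\<lambda>C. (C \<inter> E1, C \<inter> E2)"])
       (use assms in \<open>auto simp flip: Int_Un_distrib simp: Int_absorb2\<close>)
  also have "\<dots> = (\<Sum>(A, B)\<in>Pow E1 \<times> Pow E2. ?w E1 A * (?w E2 B * f (A \<union> B)))"
  proof (intro sum.cong refl, clarify)
    fix A B assume AB: "A \<subseteq> E1" "B \<subseteq> E2"
    have "card (A \<union> B) = card A + card B"
      using AB assms by (intro card_Un_disjoint) (auto intro: finite_subset)
    moreover have "E1 \<union> E2 - (A \<union> B) = (E1 - A) \<union> (E2 - B)"
      using AB assms by auto
    moreover have "card ((E1 - A) \<union> (E2 - B)) = card (E1 - A) + card (E2 - B)"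
      using assms by (intro card_Un_disjoint) auto
    ultimately show "?w (E1 \<union> E2) (A \<union> B) * f (A \<union> B) = ?w E1 A * (?w E2 B * f (A \<union> B))"
      by (simp add: power_add)
  qed
  finally show ?thesis
    by (simp add: bexp_def sum.cartesian_product sum_distrib_left)
qed

lemma bexp_empty [simp]: "bexp {} p f = f {}"
  by (simp add: bexp_def)

lemma bexp_singleton: "bexp {e} p f = (1 - p) * f {} + p * f {e}"
  by (simp add: bexp_def Pow_insert)

lemma bexp_insert:
  assumes "finite E" "e \<notin> E"
  shows "bexp (insert e E) p f = (1 - p) * bexp E p f + p * bexp E p (\<lambda>A. f (insert e A))"
  using bexp_union[of "{e}" E p f] assms by (simp add: bexp_singleton)

lemma bexp_const [simp]:
  assumes "finite E"
  shows "bexp E p (\<lambda>_. c) = c"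
  using assms by (induction rule: finite_induct) (simp_all add: bexp_insert algebra_simps)

lemma bexp_local:
  assumes "finite E" "D \<subseteq> E" "\<And>A. A \<subseteq> E \<Longrightarrow> f A = f (A \<inter> D)"
  shows "bexp E p f = bexp D p f"
proof -
  have "bexp (D \<union> (E - D)) p f = bexp D p (\<lambda>A. bexp (E - D) p (\<lambda>B. f (A \<union> B)))"
    using assms by (intro bexp_union) (auto intro: finite_subset)
  also have "\<dots> = bexp D p (\<lambda>A. bexp (E - D) p (\<lambda>B. f A))"
  proof (intro bexp_cong)
    fix A B assume "A \<subseteq> D" "B \<subseteq> E - D"
    then have "(A \<union> B) \<inter> D = A" "A \<union> B \<subseteq> E" using assms(2) by auto
    then show "f (A \<union> B) = f A" using assms(3)[of "A \<union> B"] by simp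
  qed
  also have "\<dots> = bexp D p f"
    using assms(1) by simp
  finally show ?thesis
    using assms(2) by (simp add: Un_absorb1)
qed

lemma bexp_image:
  assumes "inj_on \<phi> U"
  shows "bexp (\<phi> ` U) p f = bexp U p (\<lambda>N. f (\<phi> ` N))"
proof -
  have "inj_on ((`) \<phi>) (Pow U)"
    using assms by (rule inj_on_image_Pow)
  then have "bexp (\<phi> ` U) p f =
      (\<Sum>A\<in>Pow U. p ^ card (\<phi> ` A) * (1 - p) ^ card (\<phi> ` U - \<phi> ` A) * f (\<phi> ` A))"
    unfolding bexp_def by (subst image_Pow_surj[OF refl, symmetric], subst sum.reindex) simp_all
  also have "\<dots> = bexp U p (\<lambda>N. f (\<phi> ` N))"
    unfolding bexp_def
  proof (intro sum.cong refl)
    fix A assume "A \<in> Pow U"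
    then have "A \<subseteq> U" by simp
    then have "card (\<phi> ` A) = card A" "card (\<phi> ` (U - A)) = card (U - A)"
      using assms by (intro card_image; blast intro: inj_on_subset)+
    moreover have "\<phi> ` U - \<phi> ` A = \<phi> ` (U - A)"
      using inj_on_image_set_diff[OF assms, of U A] \<open>A \<subseteq> U\<close> by simp
    ultimately show "p ^ card (\<phi> ` A) * (1 - p) ^ card (\<phi> ` U - \<phi> ` A) * f (\<phi> ` A) =
        p ^ card A * (1 - p) ^ card (U - A) * f (\<phi> ` A)" by simp
  qed
  finally show ?thesis .
qed

lemma bexp_card:
  assumes "finite U"
  shows "bexp U p (\<lambda>N. h (card N)) =
    (\<Sum>i\<le>card U. real (card U choose i) * p ^ i * (1 - p) ^ (card U - i) * h i)"
proof -
  let ?m = "card U"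
  have "bexp U p (\<lambda>N. h (card N)) = (\<Sum>N\<in>Pow U. p ^ card N * (1 - p) ^ (?m - card N) * h (card N))"
    unfolding bexp_def
    using assms by (intro sum.cong refl) (auto simp: card_Diff_subset finite_subset)
  also have "\<dots> = (\<Sum>i\<le>?m. \<Sum>N\<in>{N \<in> Pow U. card N = i}. p ^ card N * (1 - p) ^ (?m - card N) * h (card N))"
    using assms by (intro sum.group[symmetric]) (auto intro: card_mono)
  also have "\<dots> = (\<Sum>i\<le>?m. \<Sum>N\<in>{N \<in> Pow U. card N = i}. p ^ i * (1 - p) ^ (?m - i) * h i)"
    by (intro sum.cong refl) auto
  also have "\<dots> = (\<Sum>i\<le>?m. real (card {N. N \<subseteq> U \<and> card N = i}) * (p ^ i * (1 - p) ^ (?m - i) * h i))"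
    by simp
  finally show ?thesis
    using n_subsets[OF assms] by (simp add: mult_ac)
qed

text \<open>An Efron-Stein type bound by induction on the edges. Conditioning on one edge splits the
  variance into the average of the two conditional variances and p(1-p)(m1 - m0)^2; the Lipschitz
  condition bounds the last term by p.\<close>

lemma bexp_variance:
  assumes "finite E" "0 \<le> p" "p \<le> 1"
    and "\<And>e A. e \<in> E \<Longrightarrow> A \<subseteq> E \<Longrightarrow> \<bar>f (insert e A) - f A\<bar> \<le> 1"
  shows "bexp E p (\<lambda>A. (f A)\<^sup>2) - (bexp E p f)\<^sup>2 \<le> real (card E) * p"
  using assms(1,4)
proof (induction E arbitrary: f rule: finite_induct)
  case empty
  then show ?case by simp
next
  case (insert e E)
  define g where "g A = f (insert e A)" for A
  define m0 m1 where "m0 = bexp E p f" and "m1 = bexp E p g"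
  have V0: "bexp E p (\<lambda>A. (f A)\<^sup>2) - m0\<^sup>2 \<le> real (card E) * p"
    unfolding m0_def using insert.prems by (intro insert.IH) auto
  have V1: "bexp E p (\<lambda>A. (g A)\<^sup>2) - m1\<^sup>2 \<le> real (card E) * p"
    unfolding m1_def
  proof (rule insert.IH)
    fix e' A assume "e' \<in> E" "A \<subseteq> E"
    then show "\<bar>g (insert e' A) - g A\<bar> \<le> 1"
      using insert.prems[of e' "insert e A"] by (auto simp: g_def insert_commute)
  qed
  have diff: "g A - f A \<le> 1" "-1 \<le> g A - f A" if "A \<subseteq> E" for A
    using insert.prems[of e A] subset_insertI2[OF that, of e] by (simp_all add: g_def abs_le_iff)
  have "bexp E p (\<lambda>A. g A - f A) \<le> bexp E p (\<lambda>_. 1)"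
    using assms(2,3) diff(1) by (rule bexp_mono)
  moreover have "bexp E p (\<lambda>_. -1) \<le> bexp E p (\<lambda>A. g A - f A)"
    using assms(2,3) diff(2) by (rule bexp_mono)
  ultimately have "\<bar>m1 - m0\<bar> \<le> 1"
    using insert.hyps by (simp add: m0_def m1_def bexp_diff)
  then have sq: "(m1 - m0)\<^sup>2 \<le> 1"
    using abs_le_square_iff[of "m1 - m0" 1] by simp
  have "bexp (insert e E) p (\<lambda>A. (f A)\<^sup>2) - (bexp (insert e E) p f)\<^sup>2 =
      (1 - p) * bexp E p (\<lambda>A. (f A)\<^sup>2) + p * bexp E p (\<lambda>A. (g A)\<^sup>2) - ((1 - p) * m0 + p * m1)\<^sup>2"
    using insert.hyps by (simp add: bexp_insert m0_def m1_def g_def[abs_def])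
  also have "\<dots> = (1 - p) * (bexp E p (\<lambda>A. (f A)\<^sup>2) - m0\<^sup>2) + p * (bexp E p (\<lambda>A. (g A)\<^sup>2) - m1\<^sup>2)
      + p * (1 - p) * (m1 - m0)\<^sup>2"
    by (simp add: algebra_simps power2_eq_square)
  also have "\<dots> \<le> (1 - p) * (real (card E) * p) + p * (real (card E) * p) + p * 1 * 1"
    using V0 V1 sq assms(2,3) by (intro add_mono mult_left_mono mult_mono) auto
  also have "\<dots> = real (card (insert e E)) * p"
    using insert.hyps by (simp add: algebra_simps)
  finally show ?case .
qed

text \<open>The mean absolute deviation is at most the standard deviation, which amounts to
  nonnegativity of the variance of \<open>g\<close>.\<close>

lemma bexp_deviation:
  assumes "finite E" "0 \<le> p" "p \<le> 1"
    and "\<And>e A. e \<in> E \<Longrightarrow> A \<subseteq> E \<Longrightarrow> \<bar>f (insert e A) - f A\<bar> \<le> 1"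
  shows "bexp E p (\<lambda>A. \<bar>f A - bexp E p f\<bar>) \<le> sqrt (real (card E) * p)"
proof -
  define m where "m = bexp E p f"
  define g where "g A = \<bar>f A - m\<bar>" for A
  define a where "a = bexp E p g"
  have "0 \<le> bexp E p (\<lambda>A. (g A - a)\<^sup>2)"
    using bexp_mono[OF assms(2,3), of E "\<lambda>_. 0" "\<lambda>A. (g A - a)\<^sup>2"] assms(1) by simp
  also have "(\<lambda>A. (g A - a)\<^sup>2) = (\<lambda>A. ((f A)\<^sup>2 - 2 * m * f A) + m\<^sup>2 - 2 * a * g A + a\<^sup>2)"
    by (simp add: fun_eq_iff g_def power2_diff mult_ac)
  also have "bexp E p \<dots> = bexp E p (\<lambda>A. (f A)\<^sup>2) - m\<^sup>2 - a\<^sup>2"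
    using assms(1) by (simp add: bexp_add bexp_diff bexp_cmult flip: m_def a_def)
      (simp add: power2_eq_square)
  finally have "a\<^sup>2 \<le> bexp E p (\<lambda>A. (f A)\<^sup>2) - m\<^sup>2" by simp
  also have "\<dots> \<le> real (card E) * p"
    unfolding m_def using assms by (rule bexp_variance)
  finally have "a\<^sup>2 \<le> real (card E) * p" .
  then show ?thesis
    unfolding a_def[symmetric] g_def[symmetric] m_def[symmetric]
    by (rule real_le_rsqrt)
qed

section \<open>Exploration of a component, one active vertex at a time\<close>

inductive_set reached :: "nat set \<Rightarrow> nat set \<Rightarrow> nat set set \<Rightarrow> nat set" for A U T where
  base: "x \<in> A \<Longrightarrow> y \<in> U \<Longrightarrow> {x, y} \<in> T \<Longrightarrow> y \<in> reached A U T"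
| step: "x \<in> reached A U T \<Longrightarrow> y \<in> U \<Longrightarrow> {x, y} \<in> T \<Longrightarrow> y \<in> reached A U T"

lemma reached_subset: "reached A U T \<subseteq> U"
proof
  fix y assume "y \<in> reached A U T"
  then show "y \<in> U" by cases auto
qed

lemma reached_empty [simp]: "reached {} U T = {}"
proof -
  have False if "y \<in> reached {} U T" for y
    using that by induction auto
  then show ?thesis by auto
qed

lemma reached_mono:
  assumes "A \<subseteq> A'" "U \<subseteq> A' \<union> U'" "\<And>x y. x \<in> A \<union> U \<Longrightarrow> y \<in> U \<Longrightarrow> {x, y} \<in> T \<Longrightarrow> {x, y} \<in> T'"
  shows "reached A U T \<subseteq> A' \<union> reached A' U' T'"
proof
  fix y assume "y \<in> reached A U T"
  then show "y \<in> A' \<union> reached A' U' T'"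
  proof induction
    case (base x y)
    then show ?case
      using assms(3)[of x y] assms(1,2) by (auto intro: reached.base)
  next
    case (step x y)
    then have "{x, y} \<in> T'" "y \<in> A' \<union> U'"
      using assms(2,3) reached_subset[of A U T] by blast+
    then show ?case
      using step by (auto intro: reached.base reached.step)
  qed
qed

lemma reached_cong:
  assumes "\<And>x y. x \<in> A \<union> U \<Longrightarrow> y \<in> U \<Longrightarrow> {x, y} \<in> T \<longleftrightarrow> {x, y} \<in> T'" "A \<inter> U = {}"
  shows "reached A U T = reached A U T'"
  using reached_mono[of A A U U T T'] reached_mono[of A A U U T' T] assms
    reached_subset[of A U T] reached_subset[of A U T'] by blast

text \<open>One step of the exploration, with \<open>A\<close> the active and \<open>U\<close> the
  undiscovered vertices: the processed vertex \<open>v\<close> is dropped and its neighbours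
  \<open>N\<close> become active. If \<open>v\<close> is not in \<open>A\<close>, no edge at
  \<open>v\<close> is inspected again, so the rest of the exploration is independent of what this
  step reveals.\<close>

lemma reached_insert:
  assumes "v \<notin> U" and N: "N = {u \<in> U. {v, u} \<in> T}"
  shows "reached (insert v A) U T = N \<union> reached (A \<union> N) (U - N) T"
proof (intro equalityI subsetI)
  fix y assume "y \<in> reached (insert v A) U T"
  then show "y \<in> N \<union> reached (A \<union> N) (U - N) T"
  proof induction
    case (base x y)
    then show ?case
      by (cases "y \<in> N"; cases "x = v") (auto simp: N intro: reached.base)
  next
    case (step x y)
    then show ?case
      by (cases "y \<in> N") (auto intro: reached.base reached.step)
  qed
next
  fix y assume "y \<in> N \<union> reached (A \<union> N) (U - N) T"
  then show "y \<in> reached (insert v A) U T"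
  proof
    assume "y \<in> N"
    then show ?thesis by (auto simp: N intro: reached.base)
  next
    assume "y \<in> reached (A \<union> N) (U - N) T"
    then show ?thesis
    proof induction
      case (base x y)
      show ?case
      proof (cases "x \<in> N")
        case True
        then have "x \<in> reached (insert v A) U T" by (auto simp: N intro: reached.base)
        then show ?thesis using base by (auto intro: reached.step)
      next
        case False
        then show ?thesis using base by (auto intro: reached.base)
      qed
    next
      case (step x y)
      then show ?case by (auto intro: reached.step)
    qed
  qed
qed

lemma component_reached:
  assumes "T \<subseteq> complete_edges n" "v < n"
  shows "component T v = insert v (reached {v} ({..<n} - {v}) T)"
proof (intro equalityI subsetI)
  fix y assume "y \<in> component T v"
  then have "(v, y) \<in> (adjacency T)\<^sup>*" by (simp add: component_def)
  then show "y \<in> insert v (reached {v} ({..<n} - {v}) T)"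
  proof induction
    case base
    then show ?case by simp
  next
    case (step y z)
    then have "{y, z} \<in> T" by (simp add: adjacency_def)
    moreover from this have "z < n"
      using assms by (auto simp: complete_edges_def doubleton_eq_iff)
    ultimately show ?case
      using step by (cases "z = v") (auto intro: reached.base reached.step)
  qed
next
  fix y assume "y \<in> insert v (reached {v} ({..<n} - {v}) T)"
  then show "y \<in> component T v"
  proof
    assume "y \<in> reached {v} ({..<n} - {v}) T"
    then show ?thesis
    proof induction
      case (base x y)
      then show ?case by (auto simp: component_def adjacency_def)
    next
      case (step x y)
      then show ?case
        unfolding component_def by (auto simp: adjacency_def intro: rtrancl_into_rtrancl)
    qed
  qed simp
qed

text \<open>The probability that exploring the component from \<open>a\<close> active vertices among \<open>m\<close> unexplored
  ones finds exactly \<open>k\<close> new vertices; the recursion processes one active vertex.\<close>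
function expl :: "real \<Rightarrow> nat \<Rightarrow> nat \<Rightarrow> nat \<Rightarrow> real" where
  "expl p 0 m k = of_bool (k = 0)"
| "expl p (Suc a) m k =
     (\<Sum>i\<le>k. real (m choose i) * p ^ i * (1 - p) ^ (m - i) * expl p (a + i) (m - i) (k - i))"
  by pat_completeness auto
text \<open>A step that finds \<open>i\<close> neighbours turns \<open>Suc a + k\<close> into
  \<open>(a + i) + (k - i)\<close>, which is smaller by one.\<close>

termination by (relation "Wellfounded.measure (\<lambda>(p, a, m, k). a + k)") auto

declare expl.simps(2) [simp del]

text \<open>The edges from one active vertex \<open>v\<close> to \<open>U\<close> are revealed: the
  number of neighbours found is binomial, and the remaining edges \<open>F'\<close> are independent
  of it. \<open>F\<close> may be any set containing the relevant edges, so that the star of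
  \<open>v\<close> can be removed from it in the induction.\<close>

lemma bexp_reached:
  assumes "finite F" "finite A" "finite U" "A \<inter> U = {}"
    and "\<And>x y. x \<in> A \<union> U \<Longrightarrow> y \<in> U \<Longrightarrow> x \<noteq> y \<Longrightarrow> {x, y} \<in> F"
  shows "bexp F p (\<lambda>T. of_bool (card (reached A U T) = k)) = expl p (card A) (card U) k"
  using assms
proof (induction "card A + card U" arbitrary: A U F k rule: less_induct)
  case less
  show ?case
  proof (cases "A = {}")
    case True
    then show ?thesis using less.prems by simp
  next
    case False
    then obtain v A' where A: "A = insert v A'" "v \<notin> A'"
      by (metis all_not_in_conv mk_disjoint_insert)
    have finA': "finite A'" and cA: "card A = Suc (card A')"
      using less.prems A by auto
    have vU: "v \<notin> U" using less.prems A by auto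
    define s where "s u = {v, u}" for u
    have inj: "inj_on s U" by (auto simp: inj_on_def s_def doubleton_eq_iff)
    define F' where "F' = F - s ` U"
    have "s ` U \<subseteq> F"
      using less.prems(5)[of v] A vU by (auto simp: s_def)
    then have F: "F = s ` U \<union> F'" by (auto simp: F'_def)
    \<comment> \<open>The guard is for more than \<open>k\<close> neighbours, where the event is
      impossible although \<open>k - i\<close> would be 0.\<close>
    let ?h = "\<lambda>i. if i \<le> k then expl p (card A' + i) (card U - i) (k - i) else 0"
    have "bexp F p (\<lambda>T. of_bool (card (reached A U T) = k)) =
        bexp (s ` U) p (\<lambda>S. bexp F' p (\<lambda>T. of_bool (card (reached A U (S \<union> T)) = k)))"
      unfolding F using less.prems by (intro bexp_union) (auto simp: F'_def)
    also have "\<dots> = bexp U p (\<lambda>N. bexp F' p (\<lambda>T. of_bool (card (reached A U (s ` N \<union> T)) = k)))"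
      using inj by (rule bexp_image)
    also have "\<dots> = bexp U p (\<lambda>N. ?h (card N))"
    proof (intro bexp_cong)
      fix N assume N: "N \<subseteq> U"
      then have finN: "finite N" and cN: "card N \<le> card U"
        using less.prems by (auto intro: finite_subset card_mono)
      have r: "card (reached A U (s ` N \<union> T)) = card N + card (reached (A' \<union> N) (U - N) T)"
        if T: "T \<subseteq> F'" for T
      proof -
        have "N = {u \<in> U. {v, u} \<in> s ` N \<union> T}"
          using N T by (auto simp: F'_def s_def doubleton_eq_iff)
        from reached_insert[OF vU this, of A']
        have "reached A U (s ` N \<union> T) = N \<union> reached (A' \<union> N) (U - N) (s ` N \<union> T)"
          by (simp add: A(1))
        also have "reached (A' \<union> N) (U - N) (s ` N \<union> T) = reached (A' \<union> N) (U - N) T"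
        proof (rule reached_cong)
          fix x y assume "x \<in> A' \<union> N \<union> (U - N)" "y \<in> U - N"
          then have "x \<noteq> v" "y \<noteq> v" using A vU N by auto
          then show "{x, y} \<in> s ` N \<union> T \<longleftrightarrow> {x, y} \<in> T"
            by (auto simp: s_def doubleton_eq_iff)
        qed (use less.prems A N in auto)
        finally have "reached A U (s ` N \<union> T) = N \<union> reached (A' \<union> N) (U - N) T" .
        moreover have "finite (reached (A' \<union> N) (U - N) T)" "N \<inter> reached (A' \<union> N) (U - N) T = {}"
          using reached_subset[of "A' \<union> N" "U - N" T] less.prems(3) by (auto intro: finite_subset)
        ultimately show ?thesis
          using finN by (simp add: card_Un_disjoint)
      qed
      show "bexp F' p (\<lambda>T. of_bool (card (reached A U (s ` N \<union> T)) = k)) = ?h (card N)"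
      proof (cases "card N \<le> k")
        case True
        have "bexp F' p (\<lambda>T. of_bool (card (reached A U (s ` N \<union> T)) = k)) =
            bexp F' p (\<lambda>T. of_bool (card (reached (A' \<union> N) (U - N) T) = k - card N))"
          using True by (intro bexp_cong) (auto simp: r)
        also have "\<dots> = expl p (card (A' \<union> N)) (card (U - N)) (k - card N)"
        proof (rule less.hyps)
          have *: "card (A' \<union> N) = card A' + card N" "card (U - N) = card U - card N"
            using finA' finN less.prems A N by (auto simp: card_Diff_subset intro!: card_Un_disjoint)
          then show "card (A' \<union> N) + card (U - N) < card A + card U"
            using cA cN by simp
          show "finite F'" "finite (A' \<union> N)" "finite (U - N)" "(A' \<union> N) \<inter> (U - N) = {}"
            using less.prems finA' finN A by (auto simp: F'_def)
          fix x y assume xy: "x \<in> A' \<union> N \<union> (U - N)" "y \<in> U - N" "x \<noteq> y"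
          then have "{x, y} \<in> F"
            using less.prems(5)[of x y] A N by auto
          moreover have "x \<noteq> v" "y \<noteq> v" using xy A vU N by auto
          ultimately show "{x, y} \<in> F'"
            by (auto simp: F'_def s_def doubleton_eq_iff)
        qed
        also have "card (A' \<union> N) = card A' + card N"
          using finA' finN less.prems A N by (intro card_Un_disjoint) auto
        also have "card (U - N) = card U - card N"
          using finN N by (rule card_Diff_subset)
        finally show ?thesis using True by simp
      next
        case False
        then have "bexp F' p (\<lambda>T. of_bool (card (reached A U (s ` N \<union> T)) = k)) = bexp F' p (\<lambda>T. 0)"
          by (intro bexp_cong) (auto simp: r)
        then show ?thesis
          using False less.prems by (simp add: F'_def)
      qed
    qed
    also have "\<dots> = (\<Sum>i\<le>card U. real (card U choose i) * p ^ i * (1 - p) ^ (card U - i) * ?h i)"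
      using less.prems by (intro bexp_card)
    \<comment> \<open>The two ranges differ only in zero terms: the guard removes i > k, the
      binomial coefficient removes i > \<open>card U\<close>.\<close>
    also have "\<dots> = (\<Sum>i\<le>k. real (card U choose i) * p ^ i * (1 - p) ^ (card U - i) *
        expl p (card A' + i) (card U - i) (k - i))"
      by (rule sum.mono_neutral_cong) (auto simp: binomial_eq_0)
    finally show ?thesis
      by (simp add: cA expl.simps(2))
  qed
qed

text \<open>A component of size c receives 1/c from each of its c vertices. The count becomes a sum
  over vertices, and its expectation only requires the component of one vertex.\<close>

lemma ncomp_eq_sum:
  assumes "T \<subseteq> complete_edges n"
  shows "real (ncomp n T) = (\<Sum>v<n. 1 / real (card (component T v)))"
proof -
  have "(\<Sum>v<n. 1 / real (card (component T v))) =
      (\<Sum>c\<in>component T ` {..<n}. \<Sum>v\<in>{v \<in> {..<n}. component T v = c}. 1 / real (card (component T v)))"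
    by (rule sum.image_gen) simp
  also have "\<dots> = (\<Sum>c\<in>component T ` {..<n}. 1)"
  proof (rule sum.cong[OF refl])
    fix c assume "c \<in> component T ` {..<n}"
    then obtain w where w: "w < n" "c = component T w" by auto
    then have sub: "c \<subseteq> {..<n}" using component_subset[OF assms] by simp
    have "{v \<in> {..<n}. component T v = c} = c"
    proof (intro equalityI subsetI)
      fix v assume "v \<in> {v \<in> {..<n}. component T v = c}"
      then have "component T v = c" by simp
      then show "v \<in> c" using component_refl[of v T] by simp
    next
      fix v assume "v \<in> c"
      then have "component T v = c" unfolding w(2) by (rule component_eq)
      then show "v \<in> {v \<in> {..<n}. component T v = c}" using sub \<open>v \<in> c\<close> by blast
    qed
    moreover have "card c > 0"
      using finite_subset[OF sub] w component_refl[of w T] by (metis card_gt_0_iff empty_iff finite_lessThan)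
    moreover have "(\<Sum>v\<in>{v \<in> {..<n}. component T v = c}. 1 / real (card (component T v))) =
        (\<Sum>v\<in>{v \<in> {..<n}. component T v = c}. 1 / real (card c))"
      by (rule sum.cong) simp_all
    ultimately show "(\<Sum>v\<in>{v \<in> {..<n}. component T v = c}. 1 / real (card (component T v))) = 1"
      by simp
  qed
  finally show ?thesis
    by (simp add: ncomp_def)
qed

lemma edges_from: "v < n \<Longrightarrow> x \<in> {v} \<union> ({..<n} - {v}) \<Longrightarrow> y \<in> {..<n} - {v} \<Longrightarrow> x \<noteq> y
    \<Longrightarrow> {x, y} \<in> complete_edges n"
  by (auto simp: complete_edges_def)

lemma card_component:
  assumes "T \<subseteq> complete_edges n" "v < n"
  shows "card (component T v) = Suc (card (reached {v} ({..<n} - {v}) T))"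
proof -
  have "finite (reached {v} ({..<n} - {v}) T)" "v \<notin> reached {v} ({..<n} - {v}) T"
    using reached_subset[of "{v}" "{..<n} - {v}" T] by (auto intro: finite_subset)
  then show ?thesis
    by (simp add: component_reached[OF assms])
qed

lemma bexp_component:
  assumes "v < n"
  shows "bexp (complete_edges n) p (\<lambda>T. h (card (component T v))) =
    (\<Sum>k<n. expl p 1 (n - 1) k * h (Suc k))"
proof -
  let ?r = "\<lambda>T. card (reached {v} ({..<n} - {v}) T)"
  have "bexp (complete_edges n) p (\<lambda>T. h (card (component T v))) =
      bexp (complete_edges n) p (\<lambda>T. \<Sum>k<n. h (Suc k) * of_bool (?r T = k))"
  proof (rule bexp_cong)
    fix T assume T: "T \<subseteq> complete_edges n"
    have "?r T \<le> card ({..<n} - {v})"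
      by (intro card_mono reached_subset) simp
    then have "?r T < n" using assms by simp
    then have "(\<Sum>k<n. h (Suc k) * of_bool (?r T = k)) = h (Suc (?r T))"
      by (subst sum.remove[of _ "?r T"]) auto
    then show "h (card (component T v)) = (\<Sum>k<n. h (Suc k) * of_bool (?r T = k))"
      by (simp add: card_component[OF T assms])
  qed
  also have "\<dots> = (\<Sum>k<n. h (Suc k) * expl p 1 (n - 1) k)"
    unfolding bexp_sum bexp_cmult
  proof (intro sum.cong refl arg_cong2[where f = "(*)"])
    fix k
    show "bexp (complete_edges n) p (\<lambda>T. of_bool (?r T = k)) = expl p 1 (n - 1) k"
      using bexp_reached[of "complete_edges n" "{v}" "{..<n} - {v}" p k] edges_from[OF assms] assms
      by simp
  qed
  finally show ?thesis by (simp add: mult_ac)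
qed

definition comp_density :: "nat \<Rightarrow> real \<Rightarrow> real" where
  "comp_density n p = (\<Sum>k<n. expl p 1 (n - 1) k / real (Suc k))"

lemma bexp_inverse_component:
  assumes "v < n"
  shows "bexp (complete_edges n) p (\<lambda>T. 1 / real (card (component T v))) = comp_density n p"
  using bexp_component[OF assms, of p "\<lambda>k. 1 / real k"] by (simp add: comp_density_def)

lemma bexp_ncomp: "bexp (complete_edges n) p (\<lambda>T. real (ncomp n T)) = real n * comp_density n p"
proof -
  have "bexp (complete_edges n) p (\<lambda>T. real (ncomp n T)) =
      bexp (complete_edges n) p (\<lambda>T. \<Sum>v<n. 1 / real (card (component T v)))"
    by (intro bexp_cong ncomp_eq_sum)
  then show ?thesis
    by (simp add: bexp_sum bexp_inverse_component)
qed

lemma expl_nonneg: "0 \<le> p \<Longrightarrow> p \<le> 1 \<Longrightarrow> 0 \<le> expl p a m k"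
  by (induction p a m k rule: expl.induct) (auto simp: expl.simps(2) intro!: sum_nonneg mult_nonneg_nonneg)

lemma expl_sum:
  assumes "0 < n"
  shows "(\<Sum>k<n. expl p 1 (n - 1) k) = 1"
  using bexp_component[of 0 n p "\<lambda>_. 1"] assms by simp

lemma comp_density_le_1:
  assumes "0 < n" "0 \<le> p" "p \<le> 1"
  shows "comp_density n p \<le> 1"
proof -
  have "comp_density n p \<le> (\<Sum>k<n. expl p 1 (n - 1) k)"
    unfolding comp_density_def using expl_nonneg[OF assms(2,3)]
    by (intro sum_mono) (auto simp: divide_le_eq intro!: mult_left_le mult_nonneg_nonneg simp: distrib_left)
  then show ?thesis using expl_sum[OF assms(1)] by simp
qed

lemma comp_density_nonneg:
  assumes "0 \<le> p" "p \<le> 1"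
  shows "0 \<le> comp_density n p"
  unfolding comp_density_def using expl_nonneg[OF assms] by (intro sum_nonneg) simp

text \<open>The probabilities of finding \<open>K\<close> or more new vertices add up to at most 1
  and carry weights of at most 1/(K+1), so the tail is small uniformly in \<open>n\<close> and
  \<open>p\<close>, whether or not there is a giant component.\<close>

lemma comp_density_bounds:
  assumes "K \<le> n" "0 < n" "0 \<le> p" "p \<le> 1"
  shows "(\<Sum>k<K. expl p 1 (n - 1) k / real (Suc k)) \<le> comp_density n p"
    and "comp_density n p \<le> (\<Sum>k<K. expl p 1 (n - 1) k / real (Suc k)) + 1 / real (Suc K)"
proof -
  have split: "comp_density n p = (\<Sum>k<K. expl p 1 (n - 1) k / real (Suc k)) +
      (\<Sum>k\<in>{K..<n}. expl p 1 (n - 1) k / real (Suc k))"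
    unfolding comp_density_def using assms(1)
    by (subst sum.union_disjoint[symmetric]) (auto intro!: sum.cong)
  show "(\<Sum>k<K. expl p 1 (n - 1) k / real (Suc k)) \<le> comp_density n p"
    unfolding split using expl_nonneg[OF assms(3,4)] by (simp add: sum_nonneg)
  have "(\<Sum>k\<in>{K..<n}. expl p 1 (n - 1) k / real (Suc k)) \<le> (\<Sum>k\<in>{K..<n}. expl p 1 (n - 1) k * (1 / real (Suc K)))"
    using expl_nonneg[OF assms(3,4)]
    by (intro sum_mono) (auto simp: field_simps intro!: mult_right_mono)
  also have "\<dots> \<le> (\<Sum>k<n. expl p 1 (n - 1) k * (1 / real (Suc K)))"
    using expl_nonneg[OF assms(3,4)] by (intro sum_mono2) auto
  also have "\<dots> = 1 / real (Suc K)"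
    unfolding sum_distrib_right[symmetric] using expl_sum[OF assms(2)] by simp
  finally show "comp_density n p \<le> (\<Sum>k<K. expl p 1 (n - 1) k / real (Suc k)) + 1 / real (Suc K)"
    unfolding split by simp
qed

text \<open>The absorption identity moves 1/(i+1) into the binomial coefficient; what remains is the
  expansion of (p + (1 - p))^(m+1) without its term for i = 0.\<close>

lemma binomial_inverse_mean:
  assumes "0 < p" "p \<le> 1"
  shows "(\<Sum>i\<le>m. real (m choose i) * p ^ i * (1 - p) ^ (m - i) * (1 / real (Suc i))) \<le> 1 / (real (Suc m) * p)"
proof -
  have "(\<Sum>i\<le>m. real (m choose i) * p ^ i * (1 - p) ^ (m - i) * (1 / real (Suc i))) * (real (Suc m) * p)
      = (\<Sum>i\<le>m. real (Suc m choose Suc i) * p ^ Suc i * (1 - p) ^ (Suc m - Suc i))"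
    unfolding sum_distrib_right
  proof (intro sum.cong refl)
    fix i
    have "real (Suc i) * real (Suc m choose Suc i) = real (Suc m) * real (m choose i)"
      using Suc_times_binomial[of i m] by (metis of_nat_mult)
    then have "real (Suc m choose Suc i) = real (Suc m) * real (m choose i) / real (Suc i)"
      by (simp add: field_simps del: of_nat_Suc binomial_Suc_Suc)
    then show "real (m choose i) * p ^ i * (1 - p) ^ (m - i) * (1 / real (Suc i)) * (real (Suc m) * p)
        = real (Suc m choose Suc i) * p ^ Suc i * (1 - p) ^ (Suc m - Suc i)"
      by (simp del: of_nat_Suc binomial_Suc_Suc)
  qed
  also have "\<dots> = (\<Sum>i\<in>{1..Suc m}. real (Suc m choose i) * p ^ i * (1 - p) ^ (Suc m - i))"
    by (rule sum.reindex_bij_witness[of _ "\<lambda>i. i - 1" Suc]) auto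
  also have "\<dots> \<le> (\<Sum>i\<le>Suc m. real (Suc m choose i) * p ^ i * (1 - p) ^ (Suc m - i))"
    using assms by (intro sum_mono2) auto
  also have "\<dots> = (p + (1 - p)) ^ Suc m"
    by (rule binomial_ring[symmetric])
  finally show ?thesis
    using assms by (simp add: pos_le_divide_eq)
qed

text \<open>A component contains the vertex and its neighbours, and the degree is binomial. For p =
  x/n the bound reads 1/x; it is the majorant for large x in the dominated convergence
  below.\<close>

lemma comp_density_le:
  assumes "0 < n" "0 < p" "p \<le> 1"
  shows "comp_density n p \<le> 1 / (real n * p)"
proof -
  define U where "U = {..<n} - {0}"
  define s where "s u = {0, u}" for u :: nat
  have inj: "inj_on s U" by (auto simp: inj_on_def s_def doubleton_eq_iff)
  let ?d = "\<lambda>T. card {u \<in> U. s u \<in> T}"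
  have sU: "s ` U \<subseteq> complete_edges n"
    using assms(1) by (auto simp: s_def U_def complete_edges_def)
  have "comp_density n p = bexp (complete_edges n) p (\<lambda>T. 1 / real (card (component T 0)))"
    using bexp_inverse_component[OF assms(1)] by simp
  also have "\<dots> \<le> bexp (complete_edges n) p (\<lambda>T. 1 / real (Suc (?d T)))"
  proof (rule bexp_mono)
    fix T assume T: "T \<subseteq> complete_edges n"
    have "insert 0 {u \<in> U. s u \<in> T} \<subseteq> component T 0"
      by (auto simp: component_def s_def adjacency_def)
    then have "card (insert 0 {u \<in> U. s u \<in> T}) \<le> card (component T 0)"
      using component_subset[OF T assms(1)] by (intro card_mono) (auto intro: finite_subset)
    then have "Suc (?d T) \<le> card (component T 0)"
      by (simp add: U_def)
    then show "1 / real (card (component T 0)) \<le> 1 / real (Suc (?d T))"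
      by (intro divide_left_mono) (auto simp del: of_nat_Suc)
  qed (use assms in auto)
  also have "\<dots> = bexp (s ` U) p (\<lambda>T. 1 / real (Suc (?d T)))"
  proof (rule bexp_local[OF finite_complete_edges sU])
    fix A
    have "{u \<in> U. s u \<in> A} = {u \<in> U. s u \<in> A \<inter> s ` U}" by auto
    then show "1 / real (Suc (?d A)) = 1 / real (Suc (?d (A \<inter> s ` U)))" by simp
  qed
  also have "\<dots> = bexp U p (\<lambda>N. 1 / real (Suc (?d (s ` N))))"
    using inj by (rule bexp_image)
  also have "\<dots> = bexp U p (\<lambda>N. 1 / real (Suc (card N)))"
  proof (rule bexp_cong)
    fix N assume "N \<subseteq> U"
    then have "{u \<in> U. s u \<in> s ` N} = N"
      using inj by (auto simp: inj_on_def)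
    then show "1 / real (Suc (?d (s ` N))) = 1 / real (Suc (card N))" by simp
  qed
  also have "\<dots> = (\<Sum>i\<le>card U. real (card U choose i) * p ^ i * (1 - p) ^ (card U - i) * (1 / real (Suc i)))"
    by (rule bexp_card) (simp add: U_def)
  also have "\<dots> \<le> 1 / (real (Suc (card U)) * p)"
    using assms by (intro binomial_inverse_mean)
  also have "Suc (card U) = n"
    using assms(1) by (simp add: U_def)
  finally show ?thesis .
qed

section \<open>The limiting density of components\<close>

text \<open>The number of rooted forests on \<open>a + k\<close> vertices with \<open>a\<close> prescribed roots.\<close>
definition forests :: "nat \<Rightarrow> nat \<Rightarrow> real" where
  "forests a k = (if k = 0 then 1 else real a * real (a + k) ^ (k - 1))"

text \<open>Delete one root: its \<open>i\<close> children become roots. This is the recursion of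
  \<open>expl\<close> in the limit, stripped of the Poisson weights.\<close>

lemma forests_rec:
  "forests (Suc a) k = (\<Sum>i\<le>k. real (k choose i) * forests (a + i) (k - i))"
proof (cases k)
  case 0
  then show ?thesis by (simp add: forests_def)
next
  case (Suc j)
  \<comment> \<open>\<open>N\<close> is the total number of vertices, the same in every summand.
    Multiplying by it turns the exponent k-i-1 into k-i and absorbs the special case i = k of
    \<open>forests\<close>.\<close>
  define N where "N = real (a + k)"
  have N: "N > 0" by (simp add: N_def Suc)
  have "N * (\<Sum>i\<le>k. real (k choose i) * forests (a + i) (k - i)) =
      (\<Sum>i\<le>k. real (k choose i) * (real a + real i) * N ^ (k - i))"
    unfolding sum_distrib_left
  proof (intro sum.cong refl)
    fix i assume i: "i \<in> {..k}"
    have "N * forests (a + i) (k - i) = (real a + real i) * N ^ (k - i)"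
    proof (cases "i = k")
      case True
      then show ?thesis by (simp add: forests_def N_def)
    next
      case False
      then have "k - i = Suc (k - i - 1)" "i \<le> k" using i by auto
      then show ?thesis
        by (subst (2) \<open>k - i = Suc (k - i - 1)\<close>) (simp add: forests_def N_def)
    qed
    then show "N * (real (k choose i) * forests (a + i) (k - i)) =
        real (k choose i) * (real a + real i) * N ^ (k - i)"
      by (simp add: mult_ac)
  qed
  also have "\<dots> = real a * (\<Sum>i\<le>k. real (k choose i) * 1 ^ i * N ^ (k - i)) +
      (\<Sum>i\<le>k. real i * real (k choose i) * N ^ (k - i))"
    by (simp add: sum_distrib_left sum.distrib algebra_simps)
  also have "(\<Sum>i\<le>k. real (k choose i) * 1 ^ i * N ^ (k - i)) = (1 + N) ^ k"
    by (rule binomial_ring[symmetric])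
  also have "(\<Sum>i\<le>k. real i * real (k choose i) * N ^ (k - i)) =
      (\<Sum>i\<le>j. real (Suc i) * real (Suc j choose Suc i) * N ^ (j - i))"
    unfolding Suc by (subst sum.atMost_Suc_shift) simp
  also have "\<dots> = real k * (\<Sum>i\<le>j. real (j choose i) * 1 ^ i * N ^ (j - i))"
    unfolding sum_distrib_left
  proof (intro sum.cong refl)
    fix i
    have "real (Suc i) * real (Suc j choose Suc i) = real (Suc j) * real (j choose i)"
      using Suc_times_binomial[of i j] by (metis of_nat_mult)
    then show "real (Suc i) * real (Suc j choose Suc i) * N ^ (j - i) =
        real k * (real (j choose i) * 1 ^ i * N ^ (j - i))"
      by (simp add: Suc del: of_nat_Suc binomial_Suc_Suc)
  qed
  also have "(\<Sum>i\<le>j. real (j choose i) * 1 ^ i * N ^ (j - i)) = (1 + N) ^ j"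
    by (rule binomial_ring[symmetric])
  also have "real a * (1 + N) ^ k + real k * (1 + N) ^ j = N * (real (Suc a) * (1 + N) ^ j)"
    by (simp add: Suc N_def algebra_simps)
  also have "real (Suc a) * (1 + N) ^ j = forests (Suc a) k"
    by (simp add: forests_def Suc N_def add_ac)
  finally show ?thesis using N by simp
qed

text \<open>The offset \<open>c\<close> is general because the induction step lowers the upper index
  of the binomial coefficient by one.\<close>

lemma binomial_div_power_tendsto:
  "(\<lambda>n. real ((n - c) choose i) / real n ^ i) \<longlonglongrightarrow> 1 / fact i"
proof (induction i arbitrary: c)
  case 0
  then show ?case by simp
next
  case (Suc i)
  have "(\<lambda>n. (real n - real c) / real n) \<longlonglongrightarrow> 1" by real_asymp
  then have "(\<lambda>n. (real n - real c) / real n / real (Suc i) * (real ((n - Suc c) choose i) / real n ^ i))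
      \<longlonglongrightarrow> 1 / real (Suc i) * (1 / fact i)"
    by (intro tendsto_intros Suc) auto
  also have "1 / real (Suc i) * (1 / fact i) = 1 / fact (Suc i)" by simp
  finally show ?case
  proof (rule Lim_transform_eventually)
    show "\<forall>\<^sub>F n in sequentially. (real n - real c) / real n / real (Suc i) *
        (real ((n - Suc c) choose i) / real n ^ i) = real ((n - c) choose Suc i) / real n ^ Suc i"
      using eventually_gt_at_top[of c]
    proof eventually_elim
      case (elim n)
      have "Suc i * ((n - c) choose Suc i) = (n - c) * ((n - Suc c) choose i)"
        using times_binomial_minus1_eq[of "Suc i" "n - c"] by simp
      then have "real (Suc i) * real ((n - c) choose Suc i) = (real n - real c) * real ((n - Suc c) choose i)"
        using elim by (metis less_imp_le of_nat_diff of_nat_mult)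
      then have "real ((n - c) choose Suc i) = (real n - real c) * real ((n - Suc c) choose i) / real (Suc i)"
        by (simp add: field_simps del: of_nat_Suc)
      then show ?case by (simp del: of_nat_Suc)
    qed
  qed
qed

lemma binomial_poisson_limit:
  fixes x :: real
  shows "(\<lambda>n. real ((n - c) choose i) * (x / real n) ^ i * (1 - x / real n) ^ (n - c - i))
    \<longlonglongrightarrow> x ^ i / fact i * exp (- x)"
proof -
  have "(\<lambda>n. (1 - x / real n) ^ n) \<longlonglongrightarrow> exp (- x)"
    using tendsto_exp_limit_sequentially[of "- x"] by simp
  moreover have q: "(\<lambda>n. 1 - x / real n) \<longlonglongrightarrow> 1" by real_asymp
  moreover have "(\<lambda>n. (1 - x / real n) ^ (c + i)) \<longlonglongrightarrow> 1 ^ (c + i)"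
    by (intro tendsto_intros q)
  ultimately have "(\<lambda>n. x ^ i * (real ((n - c) choose i) / real n ^ i) *
      ((1 - x / real n) ^ n / (1 - x / real n) ^ (c + i))) \<longlonglongrightarrow> x ^ i * (1 / fact i) * (exp (- x) / 1 ^ (c + i))"
    by (intro tendsto_intros binomial_div_power_tendsto) auto
  also have "x ^ i * (1 / fact i) * (exp (- x) / 1 ^ (c + i)) = x ^ i / fact i * exp (- x)" by simp
  finally show ?thesis
  proof (rule Lim_transform_eventually)
    have "\<forall>\<^sub>F n in sequentially. 1 - x / real n > 0"
      using q by (rule order_tendstoD) simp
    then show "\<forall>\<^sub>F n in sequentially. x ^ i * (real ((n - c) choose i) / real n ^ i) *
        ((1 - x / real n) ^ n / (1 - x / real n) ^ (c + i)) =
        real ((n - c) choose i) * (x / real n) ^ i * (1 - x / real n) ^ (n - c - i)"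
      using eventually_ge_at_top[of "c + i"]
    proof eventually_elim
      case (elim n)
      have "(1 - x / real n) ^ n = (1 - x / real n) ^ (n - c - i) * (1 - x / real n) ^ (c + i)"
        using elim by (simp flip: power_add)
      then have "(1 - x / real n) ^ n / (1 - x / real n) ^ (c + i) = (1 - x / real n) ^ (n - c - i)"
        using elim(1) by (metis nonzero_mult_div_cancel_right order_less_irrefl zero_less_power)
      then show ?case by (simp add: power_divide)
    qed
  qed
qed

text \<open>The limit is taken inside the finite recursion of \<open>expl\<close>, where binomial
  laws become Poisson laws; the offset \<open>c\<close> accounts for the vertices already
  discovered. For \<open>a = 1\<close> the limit is the Borel probability of the total size
  \<open>Suc k\<close>.\<close>

lemma expl_limit:
  fixes x :: real
  shows "(\<lambda>n. expl (x / real n) a (n - c) k) \<longlonglongrightarrow> exp (- x * real (a + k)) * x ^ k * forests a k / fact k"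
proof (induction "a + k" arbitrary: a c k rule: less_induct)
  case less
  show ?case
  proof (cases a)
    case 0
    then show ?thesis by (simp add: forests_def)
  next
    case (Suc a')
    let ?e = "exp (- x * real (a' + k))"
    have "(\<lambda>n. expl (x / real n) a (n - c) k) \<longlonglongrightarrow>
        (\<Sum>i\<le>k. x ^ i / fact i * exp (- x) *
          (exp (- x * real (a' + i + (k - i))) * x ^ (k - i) * forests (a' + i) (k - i) / fact (k - i)))"
      unfolding Suc expl.simps(2)
    proof (rule tendsto_sum)
      fix i assume i: "i \<in> {..k}"
      have "(\<lambda>n. expl (x / real n) (a' + i) (n - (c + i)) (k - i)) \<longlonglongrightarrow>
          exp (- x * real (a' + i + (k - i))) * x ^ (k - i) * forests (a' + i) (k - i) / fact (k - i)"
        using i Suc by (intro less) auto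
      then show "(\<lambda>n. real (n - c choose i) * (x / real n) ^ i * (1 - x / real n) ^ (n - c - i) *
            expl (x / real n) (a' + i) (n - c - i) (k - i)) \<longlonglongrightarrow> x ^ i / fact i * exp (- x) *
          (exp (- x * real (a' + i + (k - i))) * x ^ (k - i) * forests (a' + i) (k - i) / fact (k - i))"
        by (intro tendsto_mult binomial_poisson_limit) simp
    qed
    also have "(\<Sum>i\<le>k. x ^ i / fact i * exp (- x) *
          (exp (- x * real (a' + i + (k - i))) * x ^ (k - i) * forests (a' + i) (k - i) / fact (k - i))) =
        (\<Sum>i\<le>k. exp (- x) * ?e * x ^ k / fact k * (real (k choose i) * forests (a' + i) (k - i)))"
    proof (intro sum.cong refl)
      fix i assume "i \<in> {..k}"
      then have i: "i \<le> k" by simp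
      have "x ^ k = x ^ i * x ^ (k - i)" using i by (simp flip: power_add)
      moreover have "real (k choose i) = fact k / (fact i * fact (k - i))"
        using i by (rule binomial_fact)
      moreover have "a' + i + (k - i) = a' + k" using i by simp
      ultimately show "x ^ i / fact i * exp (- x) *
          (exp (- x * real (a' + i + (k - i))) * x ^ (k - i) * forests (a' + i) (k - i) / fact (k - i)) =
          exp (- x) * ?e * x ^ k / fact k * (real (k choose i) * forests (a' + i) (k - i))"
        by simp
    qed
    also have "\<dots> = exp (- x) * ?e * x ^ k / fact k * forests a k"
      unfolding Suc forests_rec sum_distrib_left ..
    also have "exp (- x) * ?e = exp (- x * real (a + k))"
      unfolding Suc by (simp add: algebra_simps flip: exp_add)
    finally show ?thesis by simp
  qed
qed

text \<open>The Borel probability of size \<open>Suc k\<close> with parameter \<open>x\<close>,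
  times the inverse size. For x > 1 the Borel probabilities add up to less than 1; the missing mass
  belongs to the giant component.\<close>

definition density_term :: "real \<Rightarrow> nat \<Rightarrow> real" where
  "density_term x k = exp (- x * real (Suc k)) * x ^ k * forests 1 k / fact k / real (Suc k)"

definition limit_density :: "real \<Rightarrow> real" where
  "limit_density x = (\<Sum>k. density_term x k)"

lemma density_term_nonneg: "0 \<le> x \<Longrightarrow> 0 \<le> density_term x k"
  by (simp add: density_term_def forests_def)

lemma eventually_prob:
  fixes x :: real
  assumes "0 \<le> x"
  shows "\<forall>\<^sub>F n in sequentially. K \<le> n \<and> 0 < n \<and> 0 \<le> x / real n \<and> x / real n \<le> 1"
  using eventually_ge_at_top[of "nat \<lceil>x\<rceil>"] eventually_gt_at_top[of 0] eventually_ge_at_top[of K]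
proof eventually_elim
  case (elim n)
  then have "x \<le> real n" by linarith
  then show ?case using elim assms by (simp add: field_simps)
qed

lemma partial_density_limit:
  "(\<lambda>n. \<Sum>k<K. expl (x / real n) 1 (n - 1) k / real (Suc k)) \<longlonglongrightarrow> (\<Sum>k<K. density_term x k)"
  unfolding density_term_def using expl_limit[of x 1 1] by (intro tendsto_sum tendsto_divide) auto

text \<open>The partial sums are limits of truncated sums for finite \<open>n\<close>, and those are
  at most 1.\<close>

lemma summable_density_term:
  assumes "0 \<le> x"
  shows "summable (density_term x)"
proof (rule summableI_nonneg_bounded)
  fix K
  show "(\<Sum>k<K. density_term x k) \<le> 1"
  proof (rule tendsto_upperbound[OF partial_density_limit])
    show "\<forall>\<^sub>F n in sequentially. (\<Sum>k<K. expl (x / real n) 1 (n - 1) k / real (Suc k)) \<le> 1"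
      using eventually_prob[OF assms, of K]
    proof eventually_elim
      case (elim n)
      then show ?case
        using comp_density_bounds(1)[of K n "x / real n"] comp_density_le_1[of n "x / real n"] by linarith
    qed
  qed simp
qed (use density_term_nonneg[OF assms] in auto)

text \<open>\<open>K\<close> is fixed before \<open>n\<close>: the truncation error 1/(K+1) does not
  depend on \<open>n\<close>, and each of the finitely many remaining terms converges.\<close>

lemma comp_density_limit:
  assumes "0 \<le> x"
  shows "(\<lambda>n. comp_density n (x / real n)) \<longlonglongrightarrow> limit_density x"
proof (rule LIMSEQ_I)
  fix r :: real assume "0 < r"
  then have r3: "0 < r / 3" by simp
  have "(\<lambda>K. \<Sum>k<K. density_term x k) \<longlonglongrightarrow> limit_density x"
    unfolding limit_density_def using summable_density_term[OF assms] by (rule summable_LIMSEQ)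
  then have "\<forall>\<^sub>F K in sequentially. dist (\<Sum>k<K. density_term x k) (limit_density x) < r / 3"
    using r3 by (rule tendstoD)
  moreover have "(\<lambda>K. 1 / real (Suc K)) \<longlonglongrightarrow> 0" by real_asymp
  then have "\<forall>\<^sub>F K in sequentially. 1 / real (Suc K) < r / 3"
    using r3 by (rule order_tendstoD)
  ultimately have "\<forall>\<^sub>F K in sequentially. dist (\<Sum>k<K. density_term x k) (limit_density x) < r / 3
      \<and> 1 / real (Suc K) < r / 3"
    by (rule eventually_conj)
  then obtain K where K: "\<bar>(\<Sum>k<K. density_term x k) - limit_density x\<bar> < r / 3" "1 / real (Suc K) < r / 3"
    unfolding eventually_sequentially dist_real_def by blast
  have "\<forall>\<^sub>F n in sequentially.
      dist (\<Sum>k<K. expl (x / real n) 1 (n - 1) k / real (Suc k)) (\<Sum>k<K. density_term x k) < r / 3"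
    using partial_density_limit r3 by (rule tendstoD)
  then have "\<forall>\<^sub>F n in sequentially. norm (comp_density n (x / real n) - limit_density x) < r"
    using eventually_prob[OF assms, of K]
  proof eventually_elim
    case (elim n)
    then show ?case
      using comp_density_bounds[of K n "x / real n"] K unfolding dist_real_def real_norm_def by linarith
  qed
  then show "\<exists>no. \<forall>n\<ge>no. norm (comp_density n (x / real n) - limit_density x) < r"
    by (simp add: eventually_sequentially)
qed

text \<open>The measure d(x^b) on the positive half-line. Integrating over thresholds t = s x^b is
  integrating against \<open>s\<close> times this measure, which makes the rescaled edge probability
  x the variable.\<close>

definition power_measure :: "real \<Rightarrow> real measure" where
  "power_measure b = density lborel (\<lambda>x. ennreal (indicator {0<..} x * (b * x powr (b - 1))))"

lemma sets_power_measure [simp, measurable_cong]: "sets (power_measure b) = sets borel"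
  by (simp add: power_measure_def)

lemma space_power_measure [simp]: "space (power_measure b) = UNIV"
  by (simp add: power_measure_def)

lemma sigma_finite_power_measure: "sigma_finite_measure (power_measure b)"
  unfolding power_measure_def
  by (subst sigma_finite_measure.sigma_finite_iff_density_finite[OF lborel.sigma_finite_measure_axioms])
    auto

lemma AE_power_measure_pos: "AE x in power_measure b. 0 < x"
  unfolding power_measure_def by (subst AE_density) (auto simp: indicator_def)

lemma nn_integral_power_measure:
  assumes [measurable]: "f \<in> borel_measurable borel" and "0 < b" and f: "\<And>x. 0 < x \<Longrightarrow> 0 \<le> f x"
  shows "(\<integral>\<^sup>+x. ennreal (f x) \<partial>power_measure b) =
    (\<integral>\<^sup>+x. ennreal (indicator {0<..} x * (b * x powr (b - 1) * f x)) \<partial>lborel)"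
  unfolding power_measure_def
  by (subst nn_integral_density)
     (use assms(2) in \<open>auto intro!: nn_integral_cong simp: indicator_def ennreal_mult'\<close>)

lemma emeasure_power_measure:
  assumes b: "0 < b" and y: "0 \<le> y"
  shows "emeasure (power_measure b) {..<y} = ennreal (y powr b)"
proof -
  have "((\<lambda>x. b * x powr (b - 1)) has_integral (b * (y powr (b - 1 + 1) / (b - 1 + 1)))) {0..y}"
    using b y by (intro has_integral_mult_right has_integral_powr_from_0) auto
  then have "((\<lambda>x. b * x powr (b - 1)) has_integral (y powr b)) {0..y}"
    using b by simp
  then have "(\<integral>\<^sup>+x. ennreal (indicator {0..y} x * (b * x powr (b - 1))) \<partial>lborel) = ennreal (y powr b)"
    using b by (intro nn_integral_has_integral_lebesgue) auto
  moreover have "emeasure (power_measure b) {..<y} =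
      (\<integral>\<^sup>+x. ennreal (indicator {0<..} x * (b * x powr (b - 1))) * indicator {..<y} x \<partial>lborel)"
    unfolding power_measure_def by (subst emeasure_density) auto
  moreover have "\<dots> = (\<integral>\<^sup>+x. ennreal (indicator {0..y} x * (b * x powr (b - 1))) \<partial>lborel)"
  proof (rule nn_integral_cong_AE)
    have "AE x in lborel. x \<noteq> y" by (rule AE_lborel_singleton)
    moreover have "AE x in lborel. x \<noteq> (0 :: real)" by (rule AE_lborel_singleton)
    ultimately show "AE x in lborel. ennreal (indicator {0<..} x * (b * x powr (b - 1))) * indicator {..<y} x =
        ennreal (indicator {0..y} x * (b * x powr (b - 1)))"
      by eventually_elim (auto simp: indicator_def)
  qed
  ultimately show ?thesis by simp
qed

lemma Gamma_nn_integral_scaled: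
  assumes s: "0 < s" and c: "0 < c"
  shows "(\<integral>\<^sup>+x. ennreal (indicator {0<..} x * (x powr (s - 1) * exp (- x * c))) \<partial>lborel) =
    ennreal (Gamma s / c powr s)"
proof -
  have "ennreal (Gamma s) = (\<integral>\<^sup>+t. ennreal (indicator {0..} t * t powr (s - 1) / exp t) \<partial>lborel)"
    using s by (rule Gamma_conv_nn_integral_real)
  also have "\<dots> = \<bar>c\<bar> * (\<integral>\<^sup>+x. ennreal (indicator {0..} (0 + c * x) * (0 + c * x) powr (s - 1) / exp (0 + c * x)) \<partial>lborel)"
    using c by (intro nn_integral_real_affine) auto
  also have "(\<integral>\<^sup>+x. ennreal (indicator {0..} (0 + c * x) * (0 + c * x) powr (s - 1) / exp (0 + c * x)) \<partial>lborel)
      = (\<integral>\<^sup>+x. ennreal (c powr (s - 1)) * ennreal (indicator {0<..} x * (x powr (s - 1) * exp (- x * c))) \<partial>lborel)"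
  proof (intro nn_integral_cong)
    fix x :: real
    show "ennreal (indicator {0..} (0 + c * x) * (0 + c * x) powr (s - 1) / exp (0 + c * x)) =
        ennreal (c powr (s - 1)) * ennreal (indicator {0<..} x * (x powr (s - 1) * exp (- x * c)))"
      using c by (auto simp: indicator_def powr_mult exp_minus field_simps zero_le_mult_iff simp flip: ennreal_mult)
  qed
  also have "\<dots> = ennreal (c powr (s - 1)) *
      (\<integral>\<^sup>+x. ennreal (indicator {0<..} x * (x powr (s - 1) * exp (- x * c))) \<partial>lborel)"
    by (rule nn_integral_cmult) auto
  also have "ennreal \<bar>c\<bar> * (ennreal (c powr (s - 1)) * z) = ennreal (c powr s) * z" for z
  proof -
    have "c * c powr (s - 1) = c powr s" using c by (simp add: powr_diff)
    then show ?thesis using c by (simp flip: mult.assoc ennreal_mult)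
  qed
  finally have *: "ennreal (Gamma s) = ennreal (c powr s) *
      (\<integral>\<^sup>+x. ennreal (indicator {0<..} x * (x powr (s - 1) * exp (- x * c))) \<partial>lborel)" .
  have "ennreal (Gamma s / c powr s) = ennreal (1 / c powr s) * ennreal (Gamma s)"
    using c s by (simp add: Gamma_real_pos flip: ennreal_mult)
  also have "\<dots> = ennreal (1 / c powr s) * ennreal (c powr s) *
      (\<integral>\<^sup>+x. ennreal (indicator {0<..} x * (x powr (s - 1) * exp (- x * c))) \<partial>lborel)"
    unfolding * by (simp add: mult.assoc)
  also have "ennreal (1 / c powr s) * ennreal (c powr s) = 1"
    using c by (simp flip: ennreal_mult)
  finally show ?thesis by simp
qed

text \<open>A Gamma integral: x^k from the Borel term and x^(b-1) from the measure give Gamma(k+b) /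
  (k+1)^(k+b), and the factor (k+1)^(k-2) contained in \<open>density_term\<close> leaves the
  exponent b+2. Up to the factor \<open>b\<close>, these are the summands of \<open>C_const\<close>
  for b = \<gamma>/2, with k+1 in place of k.\<close>

lemma density_term_integral:
  assumes b: "0 < b"
  shows "(\<integral>\<^sup>+x. ennreal (density_term x k) \<partial>power_measure b) =
    ennreal (b * (Gamma (real k + b) / (real (Suc k) powr (b + 2) * fact k)))"
proof -
  define c where "c = forests 1 k / fact k / real (Suc k)"
  have c0: "c \<ge> 0" by (simp add: c_def forests_def)
  have [measurable]: "(\<lambda>x. density_term x k) \<in> borel_measurable borel"
    unfolding density_term_def by measurable
  have "(\<integral>\<^sup>+x. ennreal (density_term x k) \<partial>power_measure b) =
      (\<integral>\<^sup>+x. ennreal (indicator {0<..} x * (b * x powr (b - 1) * density_term x k)) \<partial>lborel)"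
    using b by (intro nn_integral_power_measure) (auto intro: density_term_nonneg)
  also have "\<dots> = (\<integral>\<^sup>+x. ennreal (b * c) * ennreal (indicator {0<..} x *
      (x powr (real k + b - 1) * exp (- x * real (Suc k)))) \<partial>lborel)"
  proof (intro nn_integral_cong)
    fix x :: real
    have "x powr (real k + b - 1) = x ^ k * x powr (b - 1)" if "x > 0"
      using that powr_add[of x "real k" "b - 1"] by (simp add: powr_realpow add_diff_eq)
    then have "indicator {0<..} x * (b * x powr (b - 1) * density_term x k) =
        (b * c) * (indicator {0<..} x * (x powr (real k + b - 1) * exp (- x * real (Suc k))))"
      by (auto simp: indicator_def density_term_def c_def)
    then show "ennreal (indicator {0<..} x * (b * x powr (b - 1) * density_term x k)) = ennreal (b * c) *
        ennreal (indicator {0<..} x * (x powr (real k + b - 1) * exp (- x * real (Suc k))))"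
      using b c0 by (simp only: ennreal_mult'[OF mult_nonneg_nonneg] less_imp_le)
  qed
  also have "\<dots> = ennreal (b * c) * (\<integral>\<^sup>+x. ennreal (indicator {0<..} x *
      (x powr (real k + b - 1) * exp (- x * real (Suc k)))) \<partial>lborel)"
    by (rule nn_integral_cmult) auto
  also have "\<dots> = ennreal (b * c) * ennreal (Gamma (real k + b) / real (Suc k) powr (real k + b))"
    using b by (subst Gamma_nn_integral_scaled) (auto simp del: of_nat_Suc)
  also have "\<dots> = ennreal (b * c * (Gamma (real k + b) / real (Suc k) powr (real k + b)))"
    using b c0 by (intro ennreal_mult'[symmetric]) simp
  also have "b * c * (Gamma (real k + b) / real (Suc k) powr (real k + b)) =
      b * (Gamma (real k + b) / (real (Suc k) powr (b + 2) * fact k))"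
  proof -
    have "c = real (Suc k) powr (real k - 2) / fact k"
    proof (cases k)
      case 0
      then show ?thesis by (simp add: c_def forests_def)
    next
      case (Suc j)
      have "real (Suc k) powr (real k - 2) = real (Suc k) powr (real j - 1)"
        by (simp add: Suc)
      also have "\<dots> = real (Suc k) ^ j / real (Suc k)"
        by (simp add: powr_diff powr_realpow)
      finally show ?thesis by (simp add: c_def forests_def Suc)
    qed
    moreover have "real (Suc k) powr (real k + b) = real (Suc k) powr (real k - 2) * real (Suc k) powr (b + 2)"
      by (simp flip: powr_add)
    ultimately show ?thesis
      by (simp add: field_simps del: of_nat_Suc)
  qed
  finally show ?thesis .
qed

text \<open>Integrability near 0 comes from b > 0, and at infinity from the exponent b - 2 <
  -1.\<close>

lemma min_integrable:
  assumes b: "0 < b" "b < 1"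
  shows "integrable (power_measure b) (\<lambda>x. min 1 (1 / x))"
proof (rule integrableI_bounded)
  have "(\<integral>\<^sup>+x. ennreal (norm (min 1 (1 / x))) \<partial>power_measure b) =
      (\<integral>\<^sup>+x. ennreal (indicator {0<..} x * (b * x powr (b - 1) * norm (min 1 (1 / x)))) \<partial>lborel)"
    using b by (intro nn_integral_power_measure) auto
  also have "\<dots> \<le> (\<integral>\<^sup>+x. ennreal (indicator {0..1} x * (b * x powr (b - 1))) +
      ennreal (indicator {1..} x * (b * x powr (b - 2))) \<partial>lborel)"
  proof (rule nn_integral_mono)
    fix x :: real
    consider "x \<le> 0" | "0 < x" "x \<le> 1" | "1 < x" by linarith
    then show "ennreal (indicator {0<..} x * (b * x powr (b - 1) * norm (min 1 (1 / x))))
        \<le> ennreal (indicator {0..1} x * (b * x powr (b - 1))) + ennreal (indicator {1..} x * (b * x powr (b - 2)))"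
    proof cases
      case 2
      then have "min 1 (1 / x) = 1" by (simp add: min_def)
      then have "ennreal (indicator {0<..} x * (b * x powr (b - 1) * norm (min 1 (1 / x)))) =
          ennreal (indicator {0..1} x * (b * x powr (b - 1)))"
        using 2 by simp
      then show ?thesis by (simp add: add_increasing2)
    next
      case 3
      then have "x powr (b - 2) = x powr (b - 1) / x"
        using powr_diff[of x "b - 1" 1] by simp
      then show ?thesis using 3 b by (simp add: min_def)
    qed simp
  qed
  also have "\<dots> = (\<integral>\<^sup>+x. ennreal (indicator {0..1} x * (b * x powr (b - 1))) \<partial>lborel) +
      (\<integral>\<^sup>+x. ennreal (indicator {1..} x * (b * x powr (b - 2))) \<partial>lborel)"
    by (rule nn_integral_add) auto
  also have "(\<integral>\<^sup>+x. ennreal (indicator {0..1} x * (b * x powr (b - 1))) \<partial>lborel) =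
      ennreal (b * (1 powr (b - 1 + 1) / (b - 1 + 1)))"
    using b by (intro nn_integral_has_integral_lebesgue has_integral_mult_right has_integral_powr_from_0) auto
  also have "(\<integral>\<^sup>+x. ennreal (indicator {1..} x * (b * x powr (b - 2))) \<partial>lborel) =
      ennreal (b * (- (1 powr (b - 2 + 1)) / (b - 2 + 1)))"
    using b by (intro nn_integral_has_integral_lebesgue has_integral_mult_right has_integral_powr_to_inf) auto
  also have "ennreal (b * (1 powr (b - 1 + 1) / (b - 1 + 1))) +
      ennreal (b * (- (1 powr (b - 2 + 1)) / (b - 2 + 1))) < \<infinity>"
    by simp
  finally show "(\<integral>\<^sup>+x. ennreal (norm (min 1 (1 / x))) \<partial>power_measure b) < \<infinity>" .
qed simp

text \<open>For fixed \<open>a\<close>, \<open>m\<close>, \<open>k\<close>, \<open>expl\<close> is a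
  polynomial in p; its continuity is proved along the recursion.\<close>

lemma comp_density_measurable [measurable]: "(\<lambda>x. comp_density n (x / c)) \<in> borel_measurable borel"
proof -
  have "continuous_on UNIV (\<lambda>p. expl p a m k)" for a m k
  proof (induction "a + k" arbitrary: a m k rule: less_induct)
    case less
    show ?case
    proof (cases a)
      case (Suc a')
      have "continuous_on UNIV (\<lambda>p. expl p (a' + i) (m - i) (k - i))" if "i \<le> k" for i
        using that Suc by (intro less) auto
      then show ?thesis
        unfolding Suc expl.simps(2) by (intro continuous_intros) auto
    qed simp
  qed
  then have "(\<lambda>p. expl p a m k) \<in> borel_measurable borel" for a m k
    by (rule borel_measurable_continuous_onI)
  then show ?thesis
    unfolding comp_density_def by measurable
qed

lemma limit_density_measurable [measurable]: "limit_density \<in> borel_measurable borel"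
  unfolding limit_density_def[abs_def] density_term_def by measurable

text \<open>Dominated convergence gives the integral of the limiting density, which is then
  evaluated term by term. The cutoff \<open>L\<close> stays below \<open>n\<close> so that x/n is a
  probability wherever the bounds on \<open>comp_density\<close> are applied.\<close>

theorem comp_density_integral_limit:
  assumes b: "0 < b" "b < 1" and L: "filterlim L at_top sequentially" "\<forall>\<^sub>F n in sequentially. L n \<le> real n"
  shows "(\<lambda>n. \<integral>x. indicator {..<L n} x * comp_density n (x / real n) \<partial>power_measure b) \<longlonglongrightarrow>
      (\<Sum>k. b * (Gamma (real k + b) / (real (Suc k) powr (b + 2) * fact k)))" (is "_ \<longlonglongrightarrow> suminf ?t")
    and "summable (\<lambda>k. b * (Gamma (real k + b) / (real (Suc k) powr (b + 2) * fact k)))"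
proof -
  let ?f = "\<lambda>n x. indicator {..<L n} x * comp_density n (x / real n)"
  obtain N0 where N0: "\<And>n. n \<ge> N0 \<Longrightarrow> L n \<le> real n"
    using L(2) unfolding eventually_sequentially by blast
  \<comment> \<open>The convergence theorem asks for the majorant at every index. The shift by
    \<open>N\<close> skips the indices for which \<open>L n\<close> may exceed \<open>n\<close>, and
    the \<open>Suc\<close> makes the shifted index positive.\<close>
  define N where "N = Suc N0"
  have N: "\<And>n. n \<ge> N \<Longrightarrow> L n \<le> real n" "N > 0"
    using N0 by (simp_all add: N_def)
  have meas: "?f n \<in> borel_measurable (power_measure b)" for n
    by measurable
  have lim: "AE x in power_measure b. (\<lambda>n. ?f (n + N) x) \<longlonglongrightarrow> limit_density x"
    using AE_power_measure_pos
  proof eventually_elim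
    case (elim x)
    have "\<forall>\<^sub>F n in sequentially. x < L n"
      using L(1) by (simp add: filterlim_at_top_dense)
    then have "\<forall>\<^sub>F n in sequentially. comp_density n (x / real n) = ?f n x"
      by eventually_elim simp
    then have "(\<lambda>n. ?f n x) \<longlonglongrightarrow> limit_density x"
      by (rule Lim_transform_eventually[OF comp_density_limit[OF less_imp_le[OF elim]]])
    then show ?case by (rule LIMSEQ_ignore_initial_segment)
  qed
  have dom: "AE x in power_measure b. norm (?f (n + N) x) \<le> min 1 (1 / x)" for n
    using AE_power_measure_pos
  proof eventually_elim
    case (elim x)
    show ?case
    proof (cases "x < L (n + N)")
      case True
      let ?m = "n + N"
      have m: "0 < ?m" "x \<le> real ?m"
        using N(2) less_le_trans[OF True N(1)[of ?m]] by simp_all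
      have p: "0 < x / real ?m" "x / real ?m \<le> 1"
        using elim m by (simp_all del: of_nat_add)
      have "comp_density ?m (x / real ?m) \<le> 1 / (real ?m * (x / real ?m))"
        using m(1) p by (rule comp_density_le)
      also have "real ?m * (x / real ?m) = x"
        using m(1) by (simp del: of_nat_add)
      finally have "comp_density ?m (x / real ?m) \<le> min 1 (1 / x)"
        using comp_density_le_1[OF m(1) less_imp_le[OF p(1)] p(2)] by simp
      moreover have "0 \<le> comp_density ?m (x / real ?m)"
        using p by (intro comp_density_nonneg) simp_all
      ultimately show ?thesis using True by (simp del: of_nat_add)
    next
      case False
      then show ?thesis using elim by simp
    qed
  qed
  have ml: "limit_density \<in> borel_measurable (power_measure b)"
    by measurable
  have int: "integrable (power_measure b) limit_density"
    by (rule integrable_dominated_convergence[OF ml meas min_integrable[OF b] lim dom])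
  have conv: "(\<lambda>n. \<integral>x. ?f (n + N) x \<partial>power_measure b) \<longlonglongrightarrow> (\<integral>x. limit_density x \<partial>power_measure b)"
    by (rule integral_dominated_convergence[OF ml meas min_integrable[OF b] lim dom])
  have t0: "0 \<le> ?t k" for k
    using b by (simp add: Gamma_real_nonneg)
  have pos: "AE x in power_measure b. 0 \<le> limit_density x"
    using AE_power_measure_pos
    by eventually_elim (auto simp: limit_density_def intro!: suminf_nonneg summable_density_term density_term_nonneg)
  have "ennreal (\<integral>x. limit_density x \<partial>power_measure b) = (\<integral>\<^sup>+x. ennreal (limit_density x) \<partial>power_measure b)"
    using int pos by (rule nn_integral_eq_integral[symmetric])
  also have "\<dots> = (\<integral>\<^sup>+x. (\<Sum>k. ennreal (density_term x k)) \<partial>power_measure b)"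
  proof (rule nn_integral_cong_AE)
    show "AE x in power_measure b. ennreal (limit_density x) = (\<Sum>k. ennreal (density_term x k))"
      using AE_power_measure_pos
      by eventually_elim
        (auto simp: limit_density_def intro!: suminf_ennreal2[symmetric] summable_density_term density_term_nonneg)
  qed
  also have "\<dots> = (\<Sum>k. \<integral>\<^sup>+x. ennreal (density_term x k) \<partial>power_measure b)"
    by (rule nn_integral_suminf) (simp add: density_term_def)
  also have "\<dots> = (\<Sum>k. ennreal (?t k))"
    using b by (simp add: density_term_integral)
  \<comment> \<open>The series in \<open>ennreal\<close> equals a finite integral, which also yields
    summability over the reals.\<close>
  finally have eq: "(\<Sum>k. ennreal (?t k)) = ennreal (\<integral>x. limit_density x \<partial>power_measure b)" ..
  show sum: "summable ?t"
    using t0 by (rule summable_suminf_not_top) (simp only: eq ennreal_neq_top not_False_eq_True)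
  have "suminf ?t = (\<integral>x. limit_density x \<partial>power_measure b)"
    using eq[unfolded suminf_ennreal2[OF t0 sum]] suminf_nonneg[OF sum t0] integral_nonneg_AE[OF pos]
    by (simp only: ennreal_inj)
  then show "(\<lambda>n. \<integral>x. ?f n x \<partial>power_measure b) \<longlonglongrightarrow> suminf ?t"
    using LIMSEQ_offset[OF conv] by simp
qed

section \<open>Concentration of the minimum spanning tree weight\<close>

definition cut :: "nat \<Rightarrow> nat set \<Rightarrow> nat set set" where
  "cut n S = (\<lambda>(u, v). {u, v}) ` (S \<times> ({..<n} - S))"

lemma cut_subset: "S \<subseteq> {..<n} \<Longrightarrow> cut n S \<subseteq> complete_edges n"
  by (auto simp: cut_def complete_edges_def)

lemma card_cut:
  assumes "S \<subseteq> {..<n}"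
  shows "card (cut n S) = card S * (n - card S)"
proof -
  have "inj_on (\<lambda>(u, v). {u, v}) (S \<times> ({..<n} - S))"
    by (auto simp: inj_on_def doubleton_eq_iff)
  then have "card (cut n S) = card (S \<times> ({..<n} - S))"
    unfolding cut_def by (rule card_image)
  also have "\<dots> = card S * card ({..<n} - S)"
    by (rule card_cartesian_product)
  also have "card ({..<n} - S) = n - card S"
    using assms by (subst card_Diff_subset) (auto intro: finite_subset)
  finally show ?thesis .
qed

text \<open>Neither a component nor its complement has an edge leaving it, and one of the two has at
  most n/2 vertices. That side faces at least n/2 vertices, so its cut has at least
  \<open>card S\<close> times n/2 possible edges.\<close>

lemma disconnected_cut:
  assumes "T \<subseteq> complete_edges n" "0 < n" "ncomp n T \<noteq> 1"
  obtains S where "S \<subseteq> {..<n}" "S \<noteq> {}" "2 * card S \<le> n" "T \<inter> cut n S = {}"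
proof -
  have "\<not> (\<forall>u<n. \<forall>v<n. (u, v) \<in> (adjacency T)\<^sup>*)"
    using ncomp_connected[OF assms(2)] assms(3) by blast
  then obtain u v where uv: "u < n" "v < n" "v \<notin> component T u"
    by (auto simp: component_def)
  define A where "A = component T u"
  have A: "A \<subseteq> {..<n}"
    unfolding A_def using component_subset[OF assms(1) uv(1)] .
  have closed: "x \<in> A \<longleftrightarrow> y \<in> A" if "{x, y} \<in> T" for x y
  proof -
    have "y \<in> component T x" using that by (auto simp: component_def adjacency_def)
    then show ?thesis unfolding A_def using component_eq component_sym by blast
  qed
  have d1: "T \<inter> cut n A = {}" and d2: "T \<inter> cut n ({..<n} - A) = {}"
    using closed by (auto simp: cut_def)
  have "u \<in> A" "v \<notin> A" using uv by (simp_all add: A_def)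
  show ?thesis
  proof (cases "2 * card A \<le> n")
    case True
    then show ?thesis using that[of A] A d1 \<open>u \<in> A\<close> by blast
  next
    case False
    have "card ({..<n} - A) = n - card A"
      using A by (subst card_Diff_subset) (auto intro: finite_subset)
    then have "2 * card ({..<n} - A) \<le> n" using False by simp
    then show ?thesis using that[of "{..<n} - A"] d2 \<open>v \<notin> A\<close> uv(2) by blast
  qed
qed

lemma bexp_avoid:
  assumes "finite E" "D \<subseteq> E"
  shows "bexp E p (\<lambda>T. of_bool (T \<inter> D = {})) = (1 - p) ^ card D"
proof -
  have "bexp E p (\<lambda>T. of_bool (T \<inter> D = {})) = bexp D p (\<lambda>T. of_bool (T \<inter> D = {}))"
    using assms by (intro bexp_local) auto
  also have "\<dots> = (\<Sum>A\<in>{{}}. p ^ card A * (1 - p) ^ card (D - A) * of_bool (A \<inter> D = {}))"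
    unfolding bexp_def using assms
    by (intro sum.mono_neutral_right) (auto intro: finite_subset)
  finally show ?thesis by simp
qed

text \<open>Union bound over the sets \<open>S\<close> of \<open>disconnected_cut\<close>: all of at
  least |S| n/2 edges are absent with probability at most y^|S|. Extending the sum to all nonempty
  \<open>S\<close> gives the closed form (1 + y)^n - 1.\<close>

lemma bexp_disconnected:
  assumes "0 < n" "0 \<le> p" "p \<le> 1"
  shows "bexp (complete_edges n) p (\<lambda>T. of_bool (ncomp n T \<noteq> 1)) \<le> (1 + exp (- (p * real n / 2))) ^ n - 1"
proof -
  let ?F = "{S \<in> Pow {..<n}. S \<noteq> {} \<and> 2 * card S \<le> n}"
  define y where "y = exp (- (p * real n / 2))"
  have "bexp (complete_edges n) p (\<lambda>T. of_bool (ncomp n T \<noteq> 1)) \<le>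
      bexp (complete_edges n) p (\<lambda>T. \<Sum>S\<in>?F. of_bool (T \<inter> cut n S = {}))"
  proof (rule bexp_mono[OF assms(2,3)])
    fix T assume T: "T \<subseteq> complete_edges n"
    show "of_bool (ncomp n T \<noteq> 1) \<le> (\<Sum>S\<in>?F. of_bool (T \<inter> cut n S = {}) :: real)"
    proof (cases "ncomp n T = 1")
      case True
      then show ?thesis by (simp add: sum_nonneg)
    next
      case False
      then obtain S where S: "S \<subseteq> {..<n}" "S \<noteq> {}" "2 * card S \<le> n" "T \<inter> cut n S = {}"
        by (rule disconnected_cut[OF T assms(1)])
      then have "S \<in> ?F" by simp
      with S(4) have "(1 :: real) \<le> (\<Sum>S\<in>?F. of_bool (T \<inter> cut n S = {}))"
        using member_le_sum[of S ?F "\<lambda>S. of_bool (T \<inter> cut n S = {}) :: real"] by auto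
      then show ?thesis using False by simp
    qed
  qed
  also have "\<dots> = (\<Sum>S\<in>?F. (1 - p) ^ card (cut n S))"
    unfolding bexp_sum
    by (intro sum.cong refl bexp_avoid finite_complete_edges cut_subset) auto
  also have "\<dots> \<le> (\<Sum>S\<in>?F. y ^ card S)"
  proof (rule sum_mono)
    fix S assume S: "S \<in> ?F"
    have "(1 - p) ^ card (cut n S) \<le> exp (- p) ^ card (cut n S)"
      using assms exp_ge_add_one_self[of "- p"] by (intro power_mono) auto
    also have "\<dots> = exp (- (real (card S) * (p * real (n - card S))))"
      using S by (simp add: card_cut mult_ac flip: exp_of_nat_mult)
    also have "\<dots> \<le> exp (- (real (card S) * (p * (real n / 2))))"
    proof -
      have "real n / 2 \<le> real (n - card S)" using S by auto
      then have "real (card S) * (p * (real n / 2)) \<le> real (card S) * (p * real (n - card S))"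
        using assms by (intro mult_left_mono) auto
      then show ?thesis by simp
    qed
    also have "\<dots> = y ^ card S"
      unfolding y_def by (simp flip: exp_of_nat_mult)
    finally show "(1 - p) ^ card (cut n S) \<le> y ^ card S" .
  qed
  also have "\<dots> \<le> (\<Sum>S\<in>Pow {..<n} - {{}}. y ^ card S)"
    by (rule sum_mono2) (auto simp: y_def)
  also have "\<dots> = (\<Sum>S\<in>Pow {..<n}. y ^ card S) - 1"
    by (simp add: sum_diff1)
  also have "(\<Sum>S\<in>Pow {..<n}. y ^ card S) = (1 + y) ^ n"
    using prod_add[of "{..<n}" "\<lambda>_. y" "\<lambda>_. 1"] by (simp add: add.commute)
  finally show ?thesis by (simp add: y_def)
qed

lemma power_measure_threshold:
  assumes "0 < b" "0 < s" "0 \<le> L" "0 \<le> y"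
  shows "(\<integral>x. indicator {..<L} x * (if s * x powr b < y then 1 else 0) \<partial>power_measure b) = min (L powr b) (y / s)"
proof -
  define r where "r = (y / s) powr (1 / b)"
  have r: "0 \<le> r" "r powr b = y / s"
    using assms by (simp_all add: r_def powr_powr)
  have "(\<integral>x. indicator {..<L} x * (if s * x powr b < y then 1 else 0) \<partial>power_measure b) =
      (\<integral>x. (indicator {..<min L r} x :: real) \<partial>power_measure b)"
  proof (rule integral_cong_AE)
    show "AE x in power_measure b. indicator {..<L} x * (if s * x powr b < y then 1 else 0) =
        (indicator {..<min L r} x :: real)"
      using AE_power_measure_pos
    proof eventually_elim
      case (elim x)
      have "s * x powr b < y \<longleftrightarrow> x powr b < r powr b"
        unfolding r(2) using assms(2) by (simp add: pos_less_divide_eq mult.commute)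
      also have "\<dots> \<longleftrightarrow> x < r"
        using elim r assms by (meson linorder_not_less less_imp_le powr_less_mono2 powr_mono2)
      finally show ?case by (auto simp: indicator_def)
    qed
  qed measurable
  also have "\<dots> = measure (power_measure b) {..<min L r}"
    by simp
  also have "\<dots> = min L r powr b"
    using emeasure_power_measure[of b "min L r"] assms r by (simp add: measure_def)
  also have "\<dots> = min (L powr b) (y / s)"
  proof (cases "L \<le> r")
    case True
    then have "L powr b \<le> r powr b" using assms by (intro powr_mono2) auto
    then show ?thesis using True r(2) by (simp add: min_def)
  next
    case False
    then have "r powr b \<le> L powr b" using assms r(1) by (intro powr_mono2) auto
    then show ?thesis using False r(2) by (simp add: min_absorb2)
  qed
  finally show ?thesis .
qed

lemma power_measure_integrable:
  fixes f :: "real \<Rightarrow> real"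
  assumes "0 < b" "0 \<le> L" and [measurable]: "f \<in> borel_measurable borel" and "\<And>x. \<bar>f x\<bar> \<le> B"
  shows "integrable (power_measure b) (\<lambda>x. indicator {..<L} x * f x)"
proof -
  have "integrable (power_measure b) (\<lambda>x. indicator {..<L} x *\<^sub>R f x)"
    using assms by (intro integrableI_bounded_set_indicator[where B = B]) (auto simp: emeasure_power_measure)
  then show ?thesis by simp
qed

text \<open>Only the lower end of the distribution is prescribed: for x <= L the edges of weight at
  most s x^b form the random graph G(n, x/n). The case x = 0 makes all weights positive almost
  surely.\<close>

locale random_weights = prob_space M for M :: "'a measure" +
  fixes n :: nat and X :: "nat set \<Rightarrow> 'a \<Rightarrow> real" and s b L :: real
  assumes n: "0 < n" and s: "0 < s" and b: "0 < b" and L: "0 \<le> L" "L \<le> real n"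
    and indep: "indep_vars (\<lambda>_. borel) X (complete_edges n)"
    and cdf: "\<And>e x. e \<in> complete_edges n \<Longrightarrow> 0 \<le> x \<Longrightarrow> x \<le> L \<Longrightarrow>
      prob {\<omega> \<in> space M. X e \<omega> \<le> s * x powr b} = x / real n"
begin

abbreviation "E \<equiv> complete_edges n"

definition H :: "real \<Rightarrow> 'a \<Rightarrow> nat set set" where
  "H x \<omega> = {e \<in> E. X e \<omega> \<le> s * x powr b}"

lemma H_subset: "H x \<omega> \<subseteq> E"
  by (auto simp: H_def)

lemma X_measurable [measurable]: "e \<in> E \<Longrightarrow> X e \<in> borel_measurable M"
  using indep by (auto simp: indep_vars_def)

lemma H_event [measurable]: "{\<omega> \<in> space M. H x \<omega> = A} \<in> events"
proof -
  have "{\<omega> \<in> space M. H x \<omega> = A} =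
      (if A \<subseteq> E then {\<omega> \<in> space M. \<forall>e\<in>E. X e \<omega> \<le> s * x powr b \<longleftrightarrow> e \<in> A} else {})"
    by (auto simp: H_def)
  moreover have "{\<omega> \<in> space M. \<forall>e\<in>E. X e \<omega> \<le> s * x powr b \<longleftrightarrow> e \<in> A} \<in> events"
    by (intro sets.sets_Collect_finite_All finite_complete_edges) measurable
  ultimately show ?thesis by simp
qed

lemma prob_H:
  assumes A: "A \<subseteq> E" and x: "0 \<le> x" "x \<le> L"
  shows "prob {\<omega> \<in> space M. H x \<omega> = A} = (x / real n) ^ card A * (1 - x / real n) ^ card (E - A)"
\<comment> \<open>For \<open>n = 1\<close> there are no edges, and the empty intersection used below
  would not be \<open>space M\<close>.\<close>
proof (cases "E = {}")
  case True
  then show ?thesis using A by (simp add: H_def prob_space)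
next
  case False
  let ?t = "s * x powr b" and ?p = "x / real n"
  let ?B = "\<lambda>e. if e \<in> A then {..?t} else {?t<..}"
  have le: "prob (X e -` {..?t} \<inter> space M) = ?p" if "e \<in> E" for e
    using cdf[OF that x] by (simp add: vimage_def Int_def conj_commute)
  have gt: "prob (X e -` {?t<..} \<inter> space M) = 1 - ?p" if e: "e \<in> E" for e
  proof -
    have "X e -` {..?t} \<inter> space M \<in> events" using e by measurable
    from prob_compl[OF this] have "prob (space M - X e -` {..?t} \<inter> space M) = 1 - ?p"
      using le[OF e] by simp
    moreover have "space M - X e -` {..?t} \<inter> space M = X e -` {?t<..} \<inter> space M"
      by (auto simp: not_le)
    ultimately show ?thesis by simp
  qed
  have "{\<omega> \<in> space M. H x \<omega> = A} = (\<Inter>e\<in>E. X e -` ?B e \<inter> space M)"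
    using A False by (auto simp: H_def not_le split: if_splits)
  also have "prob \<dots> = (\<Prod>e\<in>E. prob (X e -` ?B e \<inter> space M))"
    using False by (intro indep_varsD_finite[OF indep]) auto
  also have "\<dots> = (\<Prod>e\<in>E - A. prob (X e -` ?B e \<inter> space M)) * (\<Prod>e\<in>A. prob (X e -` ?B e \<inter> space M))"
    using A by (intro prod.subset_diff) auto
  also have "(\<Prod>e\<in>E - A. prob (X e -` ?B e \<inter> space M)) = (\<Prod>e\<in>E - A. 1 - ?p)"
    by (intro prod.cong refl) (simp add: gt)
  also have "(\<Prod>e\<in>A. prob (X e -` ?B e \<inter> space M)) = (\<Prod>e\<in>A. ?p)"
    using A by (intro prod.cong refl) (simp add: le subset_iff)
  finally show ?thesis by simp
qed

text \<open>The bridge from the probability space to finite sums: \<open>H x\<close> takes finitely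
  many values, with Bernoulli weights as probabilities.\<close>

lemma H_expectation:
  assumes x: "0 \<le> x" "x \<le> L" and f: "\<And>A. A \<subseteq> E \<Longrightarrow> 0 \<le> f A"
  shows "(\<integral>\<^sup>+\<omega>. ennreal (f (H x \<omega>)) \<partial>M) = ennreal (bexp E (x / real n) f)"
proof -
  have p: "0 \<le> x / real n" "x / real n \<le> 1" using x L n by (auto simp: field_simps)
  have "(\<integral>\<^sup>+\<omega>. ennreal (f (H x \<omega>)) \<partial>M) =
      (\<integral>\<^sup>+\<omega>. (\<Sum>A\<in>Pow E. ennreal (f A) * indicator {\<omega> \<in> space M. H x \<omega> = A} \<omega>) \<partial>M)"
  proof (rule nn_integral_cong)
    fix \<omega> assume \<omega>: "\<omega> \<in> space M"
    have "(\<Sum>A\<in>Pow E. ennreal (f A) * indicator {\<omega> \<in> space M. H x \<omega> = A} \<omega>) =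
        (\<Sum>A\<in>{H x \<omega>}. ennreal (f A) * indicator {\<omega> \<in> space M. H x \<omega> = A} \<omega>)"
      by (intro sum.mono_neutral_right) (use H_subset in \<open>auto simp: indicator_def\<close>)
    then show "ennreal (f (H x \<omega>)) = (\<Sum>A\<in>Pow E. ennreal (f A) * indicator {\<omega> \<in> space M. H x \<omega> = A} \<omega>)"
      using \<omega> by simp
  qed
  also have "\<dots> = (\<Sum>A\<in>Pow E. \<integral>\<^sup>+\<omega>. ennreal (f A) * indicator {\<omega> \<in> space M. H x \<omega> = A} \<omega> \<partial>M)"
    by (rule nn_integral_sum) measurable
  also have "\<dots> = (\<Sum>A\<in>Pow E. ennreal (f A) * emeasure M {\<omega> \<in> space M. H x \<omega> = A})"
    by (intro sum.cong refl nn_integral_cmult_indicator) measurable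
  also have "\<dots> = (\<Sum>A\<in>Pow E. ennreal ((x / real n) ^ card A * (1 - x / real n) ^ card (E - A) * f A))"
    using p f by (intro sum.cong refl) (simp add: emeasure_eq_measure prob_H x mult.commute ennreal_mult')
  also have "\<dots> = ennreal (bexp E (x / real n) f)"
    unfolding bexp_def using p f by (intro sum_ennreal) auto
  finally show ?thesis .
qed

text \<open>The indicator of \<open>H x \<omega> = A\<close> is a product over the edges of 0-1
  comparisons, each jointly measurable in both variables. Fubini's theorem in
  \<open>excess_bound\<close> needs this joint form.\<close>

lemma H_joint_measurable [measurable]:
  "(\<lambda>(\<omega>, x). f (H x \<omega>) :: real) \<in> borel_measurable (M \<Otimes>\<^sub>M power_measure b)"
proof -
  have "(\<lambda>(\<omega>, x). f (H x \<omega>) :: real) =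
      (\<lambda>z. \<Sum>A\<in>Pow E. f A * (\<Prod>e\<in>E. if X e (fst z) \<le> s * snd z powr b then of_bool (e \<in> A) else of_bool (e \<notin> A)))"
  proof (rule ext, clarsimp)
    fix \<omega> x
    let ?g = "\<lambda>A. \<Prod>e\<in>E. if X e \<omega> \<le> s * x powr b then of_bool (e \<in> A) else of_bool (e \<notin> A) :: real"
    have "?g A = 0" if A: "A \<subseteq> E" "A \<noteq> H x \<omega>" for A
    proof -
      obtain e where "e \<in> E" "(X e \<omega> \<le> s * x powr b) \<noteq> (e \<in> A)"
        using A by (auto simp: H_def)
      then show ?thesis by (intro prod_zero) auto
    qed
    then have "(\<Sum>A\<in>Pow E. f A * ?g A) = (\<Sum>A\<in>{H x \<omega>}. f A * ?g A)"
      using H_subset by (intro sum.mono_neutral_right) auto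
    moreover have "?g (H x \<omega>) = 1"
      by (intro prod.neutral) (auto simp: H_def)
    ultimately show "f (H x \<omega>) = (\<Sum>A\<in>Pow E. f A * ?g A)" by simp
  qed
  also have "\<dots> \<in> borel_measurable (M \<Otimes>\<^sub>M power_measure b)"
  proof (intro borel_measurable_sum borel_measurable_times borel_measurable_prod borel_measurable_const)
    fix A e assume [measurable]: "e \<in> E"
    show "(\<lambda>z. if X e (fst z) \<le> s * snd z powr b then of_bool (e \<in> A) else of_bool (e \<notin> A) :: real)
        \<in> borel_measurable (M \<Otimes>\<^sub>M power_measure b)"
      by measurable
  qed
  finally show ?thesis .
qed

lemma H_section_measurable:
  assumes "\<omega> \<in> space M"
  shows "(\<lambda>x. f (H x \<omega>) :: real) \<in> borel_measurable borel"
proof -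
  have "(\<lambda>x. (\<lambda>(\<omega>, x). f (H x \<omega>) :: real) (\<omega>, x)) \<in> borel_measurable (power_measure b)"
    using measurable_Pair1'[OF assms] H_joint_measurable by (rule measurable_compose)
  then show ?thesis by (simp cong: measurable_cong_sets)
qed

text \<open>An integrated deviation: its mean follows from the deviation at each fixed x, so no
  bound uniform in x is required, and it controls the integral in Kruskal's formula
  directly.\<close>

definition excess :: "'a \<Rightarrow> ennreal" where
  "excess \<omega> = (\<integral>\<^sup>+x. ennreal (indicator {..<L} x *
     \<bar>real (ncomp n (H x \<omega>)) - real n * comp_density n (x / real n)\<bar>) \<partial>power_measure b)"

lemma excess_measurable [measurable]: "excess \<in> borel_measurable M"
proof -
  interpret P: sigma_finite_measure "power_measure b" by (rule sigma_finite_power_measure)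
  show ?thesis
    unfolding excess_def[abs_def]
    using H_joint_measurable[of "\<lambda>T. real (ncomp n T)"]
    by (intro P.borel_measurable_nn_integral) (simp add: case_prod_beta')
qed

text \<open>Fubini, then \<open>bexp_deviation\<close> at fixed x: with at most n^2 edges and p =
  x/n the deviation is at most sqrt(n x) <= sqrt(n L), and {..<L} has mass L^b.\<close>

lemma excess_bound: "(\<integral>\<^sup>+\<omega>. excess \<omega> \<partial>M) \<le> ennreal (sqrt (real n * L) * L powr b)"
proof -
  interpret P: sigma_finite_measure "power_measure b" by (rule sigma_finite_power_measure)
  interpret PP: pair_sigma_finite M "power_measure b" ..
  let ?d = "\<lambda>\<omega> x. \<bar>real (ncomp n (H x \<omega>)) - real n * comp_density n (x / real n)\<bar>"
  have "(\<integral>\<^sup>+\<omega>. excess \<omega> \<partial>M) = (\<integral>\<^sup>+x. (\<integral>\<^sup>+\<omega>. ennreal (indicator {..<L} x * ?d \<omega> x) \<partial>M) \<partial>power_measure b)"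
    unfolding excess_def
    using H_joint_measurable[of "\<lambda>T. real (ncomp n T)"]
    by (intro PP.Fubini'[symmetric]) (simp add: case_prod_beta')
  also have "\<dots> \<le> (\<integral>\<^sup>+x. ennreal (sqrt (real n * L)) * indicator {..<L} x \<partial>power_measure b)"
  proof (rule nn_integral_mono_AE)
    show "AE x in power_measure b. (\<integral>\<^sup>+\<omega>. ennreal (indicator {..<L} x * ?d \<omega> x) \<partial>M) \<le>
        ennreal (sqrt (real n * L)) * indicator {..<L} x"
      using AE_power_measure_pos
    proof eventually_elim
      case (elim x)
      show ?case
      proof (cases "x < L")
        case True
        then have x: "0 \<le> x" "x \<le> L" using elim by auto
        have p: "0 \<le> x / real n" "x / real n \<le> 1" using x L n by (auto simp: field_simps)
        let ?f = "\<lambda>T. real (ncomp n T)"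
        have "(\<integral>\<^sup>+\<omega>. ennreal (indicator {..<L} x * ?d \<omega> x) \<partial>M) =
            ennreal (bexp E (x / real n) (\<lambda>T. \<bar>?f T - bexp E (x / real n) ?f\<bar>))"
          using True by (simp add: bexp_ncomp flip: H_expectation[OF x])
        also have "bexp E (x / real n) (\<lambda>T. \<bar>?f T - bexp E (x / real n) ?f\<bar>) \<le>
            sqrt (real (card E) * (x / real n))"
        proof (rule bexp_deviation[OF finite_complete_edges p])
          fix e A assume "e \<in> E" "A \<subseteq> E"
          then show "\<bar>?f (insert e A) - ?f A\<bar> \<le> 1"
            using ncomp_insert_bounds[of e n A] by simp
        qed
        also have "real (card E) * (x / real n) \<le> real (n\<^sup>2) * (x / real n)"
          using card_complete_edges_le p by (intro mult_right_mono) (auto simp only: of_nat_le_iff)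
        also have "\<dots> = real n * x"
          using n by (simp add: power2_eq_square)
        also have "\<dots> \<le> real n * L" using x by (intro mult_left_mono) auto
        finally show ?thesis using True by (simp add: ennreal_leI)
      qed simp
    qed
  qed
  also have "\<dots> = ennreal (sqrt (real n * L)) * emeasure (power_measure b) {..<L}"
    by (intro nn_integral_cmult_indicator) simp
  also have "\<dots> = ennreal (sqrt (real n * L) * L powr b)"
    using b L by (simp add: emeasure_power_measure ennreal_mult)
  finally show ?thesis .
qed

definition mean_density :: real where
  "mean_density = (\<integral>x. indicator {..<L} x * comp_density n (x / real n) \<partial>power_measure b)"

lemma excess_integral:
  assumes \<omega>: "\<omega> \<in> space M" and ex: "excess \<omega> < ennreal d"
  shows "\<bar>(\<integral>x. indicator {..<L} x * real (ncomp n (H x \<omega>)) \<partial>power_measure b) - real n * mean_density\<bar> \<le> d"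
    and "integrable (power_measure b) (\<lambda>x. indicator {..<L} x * real (ncomp n (H x \<omega>)))"
proof -
  let ?N = "\<lambda>x. real (ncomp n (H x \<omega>))"
  let ?m = "\<lambda>x. real n * comp_density n (x / real n)"
  let ?I = "\<lambda>x. indicator {..<L} x :: real"
  have [measurable]: "?N \<in> borel_measurable borel"
    by (rule H_section_measurable[OF \<omega>])
  show i1: "integrable (power_measure b) (\<lambda>x. ?I x * ?N x)"
    using b L ncomp_le by (intro power_measure_integrable[where B = "real n"]) auto
  \<comment> \<open>\<open>comp_density\<close> is only known to be bounded where x/n is a
    probability, so the integrand is first replaced by 0 at negative x, which form a null
    set.\<close>
  have "integrable (power_measure b) (\<lambda>x. ?I x * (if x \<in> {0..L} then ?m x else 0))"
  proof (rule power_measure_integrable[where B = "real n"])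
    show "\<bar>if x \<in> {0..L} then ?m x else 0\<bar> \<le> real n" for x
    proof (cases "x \<in> {0..L}")
      case True
      then have p: "0 \<le> x / real n" "x / real n \<le> 1" using L n by (auto simp: field_simps)
      then show ?thesis
        using comp_density_le_1[OF n p] comp_density_nonneg[OF p, of n] True
        by (simp add: abs_mult mult_left_le)
    next
      case False
      then have "(if x \<in> {0..L} then ?m x else 0) = 0" by (rule if_not_P)
      then show ?thesis by simp
    qed
    show "0 < b" "0 \<le> L" by (rule b, rule L)
    show "(\<lambda>x. if x \<in> {0..L} then ?m x else 0) \<in> borel_measurable borel" by measurable
  qed
  then have i2: "integrable (power_measure b) (\<lambda>x. ?I x * ?m x)"
  proof (rule integrable_cong_AE_imp)
    show "AE x in power_measure b. ?I x * (if x \<in> {0..L} then ?m x else 0) = ?I x * ?m x"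
      using AE_power_measure_pos by eventually_elim (auto simp: indicator_def)
  qed measurable
  have abs_eq: "\<bar>?I x * ?N x - ?I x * ?m x\<bar> = ?I x * \<bar>?N x - ?m x\<bar>" for x
    by (simp add: indicator_def)
  have i3: "integrable (power_measure b) (\<lambda>x. ?I x * \<bar>?N x - ?m x\<bar>)"
    using integrable_abs[OF Bochner_Integration.integrable_diff[OF i1 i2]] unfolding abs_eq .
  define J where "J = (\<integral>x. ?I x * \<bar>?N x - ?m x\<bar> \<partial>power_measure b)"
  have "(\<integral>x. ?I x * ?m x \<partial>power_measure b) = real n * mean_density"
    unfolding mean_density_def by (simp add: mult.left_commute flip: integral_mult_right_zero)
  then have eq: "(\<integral>x. ?I x * ?N x \<partial>power_measure b) - real n * mean_density =
      (\<integral>x. ?I x * ?N x - ?I x * ?m x \<partial>power_measure b)"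
    by (simp only: Bochner_Integration.integral_diff[OF i1 i2])
  have le: "\<bar>(\<integral>x. ?I x * ?N x \<partial>power_measure b) - real n * mean_density\<bar> \<le> J"
    unfolding eq J_def abs_eq[symmetric] by (rule integral_abs_bound)
  have "0 \<le> J" unfolding J_def by (rule integral_nonneg_AE) simp
  moreover have "ennreal J = excess \<omega>"
    unfolding excess_def J_def using i3 by (rule nn_integral_eq_integral[symmetric]) simp
  ultimately have "J < d"
    using ex ennreal_less_iff[of J d] by simp
  then show "\<bar>(\<integral>x. ?I x * ?N x \<partial>power_measure b) - real n * mean_density\<bar> \<le> d"
    using le by linarith
qed

text \<open>The layer-cake formula: an edge of weight \<open>y\<close> contributes \<open>y / s\<close> to the integral of the
  number of tree edges above the threshold \<open>s x\<^sup>b\<close>.\<close>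
lemma tree_weight_integral:
  assumes T: "T \<subseteq> E" and pos: "\<And>e. e \<in> T \<Longrightarrow> 0 \<le> X e \<omega>"
  shows "(\<integral>x. indicator {..<L} x * real (card {e \<in> T. X e \<omega> > s * x powr b}) \<partial>power_measure b) =
      (\<Sum>e\<in>T. min (L powr b) (X e \<omega> / s))"
    and "integrable (power_measure b) (\<lambda>x. indicator {..<L} x * real (card {e \<in> T. X e \<omega> > s * x powr b}))"
proof -
  have finT: "finite T" using T by (rule finite_edges)
  have eq: "indicator {..<L} x * real (card {e \<in> T. X e \<omega> > s * x powr b}) =
      (\<Sum>e\<in>T. indicator {..<L} x * (if s * x powr b < X e \<omega> then 1 else 0))" for x
  proof -
    have "(\<Sum>e\<in>T. (if s * x powr b < X e \<omega> then 1 else 0 :: real)) = real (card {e \<in> T. X e \<omega> > s * x powr b})"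
      using finT by (simp add: sum.If_cases Int_def)
    then show ?thesis by (simp flip: sum_distrib_left)
  qed
  have int: "integrable (power_measure b) (\<lambda>x. indicator {..<L} x * (if s * x powr b < X e \<omega> then 1 else 0 :: real))" for e
    using b L by (intro power_measure_integrable[where B = 1]) auto
  show "integrable (power_measure b) (\<lambda>x. indicator {..<L} x * real (card {e \<in> T. X e \<omega> > s * x powr b}))"
    unfolding eq using int by (intro Bochner_Integration.integrable_sum)
  show "(\<integral>x. indicator {..<L} x * real (card {e \<in> T. X e \<omega> > s * x powr b}) \<partial>power_measure b) =
      (\<Sum>e\<in>T. min (L powr b) (X e \<omega> / s))"
    unfolding eq using int b s L pos
    by (subst Bochner_Integration.integral_sum) (auto intro!: sum.cong power_measure_threshold)
qed

text \<open>The loss \<open>L powr b\<close> in the lower bound is the integral of 1 over {..<L},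
  since the number of tree edges above a threshold is compared with the number of components minus
  one. In the upper bound, connectivity at x = L puts all edges of Kruskal's tree below
  \<open>s * L powr b\<close>, so the truncation in \<open>tree_weight_integral\<close> is exact for
  it.\<close>

lemma tree_weight_bounds:
  assumes \<omega>: "\<omega> \<in> space M" and ex: "excess \<omega> < ennreal d" and pos: "\<And>e. e \<in> E \<Longrightarrow> 0 \<le> X e \<omega>"
  shows "spanning_tree n T \<Longrightarrow> s * (real n * mean_density - d - L powr b) \<le> (\<Sum>e\<in>T. X e \<omega>)"
    and "ncomp n (H L \<omega>) = 1 \<Longrightarrow>
      \<exists>T. spanning_tree n T \<and> (\<Sum>e\<in>T. X e \<omega>) \<le> s * (real n * mean_density + d)"
proof -
  let ?I = "\<lambda>x. indicator {..<L} x :: real"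
  let ?N = "\<lambda>x. real (ncomp n (H x \<omega>))"
  note ei = excess_integral[OF \<omega> ex]
  have i1: "integrable (power_measure b) ?I"
    using power_measure_integrable[of b L "\<lambda>_. 1" 1] b L by simp
  have v1: "(\<integral>x. ?I x \<partial>power_measure b) = L powr b"
    using b L emeasure_power_measure[of b L] by (simp add: measure_def)
  {
    assume T: "spanning_tree n T"
    then have TE: "T \<subseteq> E" by (simp add: spanning_tree_def)
    then have posT: "\<And>e. e \<in> T \<Longrightarrow> 0 \<le> X e \<omega>" using pos by auto
    note tw = tree_weight_integral[OF TE posT]
    have "real n * mean_density - d - L powr b \<le> (\<integral>x. ?I x * ?N x \<partial>power_measure b) - (\<integral>x. ?I x \<partial>power_measure b)"
      using ei(1) v1 by linarith
    also have "\<dots> = (\<integral>x. ?I x * ?N x - ?I x \<partial>power_measure b)"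
      using ei(2) i1 by (rule Bochner_Integration.integral_diff[symmetric])
    also have "\<dots> \<le> (\<integral>x. ?I x * real (card {e \<in> T. X e \<omega> > s * x powr b}) \<partial>power_measure b)"
    proof (rule integral_mono)
      show "integrable (power_measure b) (\<lambda>x. ?I x * ?N x - ?I x)"
        using ei(2) i1 by (rule Bochner_Integration.integrable_diff)
      fix x
      have "?N x \<le> 1 + real (card {e \<in> T. X e \<omega> > s * x powr b})"
        using spanning_tree_ncomp_le[OF n T TE order_refl, of "\<lambda>e. X e \<omega>" "s * x powr b"]
        by (simp add: H_def)
      then show "?I x * ?N x - ?I x \<le> ?I x * real (card {e \<in> T. X e \<omega> > s * x powr b})"
        by (simp add: indicator_def)
    qed (rule tw(2))
    also have "\<dots> = (\<Sum>e\<in>T. min (L powr b) (X e \<omega> / s))" by (rule tw(1))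
    also have "\<dots> \<le> (\<Sum>e\<in>T. X e \<omega> / s)" by (intro sum_mono) simp
    also have "\<dots> = (\<Sum>e\<in>T. X e \<omega>) / s" by (simp add: sum_divide_distrib)
    finally show "s * (real n * mean_density - d - L powr b) \<le> (\<Sum>e\<in>T. X e \<omega>)"
      using s by (simp add: field_simps)
  }
  assume conn: "ncomp n (H L \<omega>) = 1"
  obtain T where T: "spanning_tree n T"
    "\<And>t. Suc (card {e \<in> T. X e \<omega> > t}) = ncomp n {e \<in> E. X e \<omega> \<le> t}"
    using minimum_spanning_tree[OF n, of "\<lambda>e. X e \<omega>"] by blast
  then have TE: "T \<subseteq> E" by (simp add: spanning_tree_def)
  then have posT: "\<And>e. e \<in> T \<Longrightarrow> 0 \<le> X e \<omega>" and finT: "finite T" using pos finite_edges by auto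
  note tw = tree_weight_integral[OF TE posT]
  have "card {e \<in> T. X e \<omega> > s * L powr b} = 0"
    using T(2)[of "s * L powr b"] conn by (simp add: H_def)
  then have "{e \<in> T. X e \<omega> > s * L powr b} = {}"
    using finT by simp
  then have small: "X e \<omega> / s \<le> L powr b" if "e \<in> T" for e
    using that s by (auto simp: field_simps not_less)
  have "(\<Sum>e\<in>T. X e \<omega>) / s = (\<Sum>e\<in>T. min (L powr b) (X e \<omega> / s))"
    unfolding sum_divide_distrib using small by (intro sum.cong refl) (simp add: min_absorb2)
  also have "\<dots> = (\<integral>x. ?I x * real (card {e \<in> T. X e \<omega> > s * x powr b}) \<partial>power_measure b)"
    by (rule tw(1)[symmetric])
  also have "\<dots> \<le> (\<integral>x. ?I x * ?N x \<partial>power_measure b)"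
  proof (rule integral_mono[OF tw(2) ei(2)])
    fix x
    have "real (card {e \<in> T. X e \<omega> > s * x powr b}) \<le> ?N x"
      using T(2)[of "s * x powr b"] by (simp add: H_def)
    then show "?I x * real (card {e \<in> T. X e \<omega> > s * x powr b}) \<le> ?I x * ?N x"
      by (intro mult_left_mono) auto
  qed
  also have "\<dots> \<le> real n * mean_density + d" using ei(1) by linarith
  finally have "(\<Sum>e\<in>T. X e \<omega>) \<le> s * (real n * mean_density + d)"
    using s by (simp add: field_simps)
  with T(1) show "\<exists>T. spanning_tree n T \<and> (\<Sum>e\<in>T. X e \<omega>) \<le> s * (real n * mean_density + d)" by blast
qed

lemma prob_disconnected:
  "prob {\<omega> \<in> space M. ncomp n (H L \<omega>) \<noteq> 1} \<le> (1 + exp (- (L / 2))) ^ n - 1"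
proof -
  have ev: "{\<omega> \<in> space M. ncomp n (H L \<omega>) \<noteq> 1} = (\<Union>A\<in>{A \<in> Pow E. ncomp n A \<noteq> 1}. {\<omega> \<in> space M. H L \<omega> = A})"
    using H_subset by auto
  then have dm: "{\<omega> \<in> space M. ncomp n (H L \<omega>) \<noteq> 1} \<in> events"
    by (simp only:) (intro sets.finite_UN, auto)
  have "ennreal (prob {\<omega> \<in> space M. ncomp n (H L \<omega>) \<noteq> 1}) =
      (\<integral>\<^sup>+\<omega>. indicator {\<omega> \<in> space M. ncomp n (H L \<omega>) \<noteq> 1} \<omega> \<partial>M)"
    using dm by (simp only: nn_integral_indicator emeasure_eq_measure)
  also have "\<dots> = (\<integral>\<^sup>+\<omega>. ennreal (of_bool (ncomp n (H L \<omega>) \<noteq> 1)) \<partial>M)"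
    by (intro nn_integral_cong) (auto simp: indicator_def)
  also have "\<dots> = ennreal (bexp E (L / real n) (\<lambda>T. of_bool (ncomp n T \<noteq> 1)))"
    using L by (intro H_expectation) auto
  finally have "prob {\<omega> \<in> space M. ncomp n (H L \<omega>) \<noteq> 1} = bexp E (L / real n) (\<lambda>T. of_bool (ncomp n T \<noteq> 1))"
    using L n bexp_mono[of "L / real n" E "\<lambda>_. 0" "\<lambda>T. of_bool (ncomp n T \<noteq> 1)"]
    by (subst (asm) ennreal_inj) (auto simp: field_simps)
  also have "\<dots> \<le> (1 + exp (- (L / real n * real n / 2))) ^ n - 1"
    using L n by (intro bexp_disconnected) (auto simp: field_simps)
  finally show ?thesis using n by simp
qed

lemma prob_excess:
  assumes "0 < d"
  shows "prob {\<omega> \<in> space M. \<not> excess \<omega> < ennreal d} \<le> sqrt (real n * L) * L powr b / d"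
proof -
  have "ennreal (prob {\<omega> \<in> space M. \<not> excess \<omega> < ennreal d}) \<le>
      emeasure M {\<omega> \<in> space M. 1 \<le> ennreal (1 / d) * excess \<omega>}"
    unfolding emeasure_eq_measure[symmetric]
  proof (rule emeasure_mono)
    show "{\<omega> \<in> space M. \<not> excess \<omega> < ennreal d} \<subseteq> {\<omega> \<in> space M. 1 \<le> ennreal (1 / d) * excess \<omega>}"
    proof safe
      fix \<omega> assume "\<not> excess \<omega> < ennreal d"
      then have "ennreal (1 / d) * ennreal d \<le> ennreal (1 / d) * excess \<omega>"
        by (intro mult_left_mono) auto
      moreover have "ennreal (1 / d) * ennreal d = 1"
        using assms by (simp flip: ennreal_mult)
      ultimately show "1 \<le> ennreal (1 / d) * excess \<omega>" by simp
    qed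
  qed measurable
  also have "\<dots> \<le> ennreal (1 / d) * (\<integral>\<^sup>+\<omega>. excess \<omega> * indicator (space M) \<omega> \<partial>M)"
    by (rule nn_integral_Markov_inequality) auto
  also have "(\<integral>\<^sup>+\<omega>. excess \<omega> * indicator (space M) \<omega> \<partial>M) = (\<integral>\<^sup>+\<omega>. excess \<omega> \<partial>M)"
    by (intro nn_integral_cong) simp
  also have "ennreal (1 / d) * \<dots> \<le> ennreal (1 / d) * ennreal (sqrt (real n * L) * L powr b)"
    by (intro mult_left_mono excess_bound) auto
  also have "\<dots> = ennreal (sqrt (real n * L) * L powr b / d)"
    using assms L by (simp flip: ennreal_mult')
  finally show ?thesis
    using assms L by (subst (asm) ennreal_le_iff) auto
qed

text \<open>The exceptional event combines Markov's inequality for \<open>excess\<close>,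
  disconnection at x = L, and the null event of a nonpositive weight. With a measurable
  \<open>G\<close> on which both bounds hold, later arguments only have to intersect events.\<close>

theorem mst_concentration:
  assumes d: "0 < d"
  obtains G where "G \<in> events"
    "prob G \<ge> 1 - sqrt (real n * L) * L powr b / d - ((1 + exp (- (L / 2))) ^ n - 1)"
    "\<And>\<omega> T. \<omega> \<in> G \<Longrightarrow> spanning_tree n T \<Longrightarrow>
       s * (real n * mean_density - d - L powr b) \<le> (\<Sum>e\<in>T. X e \<omega>)"
    "\<And>\<omega>. \<omega> \<in> G \<Longrightarrow> \<exists>T. spanning_tree n T \<and> (\<Sum>e\<in>T. X e \<omega>) \<le> s * (real n * mean_density + d)"
proof -
  define B1 where "B1 = {\<omega> \<in> space M. \<not> excess \<omega> < ennreal d}"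
  define B2 where "B2 = {\<omega> \<in> space M. ncomp n (H L \<omega>) \<noteq> 1}"
  define B3 where "B3 = (\<Union>e\<in>E. {\<omega> \<in> space M. X e \<omega> \<le> 0})"
  have B1: "B1 \<in> events" unfolding B1_def by measurable
  have "B2 = (\<Union>A\<in>{A \<in> Pow E. ncomp n A \<noteq> 1}. {\<omega> \<in> space M. H L \<omega> = A})"
    unfolding B2_def using H_subset by auto
  then have B2: "B2 \<in> events"
    by (simp only:) (intro sets.finite_UN, auto)
  have X0: "{\<omega> \<in> space M. X e \<omega> \<le> 0} \<in> events" if [measurable]: "e \<in> E" for e
    by measurable
  then have B3: "B3 \<in> events"
    unfolding B3_def by (intro sets.finite_UN) auto
  have "prob B3 \<le> (\<Sum>e\<in>E. prob {\<omega> \<in> space M. X e \<omega> \<le> 0})"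
    unfolding B3_def using X0 by (intro finite_measure_subadditive_finite) auto
  also have "\<dots> = 0"
    \<comment> \<open>At x = 0 the threshold is 0, since \<open>0 powr b = 0\<close>, and its
      probability is 0/n.\<close>
    using cdf[of _ 0] L by simp
  finally have P3: "prob B3 \<le> 0" .
  define G where "G = space M - (B1 \<union> B2 \<union> B3)"
  have "prob (B1 \<union> B2 \<union> B3) \<le> prob B1 + prob B2 + prob B3"
    using measure_Un_le[of "B1 \<union> B2" M B3] measure_Un_le[of B1 M B2] B1 B2 B3 by auto
  also have "\<dots> \<le> sqrt (real n * L) * L powr b / d + ((1 + exp (- (L / 2))) ^ n - 1) + 0"
    using prob_excess[OF d] prob_disconnected P3 unfolding B1_def[symmetric] B2_def[symmetric]
    by (intro add_mono)
  finally have "prob G \<ge> 1 - sqrt (real n * L) * L powr b / d - ((1 + exp (- (L / 2))) ^ n - 1)"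
    unfolding G_def using B1 B2 B3 by (subst prob_compl) auto
  moreover have "G \<in> events" unfolding G_def using B1 B2 B3 by auto
  moreover have mem: "\<omega> \<in> space M" "excess \<omega> < ennreal d" "ncomp n (H L \<omega>) = 1" "\<And>e. e \<in> E \<Longrightarrow> 0 \<le> X e \<omega>"
    if "\<omega> \<in> G" for \<omega>
    using that by (auto simp: G_def B1_def B2_def B3_def not_le intro: less_imp_le)
  ultimately show ?thesis
  proof (intro that[of G])
    fix \<omega> assume \<omega>: "\<omega> \<in> G"
    note tb = tree_weight_bounds[OF mem(1)[OF \<omega>] mem(2)[OF \<omega>] mem(4)[OF \<omega>]]
    show "\<exists>T. spanning_tree n T \<and> (\<Sum>e\<in>T. X e \<omega>) \<le> s * (real n * mean_density + d)"
      using mem(3)[OF \<omega>] by (rule tb(2)[rotated])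
    fix T assume "spanning_tree n T"
    then show "s * (real n * mean_density - d - L powr b) \<le> (\<Sum>e\<in>T. X e \<omega>)"
      by (rule tb(1)[rotated])
  qed
qed

end

section \<open>Weighted sums of two powers of uniform variables\<close>

text \<open>The area of \<open>{(u, v). u, v \<ge> 0 \<and> u powr \<gamma> + v powr \<gamma> \<le> 1}\<close>.\<close>
definition area_const :: "real \<Rightarrow> real" where
  "area_const \<gamma> = (Gamma (1 / \<gamma> + 1))\<^sup>2 / Gamma (2 / \<gamma> + 1)"

lemma area_const_pos: "0 < \<gamma> \<Longrightarrow> 0 < area_const \<gamma>"
  by (auto simp: area_const_def intro!: divide_pos_pos Gamma_real_pos add_pos_pos zero_less_power)

lemma prob_space_uniform: "prob_space (uniform_measure lborel {0..1 :: real})"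
  by (rule prob_space_uniform_measure) auto

lemma sets_uniform_power_law [simp, measurable_cong]: "sets (uniform_power_law \<gamma>) = sets borel"
  by (simp add: uniform_power_law_def)

lemma prob_space_uniform_power_law: "prob_space (uniform_power_law \<gamma>)"
  unfolding uniform_power_law_def
  by (intro prob_space.prob_space_distr prob_space_uniform) measurable

lemma nn_integral_uniform_power_law:
  assumes [measurable]: "f \<in> borel_measurable borel"
  shows "(\<integral>\<^sup>+c. f c \<partial>uniform_power_law \<gamma>) = (\<integral>\<^sup>+v. f (v powr \<gamma>) * indicator {0..1} v \<partial>lborel)"
  unfolding uniform_power_law_def
  by (subst nn_integral_distr) (simp_all add: nn_integral_uniform_measure divide_ennreal_def)

lemma emeasure_uniform_power_law:
  assumes "0 < \<gamma>" "y \<le> 1"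
  shows "emeasure (uniform_power_law \<gamma>) {..y} = (if y < 0 then 0 else ennreal (y powr (1 / \<gamma>)))"
proof -
  have "emeasure (uniform_power_law \<gamma>) {..y} = (\<integral>\<^sup>+c. indicator {..y} c \<partial>uniform_power_law \<gamma>)"
    by simp
  also have "\<dots> = (\<integral>\<^sup>+v. indicator {..y} (v powr \<gamma>) * indicator {0..1} v \<partial>lborel)"
    by (rule nn_integral_uniform_power_law) simp
  also have "\<dots> = (\<integral>\<^sup>+v. (if y < 0 then 0 else indicator {0..y powr (1 / \<gamma>)} v) \<partial>lborel)"
  proof (rule nn_integral_cong)
    fix v :: real
    show "indicator {..y} (v powr \<gamma>) * indicator {0..1} v = (if y < 0 then 0 else indicator {0..y powr (1 / \<gamma>)} v :: ennreal)"
    proof (cases "0 \<le> v \<and> 0 \<le> y")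
      case True
      define r where "r = y powr (1 / \<gamma>)"
      have r: "0 \<le> r" "r powr \<gamma> = y"
        using True assms by (simp_all add: r_def powr_powr)
      have "r \<le> 1 powr (1 / \<gamma>)"
        unfolding r_def using True assms by (intro powr_mono2) auto
      then have r1: "r \<le> 1" by simp
      have "v powr \<gamma> \<le> r powr \<gamma> \<longleftrightarrow> v \<le> r"
        using True r(1) assms(1) powr_mono2[of \<gamma> v r] powr_less_mono2[of \<gamma> r v] by linarith
      then show ?thesis
        using True r(2) r1 by (auto simp: indicator_def simp flip: r_def)
    next
      case False
      moreover have "0 \<le> v powr \<gamma>" by simp
      ultimately show ?thesis by (auto simp: indicator_def simp del: powr_ge_zero)
    qed
  qed
  also have "\<dots> = (if y < 0 then 0 else ennreal (y powr (1 / \<gamma>)))"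
    by simp
  finally show ?thesis .
qed

text \<open>The integrand vanishes at v = r. Substituting v = r z^(1/\<gamma>) turns t - l
  v^\<gamma> into t (1 - z) and the integral into a Beta integral, whose Gamma quotient is
  \<open>area_const\<close>.\<close>

lemma weighted_area:
  fixes \<gamma> l t :: real
  assumes \<gamma>: "0 < \<gamma>" "\<gamma> < 1" and l: "0 < l" and t: "0 \<le> t"
  defines "r \<equiv> (t / l) powr (1 / \<gamma>)"
  shows "((\<lambda>v. (t - l * v powr \<gamma>) powr (1 / \<gamma>)) has_integral
    (area_const \<gamma> * l powr (- 1 / \<gamma>) * t powr (2 / \<gamma>))) {0..r}"
proof -
  let ?f = "\<lambda>v. (t - l * v powr \<gamma>) powr (1 / \<gamma>)"
  let ?g = "\<lambda>z. r * z powr (1 / \<gamma>)"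
  let ?g' = "\<lambda>z. r * (1 / \<gamma> * z powr (1 / \<gamma> - 1))"
  have r: "0 \<le> r" "l * r powr \<gamma> = t"
    using \<gamma> l t by (simp_all add: r_def powr_powr)
  have nonneg: "0 \<le> t - l * v powr \<gamma>" if "v \<in> {0..r}" for v
  proof -
    have "v powr \<gamma> \<le> r powr \<gamma>" using that \<gamma> by (intro powr_mono2) auto
    then have "l * v powr \<gamma> \<le> l * r powr \<gamma>" using l by (intro mult_left_mono) auto
    then show ?thesis using r(2) by simp
  qed
  have contf: "continuous_on {0..r} ?f"
    using nonneg \<gamma> by (intro continuous_on_powr' continuous_intros) auto
  have subst: "((\<lambda>z. ?g' z *\<^sub>R ?f (?g z)) has_integral (integral {?g 0..?g 1} ?f)) {0..1}"
  proof (rule has_integral_substitution_strong[where s = "{0}" and c = 0 and d = r])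
    show "?g ` {0..1} \<subseteq> {0..r}"
    proof (rule image_subsetI)
      fix z :: real assume z: "z \<in> {0..1}"
      then have "z powr (1 / \<gamma>) \<le> 1 powr (1 / \<gamma>)" using \<gamma> by (intro powr_mono2) auto
      then show "?g z \<in> {0..r}" using r(1) by (simp add: mult_left_le)
    qed
    show "continuous_on {0..1} ?g"
      using \<gamma> by (intro continuous_on_powr' continuous_intros) auto
    fix z :: real assume "z \<in> {0..1} - {0}"
    then show "(?g has_field_derivative ?g' z) (at z within {0..1})"
      by (auto intro!: derivative_eq_intros)
  qed (use contf r in auto)
  have beta: "((\<lambda>z. r * t powr (1 / \<gamma>) * (1 / \<gamma>) * (z powr (1 / \<gamma> - 1) * (1 - z) powr (1 / \<gamma> + 1 - 1)))
      has_integral (r * t powr (1 / \<gamma>) * (1 / \<gamma>) * Beta (1 / \<gamma>) (1 / \<gamma> + 1))) {0..1}"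
    using \<gamma> by (intro has_integral_mult_right has_integral_Beta_real) (auto intro: add_pos_pos)
  have integrand: "?g' z *\<^sub>R ?f (?g z) =
      r * t powr (1 / \<gamma>) * (1 / \<gamma>) * (z powr (1 / \<gamma> - 1) * (1 - z) powr (1 / \<gamma> + 1 - 1))"
    if z: "z \<in> {0..1}" for z
  proof -
    have "(?g z) powr \<gamma> = r powr \<gamma> * z"
      using z r(1) \<gamma> by (simp add: powr_mult powr_powr)
    then have "t - l * (?g z) powr \<gamma> = t * (1 - z)"
      using r(2) by (simp add: algebra_simps)
    then have "?f (?g z) = t powr (1 / \<gamma>) * (1 - z) powr (1 / \<gamma>)"
      using t z by (simp add: powr_mult)
    then show ?thesis by simp
  qed
  have "integral {?g 0..?g 1} ?f = r * t powr (1 / \<gamma>) * (1 / \<gamma>) * Beta (1 / \<gamma>) (1 / \<gamma> + 1)"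
    by (rule has_integral_unique[OF has_integral_eq[OF integrand subst] beta])
  then have "integral {0..r} ?f = r * t powr (1 / \<gamma>) * (1 / \<gamma>) * Beta (1 / \<gamma>) (1 / \<gamma> + 1)"
    by simp
  also have "1 / \<gamma> * Beta (1 / \<gamma>) (1 / \<gamma> + 1) = area_const \<gamma>"
  proof -
    have "Gamma (1 / \<gamma> + 1) = 1 / \<gamma> * Gamma (1 / \<gamma>)"
      using \<gamma> by (intro Gamma_plus1) (auto dest: nonpos_Ints_nonpos)
    moreover have "1 / \<gamma> + (1 / \<gamma> + 1) = 2 / \<gamma> + 1" by simp
    ultimately show ?thesis
      unfolding Beta_def area_const_def by (simp only: power2_eq_square times_divide_eq_right mult.assoc)
  qed
  hence "r * t powr (1 / \<gamma>) * (1 / \<gamma>) * Beta (1 / \<gamma>) (1 / \<gamma> + 1) = r * t powr (1 / \<gamma>) * area_const \<gamma>"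
    by (simp only: mult.assoc)
  also have "r * t powr (1 / \<gamma>) = l powr (- 1 / \<gamma>) * t powr (2 / \<gamma>)"
    using l t by (simp add: r_def powr_divide powr_minus_divide flip: powr_add)
  finally have "integral {0..r} ?f = area_const \<gamma> * l powr (- 1 / \<gamma>) * t powr (2 / \<gamma>)"
    by (simp add: mult_ac)
  moreover have "(?f has_integral integral {0..r} ?f) {0..r}"
    using contf by (intro integrable_integral integrable_continuous_interval)
  ultimately show ?thesis by simp
qed

text \<open>The conditions t <= 1 and t <= l keep the region {w + l c <= t} with w, c >= 0 inside
  the unit square, so the upper ends of the two distributions never intervene and the formula is
  exact.\<close>

lemma (in prob_space) weighted_sum_cdf:
  assumes \<gamma>: "0 < \<gamma>" "\<gamma> < 1" and l: "0 < l" and t: "0 \<le> t" "t \<le> 1" "t \<le> l"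
    and indep: "indep_var borel W borel C"
    and W: "distr M borel W = uniform_power_law \<gamma>" and C: "distr M borel C = uniform_power_law \<gamma>"
  shows "prob {\<omega> \<in> space M. W \<omega> + l * C \<omega> \<le> t} = area_const \<gamma> * l powr (- 1 / \<gamma>) * t powr (2 / \<gamma>)"
proof -
  let ?\<nu> = "uniform_power_law \<gamma>"
  let ?A = "{z :: real \<times> real. fst z + l * snd z \<le> t}"
  interpret N: prob_space ?\<nu> by (rule prob_space_uniform_power_law)
  interpret NN: pair_sigma_finite ?\<nu> ?\<nu> ..
  have rv [measurable]: "W \<in> borel_measurable M" "C \<in> borel_measurable M"
    using indep_var_rv1[OF indep] indep_var_rv2[OF indep] by auto
  have "{z \<in> space (borel \<Otimes>\<^sub>M borel). fst z + l * snd z \<le> t} \<in> sets (borel \<Otimes>\<^sub>M (borel :: real measure))"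
    by measurable
  then have A [measurable]: "?A \<in> sets (borel \<Otimes>\<^sub>M borel)"
    by (simp add: space_pair_measure)
  have "sets (?\<nu> \<Otimes>\<^sub>M ?\<nu>) = sets (borel \<Otimes>\<^sub>M borel)"
    by (intro sets_pair_measure_cong) simp_all
  with A have [measurable]: "?A \<in> sets (?\<nu> \<Otimes>\<^sub>M ?\<nu>)" by simp
  have joint: "distr M (borel \<Otimes>\<^sub>M borel) (\<lambda>\<omega>. (W \<omega>, C \<omega>)) = ?\<nu> \<Otimes>\<^sub>M ?\<nu>"
    using indep unfolding indep_var_distribution_eq W C by simp
  define r where "r = (t / l) powr (1 / \<gamma>)"
  have "r \<le> 1 powr (1 / \<gamma>)"
    unfolding r_def using \<gamma> l t by (intro powr_mono2) auto
  then have r: "0 \<le> r" "r \<le> 1" "r powr \<gamma> = t / l"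
    using \<gamma> l t by (simp_all add: r_def powr_powr)
  have "emeasure M {\<omega> \<in> space M. W \<omega> + l * C \<omega> \<le> t} = emeasure M ((\<lambda>\<omega>. (W \<omega>, C \<omega>)) -` ?A \<inter> space M)"
    by (intro arg_cong2[where f = emeasure]) auto
  also have "\<dots> = emeasure (distr M (borel \<Otimes>\<^sub>M borel) (\<lambda>\<omega>. (W \<omega>, C \<omega>))) ?A"
    by (rule emeasure_distr[symmetric]) measurable
  also have "\<dots> = (\<integral>\<^sup>+c. emeasure ?\<nu> ((\<lambda>w. (w, c)) -` ?A) \<partial>?\<nu>)"
    unfolding joint by (rule NN.emeasure_pair_measure_alt2) measurable
  also have "\<dots> = (\<integral>\<^sup>+c. emeasure ?\<nu> {..t - l * c} \<partial>?\<nu>)"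
    by (intro nn_integral_cong arg_cong2[where f = emeasure]) auto
  also have "\<dots> = (\<integral>\<^sup>+v. emeasure ?\<nu> {..t - l * v powr \<gamma>} * indicator {0..1} v \<partial>lborel)"
  proof (rule nn_integral_uniform_power_law)
    have "(\<lambda>c. emeasure ?\<nu> ((\<lambda>w. (w, c)) -` ?A)) \<in> borel_measurable ?\<nu>"
      by (rule NN.measurable_emeasure_Pair2) measurable
    moreover have "(\<lambda>w. (w, c)) -` ?A = {..t - l * c}" for c by auto
    ultimately show "(\<lambda>c. emeasure ?\<nu> {..t - l * c}) \<in> borel_measurable borel"
      by (simp cong: measurable_cong_sets)
  qed
  also have "\<dots> = (\<integral>\<^sup>+v. ennreal (indicator {0..r} v * (t - l * v powr \<gamma>) powr (1 / \<gamma>)) \<partial>lborel)"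
  proof (rule nn_integral_cong)
    fix v :: real
    show "emeasure ?\<nu> {..t - l * v powr \<gamma>} * indicator {0..1} v =
        ennreal (indicator {0..r} v * (t - l * v powr \<gamma>) powr (1 / \<gamma>))"
    proof (cases "v \<in> {0..1}")
      case True
      have "t - l * v powr \<gamma> \<le> 1" using t l by (smt (verit) mult_nonneg_nonneg powr_ge_zero)
      moreover have "t - l * v powr \<gamma> < 0 \<longleftrightarrow> \<not> v \<le> r"
      proof -
        have "v powr \<gamma> \<le> r powr \<gamma> \<longleftrightarrow> v \<le> r"
          using True r(1) \<gamma> powr_mono2[of \<gamma> v r] powr_less_mono2[of \<gamma> r v] by force
        moreover have "v powr \<gamma> \<le> r powr \<gamma> \<longleftrightarrow> l * v powr \<gamma> \<le> t"
          using l r(3) by (simp add: pos_le_divide_eq mult.commute)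
        ultimately show ?thesis by linarith
      qed
      ultimately show ?thesis
        using True \<gamma> by (auto simp: emeasure_uniform_power_law)
    next
      case False
      then have "v \<notin> {0..r}" using r by auto
      then show ?thesis using False by simp
    qed
  qed
  also have "\<dots> = ennreal (area_const \<gamma> * l powr (- 1 / \<gamma>) * t powr (2 / \<gamma>))"
    unfolding r_def using \<gamma> l t by (intro nn_integral_has_integral_lebesgue weighted_area) auto
  finally show ?thesis
    unfolding emeasure_eq_measure using area_const_pos[OF \<gamma>(1)] by (subst (asm) ennreal_inj) auto
qed

text \<open>The doubled index set is grouped into the blocks {Inl e, Inr e}; functions of disjoint
  blocks are independent.\<close>

lemma (in prob_space) weighted_sums_indep:
  fixes W C :: "'i \<Rightarrow> 'a \<Rightarrow> real"
  assumes indep: "indep_vars (\<lambda>_. borel) (case_sum W C) (I <+> I)"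
  shows "indep_vars (\<lambda>_. borel) (\<lambda>e \<omega>. W e \<omega> + l * C e \<omega>) I"
    and "e \<in> I \<Longrightarrow> indep_var borel (W e) borel (C e)"
proof -
  let ?K = "\<lambda>e. {Inl e, Inr e} :: ('i + 'i) set"
  let ?V = "case_sum W C"
  have "indep_vars (\<lambda>e. PiM (?K e) (\<lambda>_. borel)) (\<lambda>e \<omega>. restrict (\<lambda>i. ?V i \<omega>) (?K e)) I"
    using indep by (rule indep_vars_restrict) (auto simp: disjoint_family_on_def)
  then have "indep_vars (\<lambda>_. borel) (\<lambda>e \<omega>. (\<lambda>r. r (Inl e) + l * r (Inr e)) (restrict (\<lambda>i. ?V i \<omega>) (?K e))) I"
    by (rule indep_vars_compose2) measurable
  then show "indep_vars (\<lambda>_. borel) (\<lambda>e \<omega>. W e \<omega> + l * C e \<omega>) I"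
    by simp
  assume e: "e \<in> I"
  have "indep_var (PiM {Inl e} (\<lambda>_. borel)) (\<lambda>\<omega>. restrict (\<lambda>i. ?V i \<omega>) {Inl e})
      (PiM {Inr e} (\<lambda>_. borel)) (\<lambda>\<omega>. restrict (\<lambda>i. ?V i \<omega>) {Inr e})"
    using indep by (rule indep_var_restrict) (use e in auto)
  then have "indep_var borel ((\<lambda>r. r (Inl e)) \<circ> (\<lambda>\<omega>. restrict (\<lambda>i. ?V i \<omega>) {Inl e}))
      borel ((\<lambda>r. r (Inr e)) \<circ> (\<lambda>\<omega>. restrict (\<lambda>i. ?V i \<omega>) {Inr e}))"
    by (rule indep_var_compose) measurable
  moreover have "(\<lambda>r. r (Inl e)) \<circ> (\<lambda>\<omega>. restrict (\<lambda>i. ?V i \<omega>) {Inl e}) = W e"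
    "(\<lambda>r. r (Inr e)) \<circ> (\<lambda>\<omega>. restrict (\<lambda>i. ?V i \<omega>) {Inr e}) = C e"
    by (simp_all add: fun_eq_iff)
  ultimately show "indep_var borel (W e) borel (C e)"
    by (simp only:)
qed

text \<open>The factor s solves \<open>area_const \<gamma> * l powr (- 1 / \<gamma>) * (s * x powr
  (\<gamma> / 2)) powr (2 / \<gamma>) = x / n\<close>. The hypothesis \<open>small\<close> says that
  the largest threshold, at x = L, is still within the range of
  \<open>weighted_sum_cdf\<close>.\<close>

lemma (in prob_space) weighted_sums_random_weights:
  fixes W C :: "nat set \<Rightarrow> 'a \<Rightarrow> real"
  assumes \<gamma>: "0 < \<gamma>" "\<gamma> < 1" and l: "0 < l" and n: "0 < n" and L: "0 \<le> L" "L \<le> real n"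
    and W: "\<And>e. e \<in> complete_edges n \<Longrightarrow> distr M borel (W e) = uniform_power_law \<gamma>"
    and C: "\<And>e. e \<in> complete_edges n \<Longrightarrow> distr M borel (C e) = uniform_power_law \<gamma>"
    and indep: "indep_vars (\<lambda>_. borel) (case_sum W C) (complete_edges n <+> complete_edges n)"
    and small: "sqrt l * (area_const \<gamma> * real n) powr (- \<gamma> / 2) * L powr (\<gamma> / 2) \<le> min 1 l"
  shows "random_weights M n (\<lambda>e \<omega>. W e \<omega> + l * C e \<omega>) (sqrt l * (area_const \<gamma> * real n) powr (- \<gamma> / 2)) (\<gamma> / 2) L"
proof unfold_locales
  let ?D = "area_const \<gamma>"
  let ?s = "sqrt l * (?D * real n) powr (- \<gamma> / 2)"
  have Dn: "0 < ?D * real n" using area_const_pos[OF \<gamma>(1)] n by simp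
  show "0 < n" "0 < \<gamma> / 2" "0 \<le> L" "L \<le> real n" using n \<gamma> L by auto
  show s: "0 < ?s" using l Dn by (intro mult_pos_pos) (simp_all only: real_sqrt_gt_0_iff powr_gt_zero less_imp_neq[symmetric] not_False_eq_True)
  show "indep_vars (\<lambda>_. borel) (\<lambda>e \<omega>. W e \<omega> + l * C e \<omega>) (complete_edges n)"
    by (rule weighted_sums_indep[OF indep])
  fix e x assume e: "e \<in> complete_edges n" and x: "0 \<le> x" "x \<le> L"
  have "?s * x powr (\<gamma> / 2) \<le> ?s * L powr (\<gamma> / 2)"
    using x s \<gamma> by (intro mult_left_mono powr_mono2) auto
  also have "\<dots> \<le> min 1 l" by (rule small)
  finally have t: "0 \<le> ?s * x powr (\<gamma> / 2)" "?s * x powr (\<gamma> / 2) \<le> 1" "?s * x powr (\<gamma> / 2) \<le> l"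
    using s by simp_all
  have "prob {\<omega> \<in> space M. W e \<omega> + l * C e \<omega> \<le> ?s * x powr (\<gamma> / 2)} =
      ?D * l powr (- 1 / \<gamma>) * (?s * x powr (\<gamma> / 2)) powr (2 / \<gamma>)"
    using \<gamma> l t weighted_sums_indep(2)[OF indep e] W[OF e] C[OF e] by (rule weighted_sum_cdf)
  also have "(?s * x powr (\<gamma> / 2)) powr (2 / \<gamma>) = l powr (1 / \<gamma>) * (?D * real n) powr (- 1) * x"
  proof -
    have "sqrt l powr (2 / \<gamma>) = l powr (1 / \<gamma>)"
      using l by (simp add: powr_half_sqrt[symmetric] powr_powr)
    moreover have "((?D * real n) powr (- \<gamma> / 2)) powr (2 / \<gamma>) = (?D * real n) powr (- 1)"
      using \<gamma> by (simp add: powr_powr)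
    moreover have "(x powr (\<gamma> / 2)) powr (2 / \<gamma>) = x"
      using \<gamma> x by (simp add: powr_powr)
    ultimately show ?thesis
      using l x by (simp add: powr_mult)
  qed
  also have "?D * l powr (- 1 / \<gamma>) * (l powr (1 / \<gamma>) * (?D * real n) powr (- 1) * x) = x / real n"
  proof -
    have "l powr (- 1 / \<gamma>) * l powr (1 / \<gamma>) = 1"
      using l by (simp flip: powr_add)
    moreover have "(?D * real n) powr (- 1) = 1 / (?D * real n)"
      using Dn by (simp add: powr_minus_divide)
    moreover have "?D \<noteq> 0" using area_const_pos[OF \<gamma>(1)] by simp
    ultimately show ?thesis
      using n by (simp add: field_simps)
  qed
  finally show "prob {\<omega> \<in> space M. W e \<omega> + l * C e \<omega> \<le> ?s * x powr (\<gamma> / 2)} = x / real n" .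
qed

section \<open>Asymptotics and Lagrangian duality\<close>

text \<open>The limiting weight of the minimum spanning tree per vertex, measured in units of the
  threshold factor s.\<close>

definition tree_const :: "real \<Rightarrow> real" where
  "tree_const b = (\<Sum>k. b * (Gamma (real k + b) / (real (Suc k) powr (b + 2) * fact k)))"

lemma tree_const_summable:
  assumes "0 < b" "b < 1"
  shows "summable (\<lambda>k. b * (Gamma (real k + b) / (real (Suc k) powr (b + 2) * fact k)))"
proof (rule comp_density_integral_limit(2)[OF assms])
  \<comment> \<open>Any cutoff that tends to infinity and stays below n would serve; summability
    does not refer to it.\<close>
  show "filterlim (\<lambda>n. ln (real n)) at_top sequentially" by real_asymp
  show "\<forall>\<^sub>F n in sequentially. ln (real n) \<le> real n" by real_asymp
qed

lemma tree_const_pos: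
  assumes "0 < b" "b < 1"
  shows "0 < tree_const b"
  unfolding tree_const_def
  by (rule suminf_pos[OF tree_const_summable[OF assms]])
     (use assms in \<open>auto intro!: mult_pos_pos divide_pos_pos Gamma_real_pos\<close>)

text \<open>Shifting the index by one merges a factor of (k+1)! with the power of k+1, and the Gamma
  quotient in front is a power of \<open>area_const\<close>. Hence
  \<open>scale n l * n * tree_const (\<gamma> / 2)\<close> is \<open>C_const \<gamma>\<close> times
  n^(1 - \<gamma>/2) sqrt l.\<close>

lemma C_const_eq:
  assumes \<gamma>: "0 < \<gamma>" "\<gamma> < 1"
  shows "C_const \<gamma> = area_const \<gamma> powr (- \<gamma> / 2) * tree_const (\<gamma> / 2)"
proof -
  let ?b = "\<gamma> / 2"
  let ?u = "\<lambda>k. Gamma (real k + ?b) / (real (Suc k) powr (?b + 2) * fact k)"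
  have G: "0 < Gamma (1 / \<gamma> + 1)" "0 < Gamma (2 / \<gamma> + 1)"
    using \<gamma> by (auto intro!: Gamma_real_pos add_pos_pos)
  have "(Gamma (1 / \<gamma> + 1))\<^sup>2 powr (- \<gamma> / 2) = Gamma (1 / \<gamma> + 1) powr (- \<gamma>)"
    using G by (simp add: powr_powr flip: powr_numeral)
  then have A: "area_const \<gamma> powr (- \<gamma> / 2) = Gamma (2 / \<gamma> + 1) powr (\<gamma> / 2) / Gamma (1 / \<gamma> + 1) powr \<gamma>"
    using G by (simp add: area_const_def powr_divide powr_minus_divide)
  have "summable (\<lambda>k. ?b * ?u k)"
    using tree_const_summable[of ?b] \<gamma> by simp
  then have s: "summable ?u"
    using \<gamma> by (subst (asm) summable_cmult_iff) simp
  have "(let k = Suc j in Gamma (real k + \<gamma> / 2 - 1) / (real k powr (\<gamma> / 2 + 1) * fact k)) = ?u j" for j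
  proof -
    have "real (Suc j) powr (?b + 2) = real (Suc j) powr (?b + 1) * real (Suc j)"
      using powr_add[of "real (Suc j)" "?b + 1" 1] by (simp add: add.assoc)
    then show ?thesis by (simp add: Let_def add.commute mult_ac)
  qed
  then have "C_const \<gamma> = ?b * (Gamma (2 / \<gamma> + 1) powr (\<gamma> / 2) / Gamma (1 / \<gamma> + 1) powr \<gamma>) * (\<Sum>j. ?u j)"
    by (simp only: C_const_def)
  also have "\<dots> = area_const \<gamma> powr (- \<gamma> / 2) * (?b * (\<Sum>j. ?u j))"
    unfolding A by (simp only: mult_ac)
  also have "?b * (\<Sum>j. ?u j) = tree_const ?b"
    unfolding tree_const_def by (rule suminf_mult[OF s, symmetric])
  finally show ?thesis .
qed

lemma C_const_pos: "0 < \<gamma> \<Longrightarrow> \<gamma> < 1 \<Longrightarrow> 0 < C_const \<gamma>"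
  using tree_const_pos[of "\<gamma> / 2"] area_const_pos[of \<gamma>] by (simp add: C_const_eq)

locale power_law_weights =
  fixes \<gamma> :: real
    and M :: "nat \<Rightarrow> 'a measure"
    and W C :: "nat \<Rightarrow> nat set \<Rightarrow> 'a \<Rightarrow> real"
  assumes \<gamma>: "0 < \<gamma>" "\<gamma> < 1"
    and prob_M: "\<And>n. prob_space (M n)"
    and W: "\<And>n e. e \<in> complete_edges n \<Longrightarrow> distr (M n) borel (W n e) = uniform_power_law \<gamma>"
    and C: "\<And>n e. e \<in> complete_edges n \<Longrightarrow> distr (M n) borel (C n e) = uniform_power_law \<gamma>"
    and indep: "\<And>n. prob_space.indep_vars (M n) (\<lambda>_. borel) (case_sum (W n) (C n))
               (complete_edges n <+> complete_edges n)"
begin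

definition scale :: "nat \<Rightarrow> real \<Rightarrow> real" where
  "scale n l = sqrt l * (area_const \<gamma> * real n) powr (- \<gamma> / 2)"

lemma scale_nonneg: "0 \<le> l \<Longrightarrow> 0 \<le> scale n l"
  by (simp add: scale_def)

text \<open>A lower bound for all trees together with one nearly optimal tree: exactly what duality
  uses about the penalised minimum, without naming a random minimiser.\<close>

definition typical :: "(nat \<Rightarrow> real) \<Rightarrow> real \<Rightarrow> nat \<Rightarrow> 'a set \<Rightarrow> bool" where
  "typical l \<epsilon> n G \<longleftrightarrow> G \<in> sets (M n) \<and> (\<forall>\<omega>\<in>G.
     (\<forall>T. spanning_tree n T \<longrightarrow>
        scale n (l n) * (real n * (tree_const (\<gamma> / 2) - \<epsilon>)) \<le> (\<Sum>e\<in>T. W n e \<omega> + l n * C n e \<omega>)) \<and>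
     (\<exists>T. spanning_tree n T \<and>
        (\<Sum>e\<in>T. W n e \<omega> + l n * C n e \<omega>) \<le> scale n (l n) * (real n * (tree_const (\<gamma> / 2) + \<epsilon>))))"

text \<open>Error budget: \<epsilon>/2 for the random fluctuation, \<epsilon>/4 for the distance of
  the mean density from its limit, and \<epsilon>/4 for the loss \<open>L powr b\<close>, which is
  o(n).\<close>

lemma mst_limit:
  assumes \<epsilon>: "0 < \<epsilon>" and l: "\<forall>\<^sub>F n in sequentially. 0 < l n"
    and small: "\<forall>\<^sub>F n in sequentially. scale n (l n) * (4 * ln (real n)) powr (\<gamma> / 2) \<le> min 1 (l n)"
  obtains G where "\<forall>\<^sub>F n in sequentially. typical l \<epsilon> n (G n)" "(\<lambda>n. measure (M n) (G n)) \<longlonglongrightarrow> 1"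
proof -
  define b where "b = \<gamma> / 2"
  have b: "0 < b" "b < 1" using \<gamma> by (simp_all add: b_def)
  \<comment> \<open>With this cutoff exp(-L/2) = n^(-2), so the disconnection bound (1 + n^(-2))^n -
    1 tends to 0, while sqrt(n L) L^b is still o(n).\<close>
  define L where "L n = 4 * ln (real n)" for n :: nat
  define \<mu> where "\<mu> n = (\<integral>x. indicator {..<L n} x * comp_density n (x / real n) \<partial>power_measure b)" for n
  define err where "err n = sqrt (real n * L n) * L n powr b / (\<epsilon> / 2 * real n) + ((1 + exp (- (L n / 2))) ^ n - 1)" for n
  define good where "good n G \<longleftrightarrow> typical l \<epsilon> n G \<and> measure (M n) G \<ge> 1 - err n" for n G
  have Linf: "filterlim L at_top sequentially" unfolding L_def by real_asymp
  have Ln: "\<forall>\<^sub>F n in sequentially. L n \<le> real n" unfolding L_def by real_asymp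
  have \<mu>: "\<mu> \<longlonglongrightarrow> tree_const b"
    unfolding \<mu>_def tree_const_def using b Linf Ln by (rule comp_density_integral_limit(1))
  have "(\<lambda>n. L n powr b / real n) \<longlonglongrightarrow> 0"
    using b unfolding L_def by real_asymp
  then have Lb: "\<forall>\<^sub>F n in sequentially. L n powr b / real n < \<epsilon> / 4"
    using \<epsilon> by (intro order_tendstoD) auto
  have \<mu>near: "\<forall>\<^sub>F n in sequentially. dist (\<mu> n) (tree_const b) < \<epsilon> / 4"
    using \<mu> \<epsilon> by (intro tendstoD) auto
  have "\<forall>\<^sub>F n in sequentially. \<exists>G. good n G"
    using l small Ln Lb \<mu>near eventually_gt_at_top[of 0]
  proof eventually_elim
    case (elim n)
    interpret prob_space "M n" by (rule prob_M)
    have L0: "0 \<le> L n" using elim(6) by (simp add: L_def)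
    let ?X = "\<lambda>e \<omega>. W n e \<omega> + l n * C n e \<omega>"
    have rw: "random_weights (M n) n ?X (scale n (l n)) b (L n)"
      unfolding scale_def b_def
      using \<gamma> elim(1) elim(6) L0 elim(3) W C indep elim(2)[unfolded scale_def L_def[symmetric]]
      by (rule weighted_sums_random_weights)
    interpret random_weights "M n" n ?X "scale n (l n)" b "L n" by (rule rw)
    have md: "mean_density = \<mu> n" by (simp add: mean_density_def \<mu>_def)
    have d: "0 < \<epsilon> / 2 * real n" using \<epsilon> elim(6) by simp
    from mst_concentration[OF d] obtain G where G: "G \<in> events"
      "prob G \<ge> 1 - sqrt (real n * L n) * L n powr b / (\<epsilon> / 2 * real n) - ((1 + exp (- (L n / 2))) ^ n - 1)"
      "\<And>\<omega> T. \<omega> \<in> G \<Longrightarrow> spanning_tree n T \<Longrightarrow>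
         scale n (l n) * (real n * \<mu> n - \<epsilon> / 2 * real n - L n powr b) \<le> (\<Sum>e\<in>T. ?X e \<omega>)"
      "\<And>\<omega>. \<omega> \<in> G \<Longrightarrow> \<exists>T. spanning_tree n T \<and> (\<Sum>e\<in>T. ?X e \<omega>) \<le> scale n (l n) * (real n * \<mu> n + \<epsilon> / 2 * real n)"
      unfolding md by blast
    have near: "\<bar>\<mu> n - tree_const b\<bar> < \<epsilon> / 4" using elim(5) by (simp add: dist_real_def)
    have "tree_const b - \<epsilon> \<le> \<mu> n - \<epsilon> / 2 - L n powr b / real n"
      using elim(4) near by linarith
    then have "real n * (tree_const b - \<epsilon>) \<le> real n * (\<mu> n - \<epsilon> / 2 - L n powr b / real n)"
      by (intro mult_left_mono) auto
    also have "\<dots> = real n * \<mu> n - \<epsilon> / 2 * real n - L n powr b"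
      using elim(6) by (simp add: algebra_simps)
    finally have lo: "scale n (l n) * (real n * (tree_const b - \<epsilon>)) \<le>
        scale n (l n) * (real n * \<mu> n - \<epsilon> / 2 * real n - L n powr b)"
      using elim(1) by (intro mult_left_mono scale_nonneg) auto
    have "real n * \<mu> n + \<epsilon> / 2 * real n = real n * (\<mu> n + \<epsilon> / 2)" by (simp add: algebra_simps)
    also have "\<dots> \<le> real n * (tree_const b + \<epsilon>)"
      by (intro mult_left_mono[OF _ of_nat_0_le_iff]) (use near in linarith)
    finally have hi: "scale n (l n) * (real n * \<mu> n + \<epsilon> / 2 * real n) \<le> scale n (l n) * (real n * (tree_const b + \<epsilon>))"
      using elim(1) by (intro mult_left_mono scale_nonneg) auto
    have "typical l \<epsilon> n G"
      unfolding typical_def b_def[symmetric]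
    proof (intro conjI ballI allI impI)
      fix \<omega> assume \<omega>: "\<omega> \<in> G"
      show "\<exists>T. spanning_tree n T \<and> (\<Sum>e\<in>T. ?X e \<omega>) \<le> scale n (l n) * (real n * (tree_const b + \<epsilon>))"
        using G(4)[OF \<omega>] hi by (meson order_trans)
      fix T assume "spanning_tree n T"
      then show "scale n (l n) * (real n * (tree_const b - \<epsilon>)) \<le> (\<Sum>e\<in>T. ?X e \<omega>)"
        using order_trans[OF lo G(3)[OF \<omega>]] by blast
    qed (rule G(1))
    moreover have "prob G \<ge> 1 - err n" using G(2) by (simp add: err_def)
    ultimately show ?case unfolding good_def by blast
  qed
  define G where "G n = (SOME G. good n G)" for n
  have ev: "\<forall>\<^sub>F n in sequentially. good n (G n)"
    unfolding G_def using \<open>\<forall>\<^sub>F n in sequentially. \<exists>G. good n G\<close>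
    by eventually_elim (rule someI_ex)
  have "err \<longlonglongrightarrow> 0"
  proof -
    have "(\<lambda>n. sqrt (real n * L n) * L n powr b / (\<epsilon> / 2 * real n)) \<longlonglongrightarrow> 0"
      unfolding L_def using b \<epsilon> by real_asymp
    moreover have "(\<lambda>n. (1 + exp (- (L n / 2))) ^ n - 1) \<longlonglongrightarrow> 0"
      unfolding L_def by real_asymp
    ultimately have "err \<longlonglongrightarrow> 0 + 0"
      unfolding err_def by (rule tendsto_add)
    then show ?thesis by simp
  qed
  then have "(\<lambda>n. 1 - err n) \<longlonglongrightarrow> 1 - 0" by (intro tendsto_intros)
  then have low: "(\<lambda>n. 1 - err n) \<longlonglongrightarrow> 1" by simp
  have le: "\<forall>\<^sub>F n in sequentially. 1 - err n \<le> measure (M n) (G n)"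
    using ev by eventually_elim (simp add: good_def)
  have le1: "\<forall>\<^sub>F n in sequentially. measure (M n) (G n) \<le> 1"
    using prob_M by (simp add: prob_space.prob_le_1)
  have "(\<lambda>n. measure (M n) (G n)) \<longlonglongrightarrow> 1"
    by (rule tendsto_sandwich[OF le le1 low tendsto_const])
  moreover have "\<forall>\<^sub>F n in sequentially. typical l \<epsilon> n (G n)"
    using ev by eventually_elim (simp add: good_def)
  ultimately show ?thesis using that[of G] by blast
qed

end

text \<open>Lagrangian duality at the multipliers \<open>l\<close>, \<open>(1 + \<eta>)\<^sup>2 l\<close> and \<open>(1 + 2\<eta>)\<^sup>2 l\<close>: comparing the
  optimal tree of the middle problem with the dual bounds at the other two pins down its cost and
  its weight separately.\<close>
lemma dual_sandwich:
  assumes \<eta>: "0 < \<eta>" "\<eta> \<le> 1" and l: "0 < l" and b: "0 < b"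
    and h1: "\<And>T. spanning_tree n T \<Longrightarrow> l * b * (2 - \<eta>\<^sup>2 / 2) \<le> (\<Sum>e\<in>T. w e + l * c e)"
    and h2: "\<exists>T. spanning_tree n T \<and> (\<Sum>e\<in>T. w e + (1 + \<eta>)\<^sup>2 * l * c e) \<le> l * b * (2 * (1 + \<eta>) + \<eta>\<^sup>2 / 2)"
    and h3: "\<And>T. spanning_tree n T \<Longrightarrow> l * b * (2 * (1 + 2 * \<eta>) - \<eta>\<^sup>2 / 2) \<le> (\<Sum>e\<in>T. w e + (1 + 2 * \<eta>)\<^sup>2 * l * c e)"
  shows "ereal ((1 - 10 * \<eta>) * (l * b)) \<le> min_constrained_weight n w c b"
    and "min_constrained_weight n w c b \<le> ereal ((1 + 10 * \<eta>) * (l * b))"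
proof -
  define B where "B = l * b"
  have B: "0 < B" using l b by (simp add: B_def)
  have sum_eq: "(\<Sum>e\<in>T. w e + k * c e) = (\<Sum>e\<in>T. w e) + k * (\<Sum>e\<in>T. c e)" for T k
    by (simp add: sum.distrib sum_distrib_left)
  have \<eta>2: "\<eta>\<^sup>2 \<le> \<eta>" "0 \<le> \<eta>\<^sup>2" using \<eta> by (auto simp: power2_eq_square mult_left_le)
  show "ereal ((1 - 10 * \<eta>) * (l * b)) \<le> min_constrained_weight n w c b"
    unfolding min_constrained_weight_def
  proof (rule INF_greatest, clarsimp)
    fix T assume T: "spanning_tree n T" "(\<Sum>e\<in>T. c e) \<le> b"
    have "B * (2 - \<eta>\<^sup>2 / 2) \<le> (\<Sum>e\<in>T. w e) + l * (\<Sum>e\<in>T. c e)"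
      using h1[OF T(1)] by (simp add: sum_eq B_def)
    moreover have "l * (\<Sum>e\<in>T. c e) \<le> B" unfolding B_def using T(2) l by simp
    ultimately have "B * (2 - \<eta>\<^sup>2 / 2) - B \<le> (\<Sum>e\<in>T. w e)" by linarith
    moreover have "B * (2 - \<eta>\<^sup>2 / 2) - B = B * (1 - \<eta>\<^sup>2 / 2)"
      by (simp add: algebra_simps)
    moreover have "B * (1 - 10 * \<eta>) \<le> B * (1 - \<eta>\<^sup>2 / 2)"
      using B \<eta> \<eta>2 by (intro mult_left_mono) auto
    ultimately have "B * (1 - 10 * \<eta>) \<le> (\<Sum>e\<in>T. w e)" by linarith
    then show "(1 - 10 * \<eta>) * (l * b) \<le> (\<Sum>e\<in>T. w e)"
      by (simp only: B_def mult.commute)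
  qed
  obtain T where T: "spanning_tree n T"
      "(\<Sum>e\<in>T. w e + (1 + \<eta>)\<^sup>2 * l * c e) \<le> l * b * (2 * (1 + \<eta>) + \<eta>\<^sup>2 / 2)"
    using h2 by blast
  \<comment> \<open>Weight and cost in units of their target values, so that both \<open>x\<close>
    and \<open>y\<close> should be close to 1.\<close>
  define x where "x = (\<Sum>e\<in>T. w e) / B"
  define y where "y = (\<Sum>e\<in>T. c e) / b"
  have x: "(\<Sum>e\<in>T. w e) = B * x" using B by (simp add: x_def)
  have y: "l * (\<Sum>e\<in>T. c e) = B * y" using b by (simp add: y_def B_def)
  have y': "k * l * (\<Sum>e\<in>T. c e) = B * (k * y)" for k
    using y by (metis mult.assoc mult.left_commute)
  have "B * (2 - \<eta>\<^sup>2 / 2) \<le> B * (x + y)"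
    using h1[OF T(1)] unfolding sum_eq x y B_def[symmetric] by (simp add: distrib_left)
  then have i1: "2 - \<eta>\<^sup>2 / 2 \<le> x + y" using B by simp
  have "B * (x + (1 + \<eta>)\<^sup>2 * y) \<le> B * (2 * (1 + \<eta>) + \<eta>\<^sup>2 / 2)"
    using T(2) unfolding sum_eq x y' B_def[symmetric] by (simp add: distrib_left)
  then have i2: "x + (1 + \<eta>)\<^sup>2 * y \<le> 2 * (1 + \<eta>) + \<eta>\<^sup>2 / 2" using B by simp
  have "B * (2 * (1 + 2 * \<eta>) - \<eta>\<^sup>2 / 2) \<le> B * (x + (1 + 2 * \<eta>)\<^sup>2 * y)"
    using h3[OF T(1)] unfolding sum_eq x y' B_def[symmetric] by (simp add: distrib_left)
  then have i3: "2 * (1 + 2 * \<eta>) - \<eta>\<^sup>2 / 2 \<le> x + (1 + 2 * \<eta>)\<^sup>2 * y" using B by simp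
  \<comment> \<open>Subtracting \<open>i1\<close> from \<open>i2\<close>: the two errors \<eta>^2/2
    add up to just the second-order term of (1 + \<eta>)^2 - 1. The tolerance is chosen for this; it
    makes the tree exactly feasible, not merely approximately.\<close>
  have "(2 * \<eta> + \<eta>\<^sup>2) * y \<le> (2 * \<eta> + \<eta>\<^sup>2) * 1"
    using i1 i2 by (simp add: power2_eq_square algebra_simps)
  then have y1: "y \<le> 1"
    using \<eta> \<eta>2 by (subst (asm) mult_le_cancel_left_pos) (auto intro: add_pos_nonneg)
  \<comment> \<open>Subtracting \<open>i2\<close> from \<open>i3\<close> bounds the cost from below,
    without which \<open>i2\<close> would not bound the weight \<open>x\<close> well enough.\<close>
  have "\<eta> * ((2 + 3 * \<eta>) * (1 - 2 * \<eta>)) \<le> \<eta> * (2 - \<eta>)"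
    using \<eta> by (intro mult_left_mono) (auto simp: algebra_simps)
  also have "\<dots> \<le> \<eta> * ((2 + 3 * \<eta>) * y)"
    using i2 i3 by (simp add: power2_eq_square algebra_simps)
  finally have y2: "1 - 2 * \<eta> \<le> y"
    using \<eta> by simp
  have "(1 + \<eta>)\<^sup>2 * (1 - 2 * \<eta>) \<le> (1 + \<eta>)\<^sup>2 * y"
    using y2 by (intro mult_left_mono) auto
  then have "x \<le> 2 * (1 + \<eta>) + \<eta>\<^sup>2 / 2 - (1 + \<eta>)\<^sup>2 * (1 - 2 * \<eta>)"
    using i2 by linarith
  also have "\<dots> = 1 + 2 * \<eta> + 7 / 2 * \<eta>\<^sup>2 + 2 * (\<eta> * \<eta>\<^sup>2)"
    by (simp add: power2_eq_square algebra_simps)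
  also have "\<dots> \<le> 1 + 10 * \<eta>"
  proof -
    have "\<eta> * \<eta>\<^sup>2 \<le> \<eta>\<^sup>2" using \<eta> by (intro mult_left_le_one_le) auto
    then show ?thesis using \<eta>2 \<eta> by linarith
  qed
  finally have x1: "x \<le> 1 + 10 * \<eta>" .
  have "(\<Sum>e\<in>T. c e) \<le> b" using y1 b by (simp add: y_def)
  then have "min_constrained_weight n w c b \<le> ereal (\<Sum>e\<in>T. w e)"
    unfolding min_constrained_weight_def using T(1) by (intro INF_lower) simp
  also have "(\<Sum>e\<in>T. w e) \<le> (1 + 10 * \<eta>) * (l * b)"
    using x1 B unfolding x B_def[symmetric] by (simp add: mult.commute)
  finally show "min_constrained_weight n w c b \<le> ereal ((1 + 10 * \<eta>) * (l * b))" by simp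
qed

text \<open>The index set of the infimum depends on the outcome. Giving infeasible trees the value
  \<open>\<infinity>\<close> makes it an infimum over a fixed finite set.\<close>

lemma min_constrained_weight_measurable:
  assumes "\<And>e. e \<in> complete_edges n \<Longrightarrow> w e \<in> borel_measurable M"
    and "\<And>e. e \<in> complete_edges n \<Longrightarrow> c e \<in> borel_measurable M"
  shows "(\<lambda>\<omega>. min_constrained_weight n (\<lambda>e. w e \<omega>) (\<lambda>e. c e \<omega>) b) \<in> borel_measurable M"
proof -
  let ?S = "{T. spanning_tree n T}"
  have sub: "?S \<subseteq> Pow (complete_edges n)" by (auto simp: spanning_tree_def)
  then have count: "countable ?S"
    by (intro countable_finite finite_subset[OF sub]) simp
  have eq: "min_constrained_weight n (\<lambda>e. w e \<omega>) (\<lambda>e. c e \<omega>) b =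
      (INF T\<in>?S. if (\<Sum>e\<in>T. c e \<omega>) \<le> b then ereal (\<Sum>e\<in>T. w e \<omega>) else \<infinity>)" for \<omega>
    unfolding min_constrained_weight_def
  proof (rule antisym)
    show "(INF T\<in>{T. spanning_tree n T \<and> (\<Sum>e\<in>T. c e \<omega>) \<le> b}. ereal (\<Sum>e\<in>T. w e \<omega>)) \<le>
        (INF T\<in>?S. if (\<Sum>e\<in>T. c e \<omega>) \<le> b then ereal (\<Sum>e\<in>T. w e \<omega>) else \<infinity>)"
      by (rule INF_greatest) (auto intro: INF_lower)
    show "(INF T\<in>?S. if (\<Sum>e\<in>T. c e \<omega>) \<le> b then ereal (\<Sum>e\<in>T. w e \<omega>) else \<infinity>) \<le>
        (INF T\<in>{T. spanning_tree n T \<and> (\<Sum>e\<in>T. c e \<omega>) \<le> b}. ereal (\<Sum>e\<in>T. w e \<omega>))"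
    proof (rule INF_greatest)
      fix T assume "T \<in> {T. spanning_tree n T \<and> (\<Sum>e\<in>T. c e \<omega>) \<le> b}"
      then show "(INF T\<in>?S. if (\<Sum>e\<in>T. c e \<omega>) \<le> b then ereal (\<Sum>e\<in>T. w e \<omega>) else \<infinity>) \<le>
          ereal (\<Sum>e\<in>T. w e \<omega>)"
        by (intro INF_lower2[of T]) simp_all
    qed
  qed
  have "(\<lambda>\<omega>. if (\<Sum>e\<in>T. c e \<omega>) \<le> b then ereal (\<Sum>e\<in>T. w e \<omega>) else \<infinity>) \<in> borel_measurable M"
    if "T \<in> ?S" for T
  proof -
    have "T \<subseteq> complete_edges n" using that sub by auto
    then have [measurable]: "(\<lambda>\<omega>. \<Sum>e\<in>T. c e \<omega>) \<in> borel_measurable M" "(\<lambda>\<omega>. \<Sum>e\<in>T. w e \<omega>) \<in> borel_measurable M"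
      using assms by (auto intro!: borel_measurable_sum)
    show ?thesis by measurable
  qed
  then show ?thesis
    unfolding eq using count by (intro borel_measurable_INF) auto
qed

lemma (in prob_space) prob_Int_ge:
  assumes "A \<in> events" "B \<in> events"
  shows "prob A + prob B - 1 \<le> prob (A \<inter> B)"
proof -
  have "prob A \<le> prob ((A \<inter> B) \<union> (space M - B))"
    using assms sets.sets_into_space[OF assms(1)] by (intro finite_measure_mono) auto
  also have "\<dots> \<le> prob (A \<inter> B) + prob (space M - B)"
    using assms by (intro measure_Un_le) auto
  finally show ?thesis
    using assms by (simp add: prob_compl)
qed

text \<open>\<open>whp_approx\<close> asks for a single null sequence. At stage n the tolerance is
  1/k for the largest k <= n at which tolerance 1/k already has probability at least 1 -
  1/k.\<close>

lemma diagonal_error_bound: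
  fixes P :: "real \<Rightarrow> nat \<Rightarrow> real"
  assumes lim: "\<And>a. 0 < a \<Longrightarrow> P a \<longlonglongrightarrow> 1" and le: "\<And>a n. P a n \<le> 1"
  obtains \<delta> where "\<delta> \<longlonglongrightarrow> 0" "(\<lambda>n. P (\<delta> n) n) \<longlonglongrightarrow> 1"
proof -
  \<comment> \<open>Admitting k = 0 keeps the set nonempty. The default \<open>1 / 0 = 0\<close>
    then occurs as a tolerance only until k reaches 1.\<close>
  define A where "A n = {k. k \<le> n \<and> (k = 0 \<or> 1 - 1 / real k \<le> P (1 / real k) n)}" for n
  define k where "k n = Max (A n)" for n
  have fin: "finite (A n)" "0 \<in> A n" for n by (auto simp: A_def)
  then have kA: "k n \<in> A n" for n
    unfolding k_def by (intro Max_in) auto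
  have large: "\<forall>\<^sub>F n in sequentially. j \<le> k n" for j
  proof (cases "j = 0")
    case False
    then have "P (1 / real j) \<longlonglongrightarrow> 1" by (intro lim) simp
    then have "\<forall>\<^sub>F n in sequentially. 1 - 1 / real j < P (1 / real j) n"
      using False by (intro order_tendstoD) auto
    then show ?thesis
      using eventually_ge_at_top[of j]
    proof eventually_elim
      case (elim n)
      then have "j \<in> A n" by (simp add: A_def)
      then show ?case unfolding k_def using fin by simp
    qed
  qed simp
  then have "filterlim k at_top sequentially" by (simp add: filterlim_at_top)
  then have "filterlim (\<lambda>n. real (k n)) at_top sequentially"
    by (rule filterlim_compose[OF filterlim_real_sequentially])
  then have \<delta>: "(\<lambda>n. 1 / real (k n)) \<longlonglongrightarrow> 0"
    by (intro tendsto_divide_0[OF tendsto_const] filterlim_at_top_imp_at_infinity)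
  then have "(\<lambda>n. 1 - 1 / real (k n)) \<longlonglongrightarrow> 1 - 0" by (intro tendsto_intros)
  then have low: "(\<lambda>n. 1 - 1 / real (k n)) \<longlonglongrightarrow> 1" by simp
  have low_le: "\<forall>\<^sub>F n in sequentially. 1 - 1 / real (k n) \<le> P (1 / real (k n)) n"
    using large[of 1]
  proof eventually_elim
    case (elim n)
    then show ?case using kA[of n] by (auto simp: A_def)
  qed
  have "\<forall>\<^sub>F n in sequentially. P (1 / real (k n)) n \<le> 1"
    using le by (intro always_eventually allI)
  then have "(\<lambda>n. P (1 / real (k n)) n) \<longlonglongrightarrow> 1"
    by (rule tendsto_sandwich[OF low_le _ low tendsto_const])
  with \<delta> show ?thesis by (rule that)
qed

text \<open>Replaces the existential quantifier by two inequalities, which define a measurable event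
  and bound \<open>x\<close> between real numbers.\<close>

lemma relative_error_iff:
  fixes x :: ereal
  assumes "0 < B" "0 \<le> a"
  shows "(\<exists>r. \<bar>r\<bar> \<le> a \<and> x = ereal ((1 + r) * B)) \<longleftrightarrow> ereal ((1 - a) * B) \<le> x \<and> x \<le> ereal ((1 + a) * B)"
proof
  assume "\<exists>r. \<bar>r\<bar> \<le> a \<and> x = ereal ((1 + r) * B)"
  then obtain r where r: "\<bar>r\<bar> \<le> a" "x = ereal ((1 + r) * B)" by blast
  then have "(1 - a) * B \<le> (1 + r) * B" "(1 + r) * B \<le> (1 + a) * B"
    using assms by (intro mult_right_mono; simp)+
  then show "ereal ((1 - a) * B) \<le> x \<and> x \<le> ereal ((1 + a) * B)" using r(2) by simp
next
  assume *: "ereal ((1 - a) * B) \<le> x \<and> x \<le> ereal ((1 + a) * B)"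
  then obtain y where y: "x = ereal y" by (cases x) auto
  define r where "r = y / B - 1"
  have eq: "y = (1 + r) * B" using assms by (simp add: r_def)
  have "(1 - a) * B \<le> (1 + r) * B" "(1 + r) * B \<le> (1 + a) * B"
    using * by (simp_all add: y eq)
  then have "\<bar>r\<bar> \<le> a" using assms(1) by auto
  then show "\<exists>r. \<bar>r\<bar> \<le> a \<and> x = ereal ((1 + r) * B)" using y eq by blast
qed

section \<open>The optimal multiplier and the final estimate\<close>

context power_law_weights
begin

text \<open>The optimal Lagrange multiplier: it maximises \<open>C\<^sub>\<gamma> n\<^bsup>1 - \<gamma>/2\<^esup> \<surd>l - l c\<close>.\<close>
definition multiplier :: "nat \<Rightarrow> real \<Rightarrow> real" where
  "multiplier n c = (C_const \<gamma> * real n powr (1 - \<gamma> / 2) / (2 * c))\<^sup>2"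

lemma multiplier_pos: "0 < n \<Longrightarrow> 0 < c \<Longrightarrow> 0 < multiplier n c"
  using C_const_pos[OF \<gamma>] by (simp add: multiplier_def)

lemma multiplier_value:
  assumes "0 < n" "0 < c"
  shows "multiplier n c * c = (C_const \<gamma>)\<^sup>2 * real n powr (2 - \<gamma>) / (4 * c)"
proof -
  have "(real n powr (1 - \<gamma> / 2))\<^sup>2 = real n powr (2 - \<gamma>)"
    using assms by (simp add: power2_eq_square flip: powr_add)
  then show ?thesis
    using assms by (simp add: multiplier_def power_divide power_mult_distrib) (simp add: power2_eq_square)
qed

lemma sqrt_multiplier:
  assumes "0 < n" "0 < c" "0 < \<rho>"
  shows "sqrt (\<rho>\<^sup>2 * multiplier n c) = \<rho> * C_const \<gamma> * real n powr (1 - \<gamma> / 2) / (2 * c)"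
  using assms C_const_pos[OF \<gamma>] by (simp add: multiplier_def real_sqrt_mult)

text \<open>The penalised minimum grows like sqrt l, so \<rho>^2 times the optimal multiplier
  changes it by the factor \<rho>; at the optimum it is twice the dual value l c. Accordingly
  \<open>x = tree_const (\<gamma> / 2)\<close> gives 2 \<rho> l c.\<close>

lemma scale_multiplier:
  assumes "0 < n" "0 < c" "0 < \<rho>"
  shows "scale n (\<rho>\<^sup>2 * multiplier n c) * (real n * x) =
    multiplier n c * c * (2 * \<rho>) * (x / tree_const (\<gamma> / 2))"
proof -
  define A where "A = area_const \<gamma> powr (- \<gamma> / 2)"
  define t where "t = tree_const (\<gamma> / 2)"
  have t: "0 < t" "C_const \<gamma> = A * t"
    using tree_const_pos[of "\<gamma> / 2"] \<gamma> by (simp_all add: t_def A_def C_const_eq)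
  have "(area_const \<gamma> * real n) powr (- \<gamma> / 2) = A * real n powr (- \<gamma> / 2)"
    using area_const_pos[OF \<gamma>(1)] by (simp add: A_def powr_mult)
  then have "scale n (\<rho>\<^sup>2 * multiplier n c) * (real n * x) =
      \<rho> * C_const \<gamma> / (2 * c) * A * x * (real n powr (1 - \<gamma> / 2) * real n powr (- \<gamma> / 2) * real n powr 1)"
    using assms by (simp add: scale_def sqrt_multiplier)
  also have "real n powr (1 - \<gamma> / 2) * real n powr (- \<gamma> / 2) * real n powr 1 = real n powr (2 - \<gamma>)"
    unfolding powr_add[symmetric] by simp
  also have "\<rho> * C_const \<gamma> / (2 * c) * A * x * real n powr (2 - \<gamma>) =
      (C_const \<gamma>)\<^sup>2 * real n powr (2 - \<gamma>) / (4 * c) * (2 * \<rho>) * (x / t)"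
    using t by (simp add: power2_eq_square field_simps)
  finally show ?thesis
    using assms by (simp add: multiplier_value t_def)
qed

text \<open>The largest threshold equals \<open>k1\<close> times the ratio in \<open>lo\<close>, and
  also the multiplier times \<open>k2\<close> times the ratio in \<open>hi\<close>. So the first
  growth condition keeps it below 1 and the second keeps it below the multiplier.\<close>

lemma scale_small:
  assumes c0: "\<forall>\<^sub>F n in sequentially. 0 < c0 n"
    and lo: "(\<lambda>n. (real n powr (1 - \<gamma>) * ln (real n) powr (\<gamma> / 2)) / c0 n) \<longlonglongrightarrow> 0"
    and hi: "(\<lambda>n. c0 n / (real n / ln (real n) powr (\<gamma> / 2))) \<longlonglongrightarrow> 0"
    and \<rho>: "0 < \<rho>"
  shows "\<forall>\<^sub>F n in sequentially. scale n (\<rho>\<^sup>2 * multiplier n (c0 n)) * (4 * ln (real n)) powr (\<gamma> / 2) \<le>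
    min 1 (\<rho>\<^sup>2 * multiplier n (c0 n))"
proof -
  define A where "A = area_const \<gamma> powr (- \<gamma> / 2)"
  define k1 where "k1 = \<rho> * C_const \<gamma> / 2 * A * 4 powr (\<gamma> / 2)"
  define k2 where "k2 = A * 4 powr (\<gamma> / 2) * 2 / (\<rho> * C_const \<gamma>)"
  have Cp: "0 < C_const \<gamma>" by (rule C_const_pos[OF \<gamma>])
  have "(\<lambda>n. k1 * ((real n powr (1 - \<gamma>) * ln (real n) powr (\<gamma> / 2)) / c0 n)) \<longlonglongrightarrow> k1 * 0"
    by (intro tendsto_intros lo)
  then have e1: "\<forall>\<^sub>F n in sequentially. k1 * ((real n powr (1 - \<gamma>) * ln (real n) powr (\<gamma> / 2)) / c0 n) < 1"
    by (rule order_tendstoD) simp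
  have "(\<lambda>n. k2 * (c0 n / (real n / ln (real n) powr (\<gamma> / 2)))) \<longlonglongrightarrow> k2 * 0"
    by (intro tendsto_intros hi)
  then have e2: "\<forall>\<^sub>F n in sequentially. k2 * (c0 n / (real n / ln (real n) powr (\<gamma> / 2))) < 1"
    by (rule order_tendstoD) simp
  show ?thesis
    using e1 e2 c0 eventually_gt_at_top[of 1]
  proof eventually_elim
    case (elim n)
    define l where "l = \<rho>\<^sup>2 * multiplier n (c0 n)"
    define g where "g = ln (real n) powr (\<gamma> / 2)"
    have n: "0 < n" "0 < real n" "0 < ln (real n)" using elim(4) by auto
    have l: "0 < l" using multiplier_pos[OF n(1) elim(3)] \<rho> by (simp add: l_def)
    have sq: "sqrt l = \<rho> * C_const \<gamma> * real n powr (1 - \<gamma> / 2) / (2 * c0 n)"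
      unfolding l_def using n(1) elim(3) \<rho> by (rule sqrt_multiplier)
    have "(area_const \<gamma> * real n) powr (- \<gamma> / 2) = A * real n powr (- \<gamma> / 2)"
      using area_const_pos[OF \<gamma>(1)] by (simp add: A_def powr_mult)
    moreover have "(4 * ln (real n)) powr (\<gamma> / 2) = 4 powr (\<gamma> / 2) * g"
      using n by (simp add: g_def powr_mult)
    ultimately have S: "scale n l * (4 * ln (real n)) powr (\<gamma> / 2) =
        sqrt l * (A * real n powr (- \<gamma> / 2) * (4 powr (\<gamma> / 2) * g))"
      by (simp add: scale_def)
    have "real n powr (1 - \<gamma> / 2) * real n powr (- \<gamma> / 2) = real n powr (1 - \<gamma>)"
      by (simp flip: powr_add)
    then have "sqrt l * (A * real n powr (- \<gamma> / 2) * (4 powr (\<gamma> / 2) * g)) = k1 * (real n powr (1 - \<gamma>) * g / c0 n)"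
      unfolding sq k1_def by (simp add: field_simps)
    then have le1: "scale n l * (4 * ln (real n)) powr (\<gamma> / 2) \<le> 1"
      using elim(1) by (simp add: S g_def)
    have "real n powr (1 - \<gamma> / 2) = real n * real n powr (- \<gamma> / 2)"
      using n powr_add[of "real n" 1 "- \<gamma> / 2"] by simp
    then have "A * real n powr (- \<gamma> / 2) * (4 powr (\<gamma> / 2) * g) = sqrt l * (k2 * (c0 n / (real n / g)))"
      unfolding sq k2_def using \<rho> Cp n elim(3) by (simp add: field_simps)
    also have "\<dots> \<le> sqrt l * 1"
      using elim(2) l by (intro mult_left_mono) (auto simp: g_def)
    finally have "sqrt l * (A * real n powr (- \<gamma> / 2) * (4 powr (\<gamma> / 2) * g)) \<le> sqrt l * sqrt l"
      using l by (intro mult_left_mono) auto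
    then have "scale n l * (4 * ln (real n)) powr (\<gamma> / 2) \<le> l"
      using l by (simp add: S)
    with le1 show ?case unfolding l_def by simp
  qed
qed

lemma typical_bounds:
  assumes tyG: "typical (\<lambda>n. \<rho>\<^sup>2 * multiplier n (c0 n)) (tree_const (\<gamma> / 2) * \<eta>\<^sup>2 / 12) n G"
    and n: "0 < n" "0 < c0 n" and \<rho>: "0 < \<rho>" "\<rho> \<le> 3" and \<omega>: "\<omega> \<in> G"
  defines "l \<equiv> multiplier n (c0 n)"
  shows "spanning_tree n T \<Longrightarrow>
      l * c0 n * (2 * \<rho> - \<eta>\<^sup>2 / 2) \<le> (\<Sum>e\<in>T. W n e \<omega> + \<rho>\<^sup>2 * l * C n e \<omega>)"
    and "\<exists>T. spanning_tree n T \<and>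
      (\<Sum>e\<in>T. W n e \<omega> + \<rho>\<^sup>2 * l * C n e \<omega>) \<le> l * c0 n * (2 * \<rho> + \<eta>\<^sup>2 / 2)"
proof -
  define t where "t = tree_const (\<gamma> / 2)"
  have t: "0 < t" using tree_const_pos[of "\<gamma> / 2"] \<gamma> by (simp add: t_def)
  have B: "0 < l * c0 n" using multiplier_pos[OF n] n by (simp add: l_def)
  note sm = scale_multiplier[OF n \<rho>(1), folded l_def t_def]
  \<comment> \<open>Explains the 12: the relative error \<eta>^2/12 is multiplied by 2 \<rho> <= 6,
    which gives the \<eta>^2/2 of \<open>dual_sandwich\<close>.\<close>
  have \<rho>\<eta>: "\<rho> * \<eta>\<^sup>2 \<le> 3 * \<eta>\<^sup>2" using \<rho> by (intro mult_right_mono) auto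
  have "2 * \<rho> - \<eta>\<^sup>2 / 2 \<le> 2 * \<rho> * ((t - t * \<eta>\<^sup>2 / 12) / t)"
    using t \<rho>\<eta> by (simp add: diff_divide_distrib right_diff_distrib)
  then have lo: "l * c0 n * (2 * \<rho> - \<eta>\<^sup>2 / 2) \<le> scale n (\<rho>\<^sup>2 * l) * (real n * (t - t * \<eta>\<^sup>2 / 12))"
    unfolding sm mult.assoc[of "l * c0 n"] using B by (intro mult_left_mono) auto
  have "2 * \<rho> * ((t + t * \<eta>\<^sup>2 / 12) / t) \<le> 2 * \<rho> + \<eta>\<^sup>2 / 2"
    using t \<rho>\<eta> by (simp add: add_divide_distrib distrib_left)
  then have hi: "scale n (\<rho>\<^sup>2 * l) * (real n * (t + t * \<eta>\<^sup>2 / 12)) \<le> l * c0 n * (2 * \<rho> + \<eta>\<^sup>2 / 2)"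
    unfolding sm mult.assoc[of "l * c0 n"] using B by (intro mult_left_mono) auto
  note T = bspec[OF conjunct2[OF tyG[unfolded typical_def, folded l_def t_def]] \<omega>]
  show "spanning_tree n T \<Longrightarrow> l * c0 n * (2 * \<rho> - \<eta>\<^sup>2 / 2) \<le> (\<Sum>e\<in>T. W n e \<omega> + \<rho>\<^sup>2 * l * C n e \<omega>)"
    using T lo by (meson order_trans)
  show "\<exists>T. spanning_tree n T \<and> (\<Sum>e\<in>T. W n e \<omega> + \<rho>\<^sup>2 * l * C n e \<omega>) \<le> l * c0 n * (2 * \<rho> + \<eta>\<^sup>2 / 2)"
    using T hi by (meson order_trans)
qed

theorem min_constrained_weight_concentration:
  assumes c0: "\<forall>\<^sub>F n in sequentially. 0 < c0 n"
    and lo: "(\<lambda>n. (real n powr (1 - \<gamma>) * ln (real n) powr (\<gamma> / 2)) / c0 n) \<longlonglongrightarrow> 0"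
    and hi: "(\<lambda>n. c0 n / (real n / ln (real n) powr (\<gamma> / 2))) \<longlonglongrightarrow> 0"
    and a: "0 < a"
  shows "(\<lambda>n. measure (M n) {\<omega> \<in> space (M n). \<exists>r. \<bar>r\<bar> \<le> a \<and>
      min_constrained_weight n (\<lambda>e. W n e \<omega>) (\<lambda>e. C n e \<omega>) (c0 n) =
      ereal ((1 + r) * ((C_const \<gamma>)\<^sup>2 * real n powr (2 - \<gamma>) / (4 * c0 n)))}) \<longlonglongrightarrow> 1"
    (is "(\<lambda>n. measure (M n) (?A n)) \<longlonglongrightarrow> 1")
proof -
  \<comment> \<open>The 10 is the factor in the conclusion of \<open>dual_sandwich\<close>.\<close>
  define \<eta> where "\<eta> = min 1 (a / 10)"
  have \<eta>: "0 < \<eta>" "\<eta> \<le> 1" "10 * \<eta> \<le> a" using a by (auto simp: \<eta>_def)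
  define \<epsilon> where "\<epsilon> = tree_const (\<gamma> / 2) * \<eta>\<^sup>2 / 12"
  have \<epsilon>: "0 < \<epsilon>" using tree_const_pos[of "\<gamma> / 2"] \<gamma> \<eta> by (simp add: \<epsilon>_def)
  define ml where "ml \<rho> n = \<rho>\<^sup>2 * multiplier n (c0 n)" for \<rho> n
  have "\<exists>G. (\<forall>\<^sub>F n in sequentially. typical (ml \<rho>) \<epsilon> n (G n)) \<and> (\<lambda>n. measure (M n) (G n)) \<longlonglongrightarrow> 1"
    if \<rho>: "0 < \<rho>" for \<rho>
  proof -
    have "\<forall>\<^sub>F n in sequentially. 0 < ml \<rho> n"
      using c0 eventually_gt_at_top[of 0]
      by eventually_elim (use \<rho> multiplier_pos in \<open>simp add: ml_def\<close>)
    then show ?thesis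
      using mst_limit[OF \<epsilon>, of "ml \<rho>"] scale_small[OF c0 lo hi \<rho>, folded ml_def] by metis
  qed
  then obtain G where G: "\<And>\<rho>. 0 < \<rho> \<Longrightarrow> \<forall>\<^sub>F n in sequentially. typical (ml \<rho>) \<epsilon> n (G \<rho> n)"
    "\<And>\<rho>. 0 < \<rho> \<Longrightarrow> (\<lambda>n. measure (M n) (G \<rho> n)) \<longlonglongrightarrow> 1"
    by metis
  \<comment> \<open>Bonferroni's lower bound for the intersection of the three events, one for each
    multiplier; hence the -2.\<close>
  define low where "low n = measure (M n) (G 1 n) + measure (M n) (G (1 + \<eta>) n) + measure (M n) (G (1 + 2 * \<eta>) n) - 2" for n
  have "low \<longlonglongrightarrow> 1 + 1 + 1 - 2"
    unfolding low_def using \<eta> by (intro tendsto_intros G(2)) auto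
  then have low: "low \<longlonglongrightarrow> 1" by simp
  have \<rho>0: "(0 :: real) < 1" "0 < 1 + \<eta>" "0 < 1 + 2 * \<eta>" using \<eta> by auto
  have low_le: "\<forall>\<^sub>F n in sequentially. low n \<le> measure (M n) (?A n)"
    using G(1)[OF \<rho>0(1)] G(1)[OF \<rho>0(2)] G(1)[OF \<rho>0(3)] c0 eventually_gt_at_top[of 0]
  proof eventually_elim
    case (elim n)
    interpret prob_space "M n" by (rule prob_M)
    define l where "l = multiplier n (c0 n)"
    define f where "f \<omega> = min_constrained_weight n (\<lambda>e. W n e \<omega>) (\<lambda>e. C n e \<omega>) (c0 n)" for \<omega>
    have n: "0 < n" "0 < c0 n" using elim by auto
    have l: "0 < l" unfolding l_def using n by (rule multiplier_pos)
    have B: "(C_const \<gamma>)\<^sup>2 * real n powr (2 - \<gamma>) / (4 * c0 n) = l * c0 n"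
      unfolding l_def using multiplier_value[OF n] by simp
    have Bpos: "0 < l * c0 n" using l n by simp
    have rv: "W n e \<in> borel_measurable (M n)" "C n e \<in> borel_measurable (M n)" if "e \<in> complete_edges n" for e
      using weighted_sums_indep(2)[OF indep that] indep_var_rv1 indep_var_rv2 by blast+
    have fm [measurable]: "f \<in> borel_measurable (M n)"
      unfolding f_def[abs_def] using rv by (intro min_constrained_weight_measurable)
    have A: "?A n = {\<omega> \<in> space (M n). ereal ((1 - a) * (l * c0 n)) \<le> f \<omega> \<and> f \<omega> \<le> ereal ((1 + a) * (l * c0 n))}"
      unfolding B f_def[symmetric] relative_error_iff[OF Bpos less_imp_le[OF a]] ..
    have Aev: "?A n \<in> events" unfolding A by measurable
    have Gev: "G 1 n \<in> events" "G (1 + \<eta>) n \<in> events" "G (1 + 2 * \<eta>) n \<in> events"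
      using elim by (simp_all add: typical_def)
    have "G 1 n \<inter> G (1 + \<eta>) n \<inter> G (1 + 2 * \<eta>) n \<subseteq> ?A n"
    proof
      fix \<omega> assume "\<omega> \<in> G 1 n \<inter> G (1 + \<eta>) n \<inter> G (1 + 2 * \<eta>) n"
      then have \<omega>: "\<omega> \<in> G 1 n" "\<omega> \<in> G (1 + \<eta>) n" "\<omega> \<in> G (1 + 2 * \<eta>) n" by auto
      have \<rho>: "0 < 1 + \<eta>" "1 + \<eta> \<le> 3" "0 < 1 + 2 * \<eta>" "1 + 2 * \<eta> \<le> 3" using \<eta> by auto
      note t1 = typical_bounds(1)[where \<rho> = 1, OF elim(1)[unfolded ml_def \<epsilon>_def] n _ _ \<omega>(1), folded l_def]
      note t2 = typical_bounds(2)[OF elim(2)[unfolded ml_def \<epsilon>_def] n \<rho>(1,2) \<omega>(2), folded l_def]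
      note t3 = typical_bounds(1)[OF elim(3)[unfolded ml_def \<epsilon>_def] n \<rho>(3,4) \<omega>(3), folded l_def]
      have t1': "l * c0 n * (2 - \<eta>\<^sup>2 / 2) \<le> (\<Sum>e\<in>T. W n e \<omega> + l * C n e \<omega>)" if "spanning_tree n T" for T
        using t1[OF _ _ that] by simp
      have "ereal ((1 - 10 * \<eta>) * (l * c0 n)) \<le> f \<omega>" "f \<omega> \<le> ereal ((1 + 10 * \<eta>) * (l * c0 n))"
        unfolding f_def
        by (rule dual_sandwich[OF \<eta>(1,2) l n(2) t1' t2 t3]; assumption)+
      moreover have "(1 - a) * (l * c0 n) \<le> (1 - 10 * \<eta>) * (l * c0 n)"
        "(1 + 10 * \<eta>) * (l * c0 n) \<le> (1 + a) * (l * c0 n)"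
        using \<eta>(3) Bpos by (intro mult_right_mono; simp)+
      ultimately have "ereal ((1 - a) * (l * c0 n)) \<le> f \<omega>" "f \<omega> \<le> ereal ((1 + a) * (l * c0 n))"
        by (meson ereal_less_eq(3) order_trans)+
      moreover have "\<omega> \<in> space (M n)"
        using sets.sets_into_space[OF Gev(1)] \<omega>(1) by auto
      ultimately show "\<omega> \<in> ?A n" unfolding A by simp
    qed
    then have "prob (G 1 n \<inter> G (1 + \<eta>) n \<inter> G (1 + 2 * \<eta>) n) \<le> prob (?A n)"
      using Aev by (rule finite_measure_mono)
    moreover have "low n \<le> prob (G 1 n \<inter> G (1 + \<eta>) n \<inter> G (1 + 2 * \<eta>) n)"
      using prob_Int_ge[OF Gev(1,2)] prob_Int_ge[OF sets.Int[OF Gev(1,2)] Gev(3)] unfolding low_def by linarith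
    ultimately show ?case by linarith
  qed
  have "\<forall>\<^sub>F n in sequentially. measure (M n) (?A n) \<le> 1"
    using prob_M by (intro always_eventually allI prob_space.prob_le_1)
  then show ?thesis
    by (rule tendsto_sandwich[OF low_le _ low tendsto_const])
qed

end

theorem theorem2:
  fixes \<gamma> :: real
    and M :: "nat \<Rightarrow> 'a measure"
    and W C :: "nat \<Rightarrow> nat set \<Rightarrow> 'a \<Rightarrow> real"
    and c0 :: "nat \<Rightarrow> real"
  assumes "0 < \<gamma>" and "\<gamma> < 1"
    and "\<And>n. prob_space (M n)"
    and "\<And>n e. e \<in> complete_edges n \<Longrightarrow> distr (M n) borel (W n e) = uniform_power_law \<gamma>"
    and "\<And>n e. e \<in> complete_edges n \<Longrightarrow> distr (M n) borel (C n e) = uniform_power_law \<gamma>"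
    and "\<And>n. prob_space.indep_vars (M n) (\<lambda>_. borel) (case_sum (W n) (C n))
               (complete_edges n <+> complete_edges n)"
    and "\<forall>\<^sub>F n in sequentially. 0 < c0 n"
    and "(\<lambda>n. (real n powr (1 - \<gamma>) * ln (real n) powr (\<gamma> / 2)) / c0 n) \<longlonglongrightarrow> 0"
    and "(\<lambda>n. c0 n / (real n / ln (real n) powr (\<gamma> / 2))) \<longlonglongrightarrow> 0"
  shows "whp_approx M
           (\<lambda>n \<omega>. min_constrained_weight n (\<lambda>e. W n e \<omega>) (\<lambda>e. C n e \<omega>) (c0 n))
           (\<lambda>n. (C_const \<gamma>)\<^sup>2 * real n powr (2 - \<gamma>) / (4 * c0 n))"
proof -
  interpret power_law_weights \<gamma> M W C
    by (rule power_law_weights.intro[OF assms(1-6)])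
  let ?B = "\<lambda>n. (C_const \<gamma>)\<^sup>2 * real n powr (2 - \<gamma>) / (4 * c0 n)"
  let ?P = "\<lambda>a n. measure (M n) {\<omega> \<in> space (M n). \<exists>r. \<bar>r\<bar> \<le> a \<and>
      min_constrained_weight n (\<lambda>e. W n e \<omega>) (\<lambda>e. C n e \<omega>) (c0 n) = ereal ((1 + r) * ?B n)}"
  have "?P a \<longlonglongrightarrow> 1" if "0 < a" for a
    using assms(7-9) that by (rule min_constrained_weight_concentration)
  moreover have "?P a n \<le> 1" for a n
    by (rule prob_space.prob_le_1[OF prob_M])
  ultimately obtain \<delta> where "\<delta> \<longlonglongrightarrow> 0" "(\<lambda>n. ?P (\<delta> n) n) \<longlonglongrightarrow> 1"
    by (rule diagonal_error_bound[of ?P])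
  then show ?thesis
    unfolding whp_approx_def by blast
qed

end
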